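(* Let $\mathcal{H}$ be a normalized complete Pick space of continuous functions on a compact set (compact topological space) $X$ such that $X$ is a maximal domain for $\mathcal{H}$ and such that $\mathrm{Mult}(\mathcal{H})$ separates the points of $X$. Then the following are equivalent. (i) $\mathrm{Mult}(\mathcal{H}) = \mathcal{H}$ as vector spaces. (ii) The corona theorem holds for $\mathrm{Mult}(\mathcal{H})$, that is, the maximal ideal space of $\mathrm{Mult}(\mathcal{H})$ is $X$ (every character on $\mathrm{Mult}(\mathcal{H})$ is evaluation at a point of $X$). (iii) The one-function corona theorem holds for $\mathrm{Mult}(\mathcal{H})$, that is, if $\varphi \in \mathrm{Mult}(\mathcal{H})$ is non-vanishing on $X$, then $1/\varphi \in \mathrm{Mult}(\mathcal{H})$.
   Context: $\mathcal{H}$ is a reproducing kernel Hilbert space of complex-valued functions on a set $X$ with reproducing kernel $k$, and it is assumed that $k$ does not vanish on the diagonal. The multiplier algebra is $\mathrm{Mult}(\mathcal{H}) = \{\varphi : X \to \mathbb{C} : \varphi f \in \mathcal{H} \text{ for all } f \in \mathcal{H}\}$; each $\varphi \in \mathrm{Mult}(\mathcal{H})$ gives a bounded multiplication operator $M_\varphi$ on $\mathcal{H}$, and $\|\varphi\|_{\mathrm{Mult}(\mathcal{H})} = \|M_\varphi\|$. $\mathcal{H}$ is normalized if there is a point $x_0 \in X$ such that $k(x,x_0) = 1$ for all $x \in X$. $\mathcal{H}$ is a complete Pick space if for every $r \in \mathbb{N}$ and every finite collection of points $z_1,\ldots,z_n \in X$ and matrices $W_1,\ldots,W_n \in M_r(\mathbb{C})$,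 positive semidefiniteness of the $nr \times nr$ block matrix $[k(z_i,z_j)(I_{\mathbb{C}^r} - W_i W_j^* )]_{i,j=1}^n$ implies that there exists $\Phi \in M_r(\mathrm{Mult}(\mathcal{H}))$ of norm at most $1$ (as a multiplication operator on $\mathcal{H} \otimes \mathbb{C}^r$) with $\Phi(z_i) = W_i$ for $i=1,\ldots,n$. A non-zero bounded linear functional $\rho$ on $\mathcal{H}$ is partially multiplicative if $\rho(fg) = \rho(f)\rho(g)$ whenever $f,g \in \mathcal{H}$ are such that $fg \in \mathcal{H}$. $X$ is a maximal domain for $\mathcal{H}$ if every partially multiplicative functional on $\mathcal{H}$ is given by evaluation at a point in $X$. A character on $\mathrm{Mult}(\mathcal{H})$ is a non-zero multiplicative linear functional; the maximal ideal space of $\mathrm{Mult}(\mathcal{H})$ is the set of its characters, and $X$ is identified with a subset of it via point evaluations. *)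

theory Defs
  imports Complex_Main "HOL-Library.FuncSet" "Jordan_Normal_Form.Schur_Decomposition"
begin

text \<open>
  The set \<open>X\<close> is the universe of the type \<open>'x\<close>. A Hilbert function space is given by the set \<open>H\<close>
  of its elements and its inner product \<open>ip\<close>, which is linear in the first argument; the values of
  \<open>ip\<close> outside \<open>H\<close> are irrelevant. The vector space operations are the pointwise ones.
\<close>

definition fun_norm :: "(('x \<Rightarrow> complex) \<Rightarrow> ('x \<Rightarrow> complex) \<Rightarrow> complex) \<Rightarrow> ('x \<Rightarrow> complex) \<Rightarrow> real" where
  "fun_norm ip f = sqrt (Re (ip f f))"

locale rkhs =
  fixes H :: "('x \<Rightarrow> complex) set"
    and ip :: "('x \<Rightarrow> complex) \<Rightarrow> ('x \<Rightarrow> complex) \<Rightarrow> complex"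
    and k :: "'x \<Rightarrow> 'x \<Rightarrow> complex"
  assumes zero_mem: "(\<lambda>x. 0) \<in> H"
    and add_mem: "\<And>f g. f \<in> H \<Longrightarrow> g \<in> H \<Longrightarrow> (\<lambda>x. f x + g x) \<in> H"
    and scale_mem: "\<And>c f. f \<in> H \<Longrightarrow> (\<lambda>x. c * f x) \<in> H"
    and ip_add: "\<And>f g h. f \<in> H \<Longrightarrow> g \<in> H \<Longrightarrow> h \<in> H \<Longrightarrow> ip (\<lambda>x. f x + g x) h = ip f h + ip g h"
    and ip_scale: "\<And>c f h. f \<in> H \<Longrightarrow> h \<in> H \<Longrightarrow> ip (\<lambda>x. c * f x) h = c * ip f h"
    and ip_cnj: "\<And>f g. f \<in> H \<Longrightarrow> g \<in> H \<Longrightarrow> ip g f = cnj (ip f g)"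
    and ip_nonneg: "\<And>f. f \<in> H \<Longrightarrow> 0 \<le> Re (ip f f)"
    and ip_definite: "\<And>f. f \<in> H \<Longrightarrow> ip f f = 0 \<Longrightarrow> f = (\<lambda>x. 0)"
    and complete: "\<And>F :: nat \<Rightarrow> 'x \<Rightarrow> complex.
          (\<And>n. F n \<in> H) \<Longrightarrow>
          (\<And>e. e > 0 \<Longrightarrow> \<exists>N. \<forall>m\<ge>N. \<forall>n\<ge>N. fun_norm ip (\<lambda>x. F m x - F n x) < e) \<Longrightarrow>
          \<exists>f\<in>H. (\<lambda>n. fun_norm ip (\<lambda>x. F n x - f x)) \<longlonglongrightarrow> 0"
    and kernel_mem: "\<And>y. (\<lambda>x. k x y) \<in> H"
    and reproducing: "\<And>f y. f \<in> H \<Longrightarrow> f y = ip f (\<lambda>x. k x y)"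

definition normalized_kernel :: "('x \<Rightarrow> 'x \<Rightarrow> complex) \<Rightarrow> bool" where
  "normalized_kernel k \<longleftrightarrow> (\<exists>x0. \<forall>x. k x x0 = 1)"

definition Mult :: "('x \<Rightarrow> complex) set \<Rightarrow> ('x \<Rightarrow> complex) set" where
  "Mult H = {\<phi>. \<forall>f\<in>H. (\<lambda>x. \<phi> x * f x) \<in> H}"

text \<open>
  In the order on complex numbers, \<open>0 \<le> z\<close> means that \<open>z\<close> is real and nonnegative. Since the
  scalars are complex, the condition below includes that \<open>A\<close> is Hermitian.
\<close>

definition pos_semidef :: "complex mat \<Rightarrow> bool" where
  "pos_semidef A \<longleftrightarrow> square_mat A \<and> (\<forall>v\<in>carrier_vec (dim_row A). 0 \<le> (A *\<^sub>v v) \<bullet>c v)"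

text \<open>
  The \<open>n r \<times> n r\<close> block matrix whose \<open>r \<times> r\<close> block at position \<open>(i, j)\<close> is
  \<open>k (z i) (z j) (I - W i (W j)\<^sup>*)\<close>; indices start at \<open>0\<close>.
\<close>

definition pick_matrix ::
    "('x \<Rightarrow> 'x \<Rightarrow> complex) \<Rightarrow> nat \<Rightarrow> nat \<Rightarrow> (nat \<Rightarrow> 'x) \<Rightarrow> (nat \<Rightarrow> complex mat) \<Rightarrow> complex mat" where
  "pick_matrix k r n z W = mat (n * r) (n * r) (\<lambda>(p, q).
     let i = p div r; j = q div r in
       (k (z i) (z j) \<cdot>\<^sub>m (1\<^sub>m r - W i * mat_adjoint (W j))) $$ (p mod r, q mod r))"

definition mat_Mult :: "nat \<Rightarrow> ('x \<Rightarrow> complex) set \<Rightarrow> ('x \<Rightarrow> complex mat) set" where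
  "mat_Mult r H = {\<Phi>. (\<forall>x. \<Phi> x \<in> carrier_mat r r) \<and>
                      (\<forall>a<r. \<forall>b<r. (\<lambda>x. \<Phi> x $$ (a, b)) \<in> Mult H)}"

text \<open>
  The Hilbert space \<open>H \<otimes> \<complex>\<^sup>r\<close>, realized as the space of \<open>\<complex>\<^sup>r\<close>-valued functions whose components
  belong to \<open>H\<close>.
\<close>

definition tensor_space :: "nat \<Rightarrow> ('x \<Rightarrow> complex) set \<Rightarrow> ('x \<Rightarrow> complex vec) set" where
  "tensor_space r H = {F. (\<forall>x. F x \<in> carrier_vec r) \<and> (\<forall>a<r. (\<lambda>x. F x $ a) \<in> H)}"

definition tensor_norm ::
    "nat \<Rightarrow> (('x \<Rightarrow> complex) \<Rightarrow> ('x \<Rightarrow> complex) \<Rightarrow> complex) \<Rightarrow> ('x \<Rightarrow> complex vec) \<Rightarrow> real" where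
  "tensor_norm r ip F = sqrt (\<Sum>a<r. (fun_norm ip (\<lambda>x. F x $ a))\<^sup>2)"

definition mult_norm_le_1 ::
    "nat \<Rightarrow> ('x \<Rightarrow> complex) set \<Rightarrow> (('x \<Rightarrow> complex) \<Rightarrow> ('x \<Rightarrow> complex) \<Rightarrow> complex) \<Rightarrow>
     ('x \<Rightarrow> complex mat) \<Rightarrow> bool" where
  "mult_norm_le_1 r H ip \<Phi> \<longleftrightarrow>
     (\<forall>F\<in>tensor_space r H. tensor_norm r ip (\<lambda>x. \<Phi> x *\<^sub>v F x) \<le> tensor_norm r ip F)"

definition complete_pick ::
    "('x \<Rightarrow> complex) set \<Rightarrow> (('x \<Rightarrow> complex) \<Rightarrow> ('x \<Rightarrow> complex) \<Rightarrow> complex) \<Rightarrow>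
     ('x \<Rightarrow> 'x \<Rightarrow> complex) \<Rightarrow> bool" where
  "complete_pick H ip k \<longleftrightarrow>
     (\<forall>r n. \<forall>z :: nat \<Rightarrow> 'x. \<forall>W :: nat \<Rightarrow> complex mat.
        (\<forall>i<n. W i \<in> carrier_mat r r) \<longrightarrow> pos_semidef (pick_matrix k r n z W) \<longrightarrow>
        (\<exists>\<Phi>\<in>mat_Mult r H. mult_norm_le_1 r H ip \<Phi> \<and> (\<forall>i<n. \<Phi> (z i) = W i)))"

definition linear_functional_on :: "('x \<Rightarrow> complex) set \<Rightarrow> (('x \<Rightarrow> complex) \<Rightarrow> complex) \<Rightarrow> bool" where
  "linear_functional_on S \<rho> \<longleftrightarrow>
     (\<forall>f\<in>S. \<forall>g\<in>S. \<rho> (\<lambda>x. f x + g x) = \<rho> f + \<rho> g) \<and>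
     (\<forall>c. \<forall>f\<in>S. \<rho> (\<lambda>x. c * f x) = c * \<rho> f)"

definition partially_multiplicative ::
    "('x \<Rightarrow> complex) set \<Rightarrow> (('x \<Rightarrow> complex) \<Rightarrow> ('x \<Rightarrow> complex) \<Rightarrow> complex) \<Rightarrow>
     (('x \<Rightarrow> complex) \<Rightarrow> complex) \<Rightarrow> bool" where
  "partially_multiplicative H ip \<rho> \<longleftrightarrow>
     linear_functional_on H \<rho> \<and>
     (\<exists>C. \<forall>f\<in>H. cmod (\<rho> f) \<le> C * fun_norm ip f) \<and>
     (\<exists>f\<in>H. \<rho> f \<noteq> 0) \<and>
     (\<forall>f\<in>H. \<forall>g\<in>H. (\<lambda>x. f x * g x) \<in> H \<longrightarrow> \<rho> (\<lambda>x. f x * g x) = \<rho> f * \<rho> g)"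

definition maximal_domain ::
    "('x \<Rightarrow> complex) set \<Rightarrow> (('x \<Rightarrow> complex) \<Rightarrow> ('x \<Rightarrow> complex) \<Rightarrow> complex) \<Rightarrow> bool" where
  "maximal_domain H ip \<longleftrightarrow>
     (\<forall>\<rho>. partially_multiplicative H ip \<rho> \<longrightarrow> (\<exists>y. \<forall>f\<in>H. \<rho> f = f y))"

definition separates_points :: "('x \<Rightarrow> complex) set \<Rightarrow> bool" where
  "separates_points S \<longleftrightarrow> (\<forall>x y. x \<noteq> y \<longrightarrow> (\<exists>f\<in>S. f x \<noteq> f y))"

text \<open>
  Functionals on an algebra \<open>A\<close> of functions are made unique as total functions by letting them be
  \<open>undefined\<close> outside \<open>A\<close>.
\<close>

definition maximal_ideal_space :: "('x \<Rightarrow> complex) set \<Rightarrow> (('x \<Rightarrow> complex) \<Rightarrow> complex) set" where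
  "maximal_ideal_space A = {\<chi> \<in> extensional A.
     linear_functional_on A \<chi> \<and>
     (\<forall>\<phi>\<in>A. \<forall>\<psi>\<in>A. \<chi> (\<lambda>x. \<phi> x * \<psi> x) = \<chi> \<phi> * \<chi> \<psi>) \<and>
     (\<exists>\<phi>\<in>A. \<chi> \<phi> \<noteq> 0)}"

definition point_evaluation :: "('x \<Rightarrow> complex) set \<Rightarrow> 'x \<Rightarrow> ('x \<Rightarrow> complex) \<Rightarrow> complex" where
  "point_evaluation A x = (\<lambda>\<phi>\<in>A. \<phi> x)"

definition corona_theorem :: "('x \<Rightarrow> complex) set \<Rightarrow> bool" where
  "corona_theorem A \<longleftrightarrow> maximal_ideal_space A = range (point_evaluation A)"

definition one_function_corona_theorem :: "('x \<Rightarrow> complex) set \<Rightarrow> bool" where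
  "one_function_corona_theorem A \<longleftrightarrow>
     (\<forall>\<phi>\<in>A. (\<forall>x. \<phi> x \<noteq> 0) \<longrightarrow> (\<lambda>x. 1 / \<phi> x) \<in> A)"

end

theory Submission
  imports Defs "HOL-Analysis.Topology_Euclidean_Space" "HOL-Library.Function_Algebras"
begin

text \<open>
  The three conditions are proved equivalent in a circle. Write \<open>\<parallel>\<cdot>\<parallel>\<close> for the norm of \<open>H\<close> and \<open>k\<^sub>w\<close> for the
  kernel at \<open>w\<close>.

  If \<open>Mult H = H\<close>, then multiplication on \<open>H\<close> is jointly continuous by the uniform boundedness principle
  (\<open>multipliers_uniformly_bounded\<close>), so \<open>H\<close> is a Banach algebra in an equivalent norm and its characters
  are bounded. A bounded character is partially multiplicative, hence a point evaluation because the domain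
  is maximal (\<open>Mult_eq_imp_corona\<close>).

  If all characters of \<open>Mult H\<close> are point evaluations, then a non-vanishing multiplier lies in the kernel of
  no character, hence in no maximal ideal by the Gelfand--Mazur theorem, and so it is invertible
  (\<open>corona_imp_one_function_corona\<close>). The Gelfand--Mazur theorem is proved for seminorms
  (\<open>gelfand_mazur\<close>), with averages over roots of unity in place of complex function theory.

  The remaining implication rests on the fact that in a normalized complete Pick space every \<open>f\<close> in \<open>H\<close> is a
  quotient of multipliers with non-vanishing denominator. If reciprocals of non-vanishing multipliers are
  multipliers, then so is \<open>f\<close> (\<open>one_function_corona_imp_Mult_eq\<close>). The quotient is explicit. Put
  \<open>V z = \<langle>f, k\<^sub>z f\<rangle>\<close>. Then \<open>2 Re \<langle>V u, u\<rangle> \<ge> \<parallel>f u\<parallel>\<^sup>2 + \<parallel>f\<parallel>\<^sup>2 \<parallel>u\<parallel>\<^sup>2\<close> for linear combinations \<open>u\<close> of kernels, in a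
  suitable sense (\<open>sarason_inequality\<close>). From this it follows that \<open>1 / (V + 1)\<close> is a contractive multiplier
  and that \<open>f / (V + 1)\<close> is a multiplier.

  The inequality comes from the structure of complete Pick kernels: on every finite set of points
  \<open>1 - 1 / k\<close> is the Gram kernel of a finite row of functions which extends to a contractive row of
  multipliers (\<open>kernel_reciprocal_gram\<close>). Since the rows change with the finite set, each consequence is first
  drawn on finite sets with uniform norm bounds and then transferred to \<open>H\<close> by the principle that a function
  which agrees on every finite set with an element of norm at most \<open>C\<close> is itself such an element
  (\<open>membership_finite_agreement\<close>).
\<close>

section \<open>The Gelfand--Mazur theorem for seminormed algebras\<close>

lemma sum_powers_root_of_unity:
  assumes "0 < j" "j < N"
  shows "(\<Sum>k<N. (cis (2 * pi / real N) ^ k) ^ j) = 0"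
proof -
  let ?z = "cis (2 * pi / real N) ^ j"
  have N: "real N > 0" using assms by simp
  have "?z \<noteq> 1"
  proof
    assume "?z = 1"
    hence "cis (real j * (2 * pi / real N)) = 1" by (simp add: DeMoivre)
    hence "cos (real j * (2 * pi / real N)) = 1" by (metis cis.sel(1) one_complex.sel(1))
    then obtain i :: int where "real j * (2 * pi / real N) = of_int i * (2 * pi)"
      using cos_one_2pi_int by (metis mult.commute mult.left_commute)
    hence "real j = of_int i * real N" using N by (simp add: field_simps)
    hence "int j = i * int N" by (metis of_int_eq_iff of_int_mult of_int_of_nat_eq)
    hence "int N dvd int j" by simp
    hence "N dvd j" by simp
    thus False using assms by (auto dest: dvd_imp_le)
  qed
  moreover have "?z ^ N = 1"
  proof -
    have "?z ^ N = (cis (2 * pi / real N) ^ N) ^ j" by (metis power_mult mult.commute)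
    also have "cis (2 * pi / real N) ^ N = 1" using N by (simp add: DeMoivre)
    finally show ?thesis by simp
  qed
  ultimately have "(\<Sum>k<N. ?z ^ k) = 0" by (simp add: geometric_sum)
  moreover have "(cis (2 * pi / real N) ^ k) ^ j = ?z ^ k" for k
    by (metis power_mult mult.commute)
  ultimately show ?thesis by simp
qed

text \<open>
  The map \<open>e\<close> embeds the scalars. The set \<open>A\<close> stands for an algebra and the null space of \<open>q\<close> for an
  ideal; keeping \<open>q\<close> a seminorm on \<open>A\<close> avoids the passage to a quotient type.
\<close>

locale seminormed_algebra =
  fixes A :: "'a::comm_ring_1 set" and e :: "complex \<Rightarrow> 'a" and q :: "'a \<Rightarrow> real"
  assumes e_mem: "e c \<in> A"
    and add_mem: "a \<in> A \<Longrightarrow> b \<in> A \<Longrightarrow> a + b \<in> A"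
    and mult_mem: "a \<in> A \<Longrightarrow> b \<in> A \<Longrightarrow> a * b \<in> A"
    and e_add: "e (c + d) = e c + e d"
    and e_mult: "e (c * d) = e c * e d"
    and e_1: "e 1 = 1"
    and q_nonneg: "a \<in> A \<Longrightarrow> 0 \<le> q a"
    and q_add: "a \<in> A \<Longrightarrow> b \<in> A \<Longrightarrow> q (a + b) \<le> q a + q b"
    and q_scale: "a \<in> A \<Longrightarrow> q (e c * a) \<le> cmod c * q a"
    and q_mult: "a \<in> A \<Longrightarrow> b \<in> A \<Longrightarrow> q (a * b) \<le> q a * q b"
    and q_one: "q 1 > 0"
begin

lemma e_0: "e 0 = 0"
  using e_add[of 0 0] by simp

lemma e_minus: "e (- c) = - e c"
  using e_add[of c "- c"] e_0 by (simp add: eq_neg_iff_add_eq_0 add.commute)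

lemma e_diff: "e (c - d) = e c - e d"
  using e_add[of c "- d"] e_minus by simp

lemma e_power: "e (c ^ n) = e c ^ n"
  by (induction n) (simp_all add: e_1 e_mult)

lemma e_sum: "e (sum c S) = (\<Sum>i\<in>S. e (c i))"
  by (induction S rule: infinite_finite_induct) (simp_all add: e_0 e_add)

lemma one_mem: "1 \<in> A" using e_mem[of 1] e_1 by simp

lemma zero_mem: "0 \<in> A" using e_mem[of 0] e_0 by simp

lemma uminus_mem: "a \<in> A \<Longrightarrow> - a \<in> A"
  using mult_mem[OF e_mem[of "-1"], of a] by (simp add: e_minus e_1)

lemma minus_mem: "a \<in> A \<Longrightarrow> b \<in> A \<Longrightarrow> a - b \<in> A"
  using add_mem[OF _ uminus_mem, of a b] by simp

lemma power_mem: "a \<in> A \<Longrightarrow> a ^ n \<in> A"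
  by (induction n) (auto simp: one_mem mult_mem)

lemma sum_mem: "(\<And>i. i \<in> S \<Longrightarrow> f i \<in> A) \<Longrightarrow> sum f S \<in> A"
  by (induction S rule: infinite_finite_induct) (auto simp: zero_mem add_mem)

lemmas mem = e_mem add_mem mult_mem one_mem zero_mem uminus_mem minus_mem power_mem sum_mem

lemma q_zero: "q 0 = 0"
  using q_scale[OF one_mem, of 0] q_nonneg[OF zero_mem] by (simp add: e_0)

lemma q_uminus: "a \<in> A \<Longrightarrow> q (- a) = q a"
  using q_scale[of a "-1"] q_scale[of "- a" "-1"] by (simp add: e_minus e_1 uminus_mem)

lemma q_sum: "(\<And>i. i \<in> S \<Longrightarrow> f i \<in> A) \<Longrightarrow> q (sum f S) \<le> (\<Sum>i\<in>S. q (f i))"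
proof (induction S rule: infinite_finite_induct)
  case (insert i S)
  have "q (f i + sum f S) \<le> q (f i) + q (sum f S)"
    by (rule q_add) (auto intro!: sum_mem insert.prems)
  with insert show ?case by fastforce
qed (simp_all add: q_zero)

lemma q_power: "a \<in> A \<Longrightarrow> n > 0 \<Longrightarrow> q (a ^ n) \<le> q a ^ n"
proof (induction n)
  case (Suc n)
  show ?case
  proof (cases "n = 0")
    case False
    have "q (a * a ^ n) \<le> q a * q (a ^ n)" using Suc.prems by (intro q_mult mem)
    also have "\<dots> \<le> q a * q a ^ n" using Suc False by (intro mult_left_mono q_nonneg) auto
    finally show ?thesis by simp
  qed simp
qed simp

definition null :: "'a set" where "null = {a \<in> A. q a = 0}"

lemma null_memI: "a \<in> A \<Longrightarrow> q a \<le> 0 \<Longrightarrow> a \<in> null"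
  unfolding null_def using q_nonneg by force

lemma null_add: "a \<in> null \<Longrightarrow> b \<in> null \<Longrightarrow> a + b \<in> null"
  using q_add[of a b] by (intro null_memI) (auto simp: null_def intro: mem)

lemma null_mult: "a \<in> A \<Longrightarrow> b \<in> null \<Longrightarrow> a * b \<in> null"
  using q_mult[of a b] by (intro null_memI) (auto simp: null_def intro: mem)

lemma null_uminus: "a \<in> null \<Longrightarrow> - a \<in> null"
  by (simp add: null_def q_uminus uminus_mem)

lemma null_diff: "a \<in> null \<Longrightarrow> b \<in> null \<Longrightarrow> a - b \<in> null"
  using null_add[OF _ null_uminus, of a b] by simp

lemma null_sum: "(\<And>i. i \<in> S \<Longrightarrow> f i \<in> null) \<Longrightarrow> sum f S \<in> null"
  by (induction S rule: infinite_finite_induct)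
     (auto simp: null_add intro!: null_memI mem simp: q_zero)

lemma q_add_null: "a \<in> A \<Longrightarrow> n \<in> null \<Longrightarrow> q (a + n) = q a"
  using q_add[of a n] q_add[of "a + n" "- n"] null_uminus[of n]
  by (simp add: null_def add_mem)

lemma resolvent_identity:
  assumes "x \<in> A" "R \<in> A" "S \<in> A" "R * (x - e l) - 1 \<in> null" "S * (x - e m) - 1 \<in> null"
  shows "R - S - e (l - m) * R * S \<in> null"
proof -
  have "R - S - e (l - m) * R * S = S * (R * (x - e l) - 1) - R * (S * (x - e m) - 1)"
    by (simp add: algebra_simps e_diff)
  also have "\<dots> \<in> null" by (intro null_diff null_mult assms)
  finally show ?thesis .
qed

text \<open>
  The quantitative content of the identity
  \<open>1/n \<Sum> a (1 - w \<omega>\<^sup>k a)\<^sup>-\<^sup>1 = a (1 - w\<^sup>n a\<^sup>n)\<^sup>-\<^sup>1\<close> over the \<open>n\<close>-th roots of unity, applied to a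
  resolvent value \<open>a = R m\<close>, for which \<open>a (1 - c a)\<^sup>-\<^sup>1\<close> is \<open>R (m + c)\<close>. It is a discrete substitute
  for the mean value property of the resolvent, so that neither integrals nor functionals on the
  algebra are needed.
\<close>

lemma resolvent_mean_bound:
  fixes w m :: complex
  assumes x: "x \<in> A" and R: "\<And>l. R l \<in> A" "\<And>l. R l * (x - e l) - 1 \<in> null"
    and N: "N > 0"
  defines "c \<equiv> \<lambda>k. w * cis (2 * pi / real N) ^ k"
  shows "real N * q (R m) \<le> (1 + (cmod w * q (R m)) ^ N) * (\<Sum>k<N. q (R (m + c k)))"
proof -
  define a where "a = R m"
  have aA: "a \<in> A" using R by (simp add: a_def)
  define S where "S = (\<Sum>k<N. R (m + c k))"
  have SA: "S \<in> A" unfolding S_def by (intro mem R)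
  define d where "d = (\<lambda>k. R (m + c k) - a - e (c k) * R (m + c k) * a)"
  have d: "d k \<in> null" for k
    using resolvent_identity[OF x R(1) R(1) R(2) R(2), of "m + c k" m] by (simp add: d_def a_def)
  have cN: "c k ^ N = w ^ N" for k
  proof -
    have "(cis (2 * pi / real N) ^ k) ^ N = (cis (2 * pi / real N) ^ N) ^ k"
      by (metis power_mult mult.commute)
    also have "cis (2 * pi / real N) ^ N = 1" using N by (simp add: DeMoivre)
    finally show ?thesis by (simp add: c_def power_mult_distrib)
  qed
  have geo: "R (m + c k) * (1 - e (w ^ N) * a ^ N)
      = (\<Sum>j<N. e (c k ^ j) * a ^ Suc j) + (\<Sum>j<N. (e (c k) * a) ^ j) * d k" for k
  proof -
    have "1 - e (w ^ N) * a ^ N = 1 - (e (c k) * a) ^ N"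
      by (simp add: power_mult_distrib cN flip: e_power)
    also have "\<dots> = (1 - e (c k) * a) * (\<Sum>j<N. (e (c k) * a) ^ j)"
      by (rule one_diff_power_eq)
    finally have "R (m + c k) * (1 - e (w ^ N) * a ^ N)
        = (R (m + c k) * (1 - e (c k) * a)) * (\<Sum>j<N. (e (c k) * a) ^ j)"
      by (simp add: mult.assoc)
    also have "R (m + c k) * (1 - e (c k) * a) = a + d k"
      by (simp add: d_def algebra_simps)
    finally show ?thesis
      by (simp add: algebra_simps sum_distrib_left power_mult_distrib e_power)
  qed
  define n where "n = (\<Sum>k<N. (\<Sum>j<N. (e (c k) * a) ^ j) * d k)"
  have n: "n \<in> null" unfolding n_def by (intro null_sum null_mult d mem aA)
  have "S * (1 - e (w ^ N) * a ^ N) = (\<Sum>k<N. \<Sum>j<N. e (c k ^ j) * a ^ Suc j) + n"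
    by (simp only: S_def sum_distrib_right geo sum.distrib n_def)
  also have "(\<Sum>k<N. \<Sum>j<N. e (c k ^ j) * a ^ Suc j) = (\<Sum>j<N. e (\<Sum>k<N. c k ^ j) * a ^ Suc j)"
    by (subst sum.swap) (simp only: e_sum sum_distrib_right)
  also have "\<dots> = (\<Sum>j<N. if j = 0 then e (of_nat N) * a else 0)"
  proof (rule sum.cong)
    fix j assume j: "j \<in> {..<N}"
    show "e (\<Sum>k<N. c k ^ j) * a ^ Suc j = (if j = 0 then e (of_nat N) * a else 0)"
    proof (cases "j = 0")
      case False
      hence "(\<Sum>k<N. c k ^ j) = 0"
        using sum_powers_root_of_unity[of j N] j
        by (simp add: c_def power_mult_distrib flip: sum_distrib_left)
      thus ?thesis using False by (simp add: e_0)
    qed simp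
  qed simp
  also have "\<dots> = e (of_nat N) * a" using N by simp
  finally have "e (of_nat N) * a + n = S + - (e (w ^ N) * (a ^ N * S))" by (simp add: algebra_simps)
  hence "q (e (of_nat N) * a) = q (S + - (e (w ^ N) * (a ^ N * S)))"
    using q_add_null[OF _ n, of "e (of_nat N) * a"] by (simp add: mem aA)
  also have "\<dots> \<le> q S + q (e (w ^ N) * (a ^ N * S))"
    using q_add[of S "- (e (w ^ N) * (a ^ N * S))"] by (simp add: mem aA SA q_uminus)
  also have "q (e (w ^ N) * (a ^ N * S)) \<le> cmod (w ^ N) * q (a ^ N * S)"
    by (intro q_scale mem aA SA)
  also have "q (a ^ N * S) \<le> q a ^ N * q S"
    using q_mult[of "a ^ N" S] q_power[OF aA N] mult_right_mono[OF q_power[OF aA N] q_nonneg[OF SA]]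
    by (simp add: mem aA SA)
  finally have "q (e (of_nat N) * a) \<le> q S + cmod (w ^ N) * (q a ^ N * q S)"
    by (simp add: mult_left_mono)
  also have "\<dots> = (1 + (cmod w * q a) ^ N) * q S"
    by (simp add: algebra_simps norm_power power_mult_distrib)
  also have "\<dots> \<le> (1 + (cmod w * q a) ^ N) * (\<Sum>k<N. q (R (m + c k)))"
    unfolding S_def by (intro mult_left_mono q_sum R) (auto intro!: add_nonneg_nonneg simp: q_nonneg aA)
  finally have *: "q (e (of_nat N) * a) \<le> \<dots>" .
  have "e (1 / of_nat N) * (e (of_nat N) * a) = a"
    using N by (simp flip: mult.assoc e_mult add: e_1)
  hence "q a \<le> 1 / real N * q (e (of_nat N) * a)"
    using q_scale[of "e (of_nat N) * a" "1 / of_nat N"] by (simp add: mem aA norm_divide)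
  hence "real N * q a \<le> q (e (of_nat N) * a)" using N by (simp add: field_simps)
  with * show ?thesis by (simp add: a_def)
qed

text \<open>
  If \<open>x - e l\<close> were invertible modulo the null ideal for every \<open>l\<close>, then the function
  \<open>h l = 1 / q ((x - e l)\<^sup>-\<^sup>1)\<close> would be positive, \<open>1\<close>-Lipschitz by the resolvent identity, and would
  tend to infinity; so it would attain a positive minimum \<open>d\<close>. By the mean bound over roots of unity a
  minimum at \<open>m\<close> forces \<open>h = d\<close> on the disc of radius \<open>d\<close> about \<open>m\<close>. Moving on in steps of length \<open>d / 2\<close>
  keeps \<open>h = d\<close> forever, which contradicts the growth of \<open>h\<close>.
\<close>

theorem gelfand_mazur:
  assumes x: "x \<in> A"
  shows "\<exists>l. \<forall>r\<in>A. r * (x - e l) - 1 \<notin> null"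
proof (rule ccontr)
  assume "\<not> ?thesis"
  hence "\<forall>l. \<exists>r\<in>A. r * (x - e l) - 1 \<in> null" by auto
  then obtain R where R: "\<And>l. R l \<in> A" "\<And>l. R l * (x - e l) - 1 \<in> null" by metis
  define g where "g = (\<lambda>l. q (R l))"
  define h where "h = (\<lambda>l. 1 / g l)"
  have g_pos: "g l > 0" for l
  proof (rule ccontr)
    assume "\<not> ?thesis"
    hence "R l \<in> null" unfolding g_def by (intro null_memI R) auto
    hence "(x - e l) * R l - (R l * (x - e l) - 1) \<in> null"
      by (intro null_diff null_mult R mem x)
    thus False using q_one by (simp add: null_def algebra_simps)
  qed
  have h_pos: "h l > 0" for l using g_pos by (simp add: h_def)
  have g_le: "g l \<le> g m + cmod (l - m) * (g l * g m)" for l m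
  proof -
    define n where "n = R l - R m - e (l - m) * R l * R m"
    have n: "n \<in> null" unfolding n_def by (rule resolvent_identity[OF x R(1) R(1) R(2) R(2)])
    have eq: "R l = (R m + e (l - m) * (R l * R m)) + n" by (simp add: n_def algebra_simps)
    have "g l = q (R m + e (l - m) * (R l * R m))"
      unfolding g_def by (subst eq, rule q_add_null[OF _ n]) (intro mem R)
    also have "\<dots> \<le> q (R m) + q (e (l - m) * (R l * R m))" by (intro q_add mem R)
    also have "q (e (l - m) * (R l * R m)) \<le> cmod (l - m) * q (R l * R m)" by (intro q_scale mem R)
    also have "\<dots> \<le> cmod (l - m) * (g l * g m)"
      unfolding g_def by (intro mult_left_mono q_mult R) auto
    finally show ?thesis by (simp add: g_def)
  qed
  have h_lip1: "h m - h l \<le> cmod (l - m)" for l m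
  proof -
    have "(g l - g m) / (g l * g m) \<le> cmod (l - m)"
      using g_le[of l m] g_pos[of l] g_pos[of m] by (simp add: divide_le_eq)
    moreover have "(g l - g m) / (g l * g m) = h m - h l"
      using g_pos[of l] g_pos[of m] by (simp add: h_def field_simps)
    ultimately show ?thesis by simp
  qed
  have h_lip: "\<bar>h l - h m\<bar> \<le> cmod (l - m)" for l m
    using h_lip1[of l m] h_lip1[of m l] norm_minus_commute[of l m] by linarith
  have h_cont: "continuous_on UNIV h"
    unfolding continuous_on_iff
    by (metis dist_norm dist_real_def h_lip order_le_less_trans)
  have h_ge: "q 1 * h l \<ge> cmod l - q x" for l
  proof -
    define n where "n = R l * (x - e l) - 1"
    have n: "n \<in> null" unfolding n_def by (rule R(2))
    show ?thesis
    proof (cases "l = 0")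
      case True
      moreover have "q 1 * h l > 0" using h_pos[of l] q_one by simp
      ultimately show ?thesis using q_nonneg[OF x] by simp
    next
      case False
      have "e (1 / l) * (R l * x + - 1) + (e (1 / l) * - n) = (e (1 / l) * e l) * R l"
        by (simp add: n_def algebra_simps)
      also have "e (1 / l) * e l = 1" using False by (simp add: e_1 flip: e_mult)
      finally have eq: "e (1 / l) * (R l * x + - 1) + (e (1 / l) * - n) = R l" by simp
      have "g l = q (e (1 / l) * (R l * x + - 1))"
        unfolding g_def by (subst eq[symmetric], rule q_add_null)
          (intro mem R x null_mult null_uminus n)+
      also have "\<dots> \<le> cmod (1 / l) * q (R l * x + - 1)" by (intro q_scale mem R x)
      also have "\<dots> \<le> cmod (1 / l) * (g l * q x + q 1)"
      proof (rule mult_left_mono)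
        have "q (R l * x + - 1) \<le> q (R l * x) + q 1"
          using q_add[of "R l * x" "- 1"] by (simp add: mem R x q_uminus)
        thus "q (R l * x + - 1) \<le> g l * q x + q 1" unfolding g_def using q_mult[OF R(1) x, of l] by simp
      qed simp
      finally have "cmod l * g l \<le> g l * q x + q 1"
        using False by (simp add: norm_divide field_simps)
      hence "cmod l \<le> q x + q 1 / g l" using g_pos[of l] by (simp add: field_simps)
      thus ?thesis by (simp add: h_def)
    qed
  qed
  obtain m0 where m0: "\<And>l. h m0 \<le> h l"
  proof -
    define r where "r = q 1 * h 0 + q x"
    have r: "r \<ge> 0" unfolding r_def using q_one h_pos[of 0] q_nonneg[OF x] by simp
    have "compact (cball (0::complex) r)" by simp
    moreover have "cball (0::complex) r \<noteq> {}" using r by auto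
    ultimately obtain m where m: "m \<in> cball 0 r" "\<And>l. l \<in> cball 0 r \<Longrightarrow> h m \<le> h l"
      using continuous_attains_inf[of "cball 0 r" h] h_cont continuous_on_subset by blast
    have "h m \<le> h l" for l
    proof (cases "l \<in> cball 0 r")
      case False
      hence "q 1 * h 0 < q 1 * h l" using h_ge[of l] by (simp add: r_def)
      hence "h 0 \<le> h l" using q_one by simp
      moreover have "h m \<le> h 0" using m(2)[of 0] r by simp
      ultimately show ?thesis by simp
    qed (use m in auto)
    thus ?thesis using that by blast
  qed
  define d where "d = h m0"
  have d_pos: "d > 0" using h_pos by (simp add: d_def)
  have spread: "h (m + w) = d" if m: "h m = d" and w: "cmod w < d" for m w
  proof (rule ccontr)
    assume "h (m + w) \<noteq> d"
    hence hw: "h (m + w) > d" using m0[of "m + w"] by (simp add: d_def)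
    define M where "M = 1 / d"
    have gM: "g l \<le> M" for l
      using m0[of l] g_pos[of l] d_pos by (simp add: M_def h_def d_def field_simps)
    have M: "M > 0" using d_pos by (simp add: M_def)
    have gm: "g m = M" using m by (auto simp: M_def h_def)
    define eps where "eps = M - g (m + w)"
    have eps: "eps > 0"
      using hw d_pos g_pos[of "m + w"] by (simp add: eps_def M_def h_def field_simps)
    define t where "t = cmod w * M"
    have t: "0 \<le> t" "t < 1" using w d_pos M by (auto simp: t_def M_def field_simps)
    \<comment> \<open>One of the \<open>N\<close> points on the circle is \<open>m + w\<close>, where \<open>g\<close> falls short of \<open>M\<close> by \<open>eps\<close>. The mean
      thus loses \<open>eps / N\<close>, while the error term is exponentially small.\<close>
    have key: "eps \<le> M * (real N * t ^ N)" if N: "N > 0" for N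
    proof -
      define c where "c = (\<lambda>k. w * cis (2 * pi / real N) ^ k)"
      have "(\<Sum>k<N. g (m + c k)) = g (m + w) + (\<Sum>k\<in>{..<N} - {0}. g (m + c k))"
        using N by (subst sum.remove[of _ 0]) (auto simp: c_def)
      also have "(\<Sum>k\<in>{..<N} - {0}. g (m + c k)) \<le> (\<Sum>k\<in>{..<N} - {0}. M)" by (intro sum_mono gM)
      also have "\<dots> = real N * M - M" using N by (simp add: algebra_simps of_nat_diff)
      finally have s: "(\<Sum>k<N. g (m + c k)) \<le> real N * M - eps" by (simp add: eps_def)
      have "real N * M \<le> (1 + t ^ N) * (\<Sum>k<N. g (m + c k))"
        using resolvent_mean_bound[OF x R N, of m w] gm by (simp add: g_def t_def c_def)
      also have "\<dots> \<le> (1 + t ^ N) * (real N * M - eps)" using s t by (intro mult_left_mono) auto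
      also have "\<dots> \<le> real N * M - eps + t ^ N * (real N * M)"
        using t eps by (simp add: algebra_simps)
      finally show ?thesis by (simp add: algebra_simps)
    qed
    have "(\<lambda>N. M * (real N * t ^ N)) \<longlonglongrightarrow> M * 0"
      by (intro tendsto_mult tendsto_const powser_times_n_limit_0) (use t in auto)
    hence "eps \<le> M * 0" by (rule LIMSEQ_le_const) (use key in \<open>auto intro!: exI[of _ 1]\<close>)
    thus False using eps by simp
  qed
  have walk: "h (m0 + of_real (real n * (d / 2))) = d" for n
  proof (induction n)
    case (Suc n)
    have "h (m0 + of_real (real n * (d / 2)) + of_real (d / 2)) = d"
      by (rule spread[OF Suc]) (use d_pos in auto)
    moreover have "m0 + of_real (real n * (d / 2)) + of_real (d / 2)
        = m0 + complex_of_real (real (Suc n) * (d / 2))"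
      by (simp add: algebra_simps add_divide_distrib)
    ultimately show ?case by (simp only:)
  qed (simp add: d_def)
  obtain n :: nat where "real n > (q 1 * d + q x + cmod m0) / (d / 2)" using reals_Archimedean2 by blast
  hence n: "real n * (d / 2) > q 1 * d + q x + cmod m0" using d_pos by (simp add: field_simps)
  have "real n * (d / 2) = cmod ((m0 + of_real (real n * (d / 2))) - m0)"
    using d_pos by (simp add: norm_mult)
  also have "\<dots> \<le> cmod (m0 + of_real (real n * (d / 2))) + cmod m0" by (rule norm_triangle_ineq4)
  also have "cmod (m0 + of_real (real n * (d / 2))) \<le> q 1 * d + q x"
    using h_ge[of "m0 + of_real (real n * (d / 2))"] walk[of n] by simp
  finally show False using n by simp
qed

end

section \<open>Hilbert function spaces and membership criteria\<close>

text \<open>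
  The first-order condition for a minimum at \<open>t = 0\<close>; it turns extremality into an equation.
\<close>

lemma nonneg_quadratic_imp_zero:
  fixes z :: complex
  assumes "\<And>t. 0 \<le> 2 * Re (cnj t * z) + (cmod t)\<^sup>2 * B"
  shows "z = 0"
proof (rule ccontr)
  assume z: "z \<noteq> 0"
  define s where "s = 1 / (\<bar>B\<bar> + 1)"
  have s: "s > 0" "s * B < 1" by (auto simp: s_def field_simps)
  have zz: "cnj z * z = of_real ((cmod z)\<^sup>2)"
    by (simp only: complex_norm_square mult.commute)
  have "0 \<le> 2 * Re (cnj (- of_real s * z) * z) + (cmod (- of_real s * z))\<^sup>2 * B" by (rule assms)
  also have "cnj (- of_real s * z) * z = of_real (- s) * (cnj z * z)" by simp
  also have "2 * Re (of_real (- s) * (cnj z * z)) + (cmod (- of_real s * z))\<^sup>2 * B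
      = s * (cmod z)\<^sup>2 * (s * B - 2)"
    unfolding zz using s by (simp add: norm_mult power2_eq_square algebra_simps)
  finally have "0 \<le> s * (cmod z)\<^sup>2 * (s * B - 2)" .
  moreover have "s * (cmod z)\<^sup>2 > 0" using s z by simp
  ultimately have "s * B - 2 \<ge> 0" by (simp only: zero_le_mult_iff) linarith
  thus False using s by simp
qed

context rkhs
begin

abbreviation nrm :: "('x \<Rightarrow> complex) \<Rightarrow> real" where "nrm \<equiv> fun_norm ip"

lemma uminus_mem: "f \<in> H \<Longrightarrow> (\<lambda>x. - f x) \<in> H"
  using scale_mem[of f "-1"] by simp

lemma diff_mem: "f \<in> H \<Longrightarrow> g \<in> H \<Longrightarrow> (\<lambda>x. f x - g x) \<in> H"
  using add_mem[OF _ uminus_mem, of f g] by simp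

lemma sum_mem: "(\<And>i. i \<in> I \<Longrightarrow> f i \<in> H) \<Longrightarrow> (\<lambda>x. \<Sum>i\<in>I. f i x) \<in> H"
  by (induction I rule: infinite_finite_induct) (auto intro: zero_mem add_mem)

lemmas mem = zero_mem add_mem scale_mem uminus_mem diff_mem sum_mem kernel_mem

lemma ip_diff: "f \<in> H \<Longrightarrow> g \<in> H \<Longrightarrow> h \<in> H \<Longrightarrow> ip (\<lambda>x. f x - g x) h = ip f h - ip g h"
  using ip_add[of f "\<lambda>x. - 1 * g x" h] ip_scale[of g h "-1"] by (simp add: mem)

lemma ip_zero: "h \<in> H \<Longrightarrow> ip (\<lambda>x. 0) h = 0"
  using ip_scale[of h h 0] by simp

lemma ip_sum: "(\<And>i. i \<in> I \<Longrightarrow> f i \<in> H) \<Longrightarrow> h \<in> H \<Longrightarrow> ip (\<lambda>x. \<Sum>i\<in>I. f i x) h = (\<Sum>i\<in>I. ip (f i) h)"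
  by (induction I rule: infinite_finite_induct) (auto simp: ip_zero ip_add mem)

lemma ip_add_right: "f \<in> H \<Longrightarrow> g \<in> H \<Longrightarrow> h \<in> H \<Longrightarrow> ip h (\<lambda>x. f x + g x) = ip h f + ip h g"
  using ip_cnj[of "\<lambda>x. f x + g x" h] ip_cnj[of f h] ip_cnj[of g h] by (simp add: mem ip_add)

lemma ip_scale_right: "f \<in> H \<Longrightarrow> h \<in> H \<Longrightarrow> ip h (\<lambda>x. c * f x) = cnj c * ip h f"
  using ip_cnj[of "\<lambda>x. c * f x" h] ip_cnj[of f h] by (simp add: mem ip_scale)

lemma ip_diff_right: "f \<in> H \<Longrightarrow> g \<in> H \<Longrightarrow> h \<in> H \<Longrightarrow> ip h (\<lambda>x. f x - g x) = ip h f - ip h g"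
  using ip_cnj[of "\<lambda>x. f x - g x" h] ip_cnj[of f h] ip_cnj[of g h] by (simp add: mem ip_diff)

lemma ip_sum_right:
  "(\<And>i. i \<in> I \<Longrightarrow> f i \<in> H) \<Longrightarrow> h \<in> H \<Longrightarrow> ip h (\<lambda>x. \<Sum>i\<in>I. f i x) = (\<Sum>i\<in>I. ip h (f i))"
  using ip_cnj[of "\<lambda>x. \<Sum>i\<in>I. f i x" h] ip_cnj[of _ h]
  by (simp add: mem ip_sum cnj_sum)

lemma ip_linear_combinations:
  assumes "\<And>w. g w \<in> H"
  shows "ip (\<lambda>x. \<Sum>w\<in>E. c w * g w x) (\<lambda>x. \<Sum>z\<in>E. d z * g z x)
    = (\<Sum>z\<in>E. \<Sum>w\<in>E. c w * cnj (d z) * ip (g w) (g z))"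
proof -
  have "ip (\<lambda>x. \<Sum>w\<in>E. c w * g w x) (\<lambda>x. \<Sum>z\<in>E. d z * g z x)
      = (\<Sum>z\<in>E. cnj (d z) * ip (\<lambda>x. \<Sum>w\<in>E. c w * g w x) (g z))"
    by (subst ip_sum_right) (simp_all add: mem assms ip_scale_right)
  also have "\<dots> = (\<Sum>z\<in>E. cnj (d z) * (\<Sum>w\<in>E. c w * ip (g w) (g z)))"
    by (subst ip_sum) (simp_all add: mem assms ip_scale)
  finally show ?thesis by (simp add: sum_distrib_left mult_ac)
qed

lemma ip_kernel: "f \<in> H \<Longrightarrow> ip f (\<lambda>x. k x y) = f y"
  using reproducing by simp

lemma kernel_cnj: "k y x = cnj (k x y)"
  using ip_cnj[OF kernel_mem kernel_mem, of x y] by (simp add: kernel_mem ip_kernel)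

lemma nrm_nonneg: "f \<in> H \<Longrightarrow> 0 \<le> nrm f"
  by (simp add: fun_norm_def ip_nonneg)

lemma nrm_sq: "f \<in> H \<Longrightarrow> (nrm f)\<^sup>2 = Re (ip f f)"
  by (simp add: fun_norm_def ip_nonneg)

lemma ip_self: "f \<in> H \<Longrightarrow> ip f f = of_real ((nrm f)\<^sup>2)"
  using ip_cnj[of f f] by (auto simp: nrm_sq complex_eq_iff)

lemma nrm_eq_0: "f \<in> H \<Longrightarrow> nrm f = 0 \<Longrightarrow> f = (\<lambda>x. 0)"
  using ip_definite[of f] ip_self[of f] by simp

lemma nrm_zero: "nrm (\<lambda>x. 0) = 0"
  using ip_zero[OF zero_mem] by (simp add: fun_norm_def)

lemma nrm_scale: "f \<in> H \<Longrightarrow> nrm (\<lambda>x. c * f x) = cmod c * nrm f"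
proof -
  assume f: "f \<in> H"
  have "(nrm (\<lambda>x. c * f x))\<^sup>2 = Re ((c * cnj c) * ip f f)"
    using f by (simp add: nrm_sq mem ip_scale ip_scale_right mult.assoc)
  also have "\<dots> = (cmod c * nrm f)\<^sup>2"
    using f by (simp add: ip_self complex_norm_square[symmetric] power_mult_distrib
        flip: of_real_mult of_real_power)
  finally show ?thesis using f by (simp add: nrm_nonneg mem)
qed

lemma nrm_add_sq:
  "f \<in> H \<Longrightarrow> g \<in> H \<Longrightarrow> (nrm (\<lambda>x. f x + g x))\<^sup>2 = (nrm f)\<^sup>2 + (nrm g)\<^sup>2 + 2 * Re (ip f g)"
  using ip_cnj[of f g] by (simp add: nrm_sq mem ip_add ip_add_right)

lemma nrm_uminus: "f \<in> H \<Longrightarrow> nrm (\<lambda>x. - f x) = nrm f"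
  using nrm_scale[of f "-1"] by simp

lemma nrm_diff_sq:
  "f \<in> H \<Longrightarrow> g \<in> H \<Longrightarrow> (nrm (\<lambda>x. f x - g x))\<^sup>2 = (nrm f)\<^sup>2 + (nrm g)\<^sup>2 - 2 * Re (ip f g)"
  using ip_cnj[of f g] by (simp add: nrm_sq mem ip_diff ip_diff_right)

lemma cauchy_schwarz:
  assumes f: "f \<in> H" and g: "g \<in> H"
  shows "cmod (ip f g) \<le> nrm f * nrm g"
proof (cases "nrm g = 0")
  case True
  hence "g = (\<lambda>x. 0 * f x)" using nrm_eq_0[OF g] by simp
  hence "ip f g = 0" using ip_scale_right[OF f f, of 0] by simp
  thus ?thesis by (simp add: True)
next
  case False
  define c where "c = ip f g / of_real ((nrm g)\<^sup>2)"
  have "0 \<le> (nrm (\<lambda>x. f x - c * g x))\<^sup>2" by simp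
  also have "\<dots> = (nrm f)\<^sup>2 + (cmod c * nrm g)\<^sup>2 - 2 * Re (cnj c * ip f g)"
    using f g by (simp add: nrm_diff_sq mem nrm_scale ip_scale_right)
  also have "cnj c * ip f g = of_real ((cmod (ip f g))\<^sup>2 / (nrm g)\<^sup>2)"
    unfolding c_def by (simp only: of_real_divide complex_norm_square) simp
  also have "cmod c * nrm g = cmod (ip f g) / nrm g"
    using False by (simp add: c_def norm_divide norm_power power2_eq_square norm_mult)
  finally have "(cmod (ip f g))\<^sup>2 / (nrm g)\<^sup>2 \<le> (nrm f)\<^sup>2" by (simp add: power_divide)
  hence "(cmod (ip f g))\<^sup>2 \<le> (nrm f * nrm g)\<^sup>2"
    using False by (simp add: divide_le_eq power_mult_distrib)
  thus ?thesis using f g by (simp add: nrm_nonneg power2_le_iff_abs_le)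
qed

lemma nrm_triangle:
  assumes f: "f \<in> H" and g: "g \<in> H"
  shows "nrm (\<lambda>x. f x + g x) \<le> nrm f + nrm g"
proof (rule power2_le_imp_le)
  have "Re (ip f g) \<le> nrm f * nrm g"
    by (rule order_trans[OF complex_Re_le_cmod cauchy_schwarz[OF f g]])
  thus "(nrm (\<lambda>x. f x + g x))\<^sup>2 \<le> (nrm f + nrm g)\<^sup>2"
    using f g by (simp add: nrm_add_sq power2_sum)
qed (use f g in \<open>simp add: nrm_nonneg\<close>)

lemma nrm_triangle_diff:
  assumes "f \<in> H" "g \<in> H" "h \<in> H"
  shows "nrm (\<lambda>x. f x - h x) \<le> nrm (\<lambda>x. f x - g x) + nrm (\<lambda>x. g x - h x)"
  using nrm_triangle[of "\<lambda>x. f x - g x" "\<lambda>x. g x - h x"] assms by (simp add: mem)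

lemma nrm_minus_commute: "f \<in> H \<Longrightarrow> g \<in> H \<Longrightarrow> nrm (\<lambda>x. f x - g x) = nrm (\<lambda>x. g x - f x)"
  using nrm_uminus[of "\<lambda>x. f x - g x"] by (simp add: mem)

lemma nrm_sum_le: "(\<And>i. i \<in> I \<Longrightarrow> f i \<in> H) \<Longrightarrow> nrm (\<lambda>x. \<Sum>i\<in>I. f i x) \<le> (\<Sum>i\<in>I. nrm (f i))"
proof (induction I rule: infinite_finite_induct)
  case (insert i I)
  have "nrm (\<lambda>x. f i x + (\<Sum>j\<in>I. f j x)) \<le> nrm (f i) + nrm (\<lambda>x. \<Sum>j\<in>I. f j x)"
    by (intro nrm_triangle mem) (auto intro: insert.prems)
  with insert show ?case by fastforce
qed (simp_all add: nrm_zero)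

lemma limit_ip:
  assumes F: "\<And>n. F n \<in> H" and f: "f \<in> H" and g: "g \<in> H"
    and lim: "(\<lambda>n. nrm (\<lambda>x. F n x - f x)) \<longlonglongrightarrow> 0"
  shows "(\<lambda>n. ip (F n) g) \<longlonglongrightarrow> ip f g"
proof -
  have "(\<lambda>n. ip (F n) g - ip f g) \<longlonglongrightarrow> 0"
  proof (rule Lim_null_comparison)
    show "(\<lambda>n. nrm (\<lambda>x. F n x - f x) * nrm g) \<longlonglongrightarrow> 0" using tendsto_mult_right[OF lim, of "nrm g"] by simp
    show "\<forall>\<^sub>F n in sequentially. norm (ip (F n) g - ip f g) \<le> nrm (\<lambda>x. F n x - f x) * nrm g"
      using cauchy_schwarz[OF diff_mem[OF F f] g] by (simp add: ip_diff F f g)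
  qed
  thus ?thesis by (simp add: LIM_zero_iff)
qed

lemma limit_nrm:
  assumes F: "\<And>n. F n \<in> H" and f: "f \<in> H"
    and lim: "(\<lambda>n. nrm (\<lambda>x. F n x - f x)) \<longlonglongrightarrow> 0"
  shows "(\<lambda>n. nrm (F n)) \<longlonglongrightarrow> nrm f"
proof -
  have "(\<lambda>n. nrm (F n) - nrm f) \<longlonglongrightarrow> 0"
  proof (rule Lim_null_comparison[OF _ lim])
    have "norm (nrm (F n) - nrm f) \<le> nrm (\<lambda>x. F n x - f x)" for n
      using nrm_triangle[OF diff_mem[OF F f] f, of n] nrm_triangle[OF diff_mem[OF f F] F, of n n]
        nrm_minus_commute[OF F f, of n] by simp
    thus "\<forall>\<^sub>F n in sequentially. norm (nrm (F n) - nrm f) \<le> nrm (\<lambda>x. F n x - f x)" by simp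
  qed
  thus ?thesis by (simp add: LIM_zero_iff)
qed

text \<open>
  The Riesz representation theorem for a functional that is given by its graph \<open>P\<close>. The graph need not
  be known in advance to be that of a function, which is what happens for linear combinations of
  kernels: several coefficient families may give the same combination. The representing vector is the
  limit of a minimizing sequence of \<open>\<parallel>u\<parallel>\<^sup>2 - 2 Re l\<close> on \<open>P\<close>; minimizing sequences are Cauchy by the
  parallelogram law. The alternative \<open>nrm f = 0\<close> covers negative \<open>C\<close>.
\<close>

lemma riesz_linear_relation:
  assumes P_mem: "\<And>u l. (u, l) \<in> P \<Longrightarrow> u \<in> H"
    and P_add: "\<And>u l v m. (u, l) \<in> P \<Longrightarrow> (v, m) \<in> P \<Longrightarrow> ((\<lambda>x. u x + v x), l + m) \<in> P"
    and P_scale: "\<And>c u l. (u, l) \<in> P \<Longrightarrow> ((\<lambda>x. c * u x), cnj c * l) \<in> P"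
    and P_bound: "\<And>u l. (u, l) \<in> P \<Longrightarrow> cmod l \<le> C * nrm u"
    and P_ne: "P \<noteq> {}"
  shows "\<exists>f\<in>H. (nrm f \<le> C \<or> nrm f = 0) \<and> (\<forall>u l. (u, l) \<in> P \<longrightarrow> ip f u = l)"
proof -
  define J where "J = (\<lambda>p::('x \<Rightarrow> complex) \<times> complex. (nrm (fst p))\<^sup>2 - 2 * Re (snd p))"
  have J_ge: "J p \<ge> - C\<^sup>2" if "p \<in> P" for p
  proof -
    have "Re (snd p) \<le> C * nrm (fst p)"
      using P_bound[of "fst p" "snd p"] that complex_Re_le_cmod[of "snd p"] by simp
    moreover have "0 \<le> (nrm (fst p) - C)\<^sup>2" by simp
    ultimately show ?thesis unfolding J_def power2_diff by (simp add: mult.commute mult.left_commute)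
  qed
  define m where "m = Inf (J ` P)"
  have bdd: "bdd_below (J ` P)" using J_ge by (intro bdd_belowI2)
  have m_le: "m \<le> J p" if "p \<in> P" for p unfolding m_def using that bdd by (intro cInf_lower) auto
  have "\<exists>p\<in>P. J p < m + 1 / real (Suc n)" for n
    using cInf_lessD[of "J ` P" "m + 1 / real (Suc n)"] P_ne unfolding m_def by auto
  then obtain p where p: "\<And>n. p n \<in> P" "\<And>n. J (p n) < m + 1 / real (Suc n)" by metis
  define u where "u = (\<lambda>n. fst (p n))"
  define l where "l = (\<lambda>n. snd (p n))"
  have up: "(u n, l n) \<in> P" for n using p by (simp add: u_def l_def)
  have uH: "u n \<in> H" for n using P_mem up by blast
  have Jp: "(nrm (u n))\<^sup>2 - 2 * Re (l n) < m + 1 / real (Suc n)" for n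
    using p(2)[of n] by (simp add: J_def u_def l_def)
  \<comment> \<open>Moving from \<open>(u n, l n)\<close> in the direction \<open>t (v, z)\<close> cannot get below the infimum.\<close>
  have J_perturb: "m \<le> (nrm (u n))\<^sup>2 + (cmod t)\<^sup>2 * (nrm v)\<^sup>2 + 2 * Re (cnj t * ip (u n) v)
      - 2 * Re (l n) - 2 * Re (cnj t * z)" if v: "(v, z) \<in> P" for v z t n
  proof -
    have "m \<le> J ((\<lambda>x. u n x + t * v x), l n + cnj t * z)" by (intro m_le P_add P_scale up v)
    thus ?thesis using P_mem[OF v] uH
      by (simp add: J_def nrm_add_sq mem nrm_scale ip_scale_right power_mult_distrib)
  qed
  have diff: "(nrm (\<lambda>x. u i x - u j x))\<^sup>2 \<le> 2 / real (Suc i) + 2 / real (Suc j)" for i j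
  proof -
    have "m \<le> J ((\<lambda>x. (1/2) * (u i x + u j x)), cnj (1/2) * (l i + l j))"
      by (intro m_le P_add P_scale up)
    also have "\<dots> = (1/4) * (nrm (\<lambda>x. u i x + u j x))\<^sup>2 - Re (l i) - Re (l j)"
      unfolding J_def fst_conv snd_conv
      by (subst nrm_scale) (simp_all add: mem uH power2_eq_square add_divide_distrib)
    finally have "4 * m \<le> (nrm (u i))\<^sup>2 + (nrm (u j))\<^sup>2 + 2 * Re (ip (u i) (u j)) - 4 * Re (l i) - 4 * Re (l j)"
      unfolding nrm_add_sq[OF uH uH] by (simp add: algebra_simps)
    thus ?thesis using Jp[of i] Jp[of j] unfolding nrm_diff_sq[OF uH uH] by linarith
  qed
  have inv0: "(\<lambda>n. 1 / real (Suc n)) \<longlonglongrightarrow> 0" using LIMSEQ_inverse_real_of_nat by (simp add: inverse_eq_divide)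
  have "\<exists>f\<in>H. (\<lambda>n. nrm (\<lambda>x. u n x - f x)) \<longlonglongrightarrow> 0"
  proof (rule complete[OF uH])
    fix e :: real assume e: "e > 0"
    obtain N where N: "1 / real (Suc N) < e\<^sup>2 / 4"
      using e nat_approx_posE[of "e\<^sup>2 / 4"] by auto
    have "nrm (\<lambda>x. u i x - u j x) < e" if "i \<ge> N" "j \<ge> N" for i j
    proof -
      have "1 / real (Suc i) \<le> 1 / real (Suc N)" "1 / real (Suc j) \<le> 1 / real (Suc N)"
        using that by (auto intro!: divide_left_mono)
      hence "(nrm (\<lambda>x. u i x - u j x))\<^sup>2 < e\<^sup>2" using diff[of i j] N by simp
      thus ?thesis using e power_less_imp_less_base[of _ 2 e] by auto
    qed
    thus "\<exists>N. \<forall>i\<ge>N. \<forall>j\<ge>N. nrm (\<lambda>x. u i x - u j x) < e" by blast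
  qed
  then obtain f where f: "f \<in> H" and lim: "(\<lambda>n. nrm (\<lambda>x. u n x - f x)) \<longlonglongrightarrow> 0" by blast
  have rep: "ip f v = z" if v: "(v, z) \<in> P" for v z
  proof -
    have vH: "v \<in> H" by (rule P_mem[OF v])
    have "ip f v - z = 0"
    proof (rule nonneg_quadratic_imp_zero)
      fix t
      have lim': "(\<lambda>n. 2 * Re (cnj t * (ip (u n) v - z)) + (cmod t)\<^sup>2 * (nrm v)\<^sup>2 + 1 / real (Suc n))
          \<longlonglongrightarrow> 2 * Re (cnj t * (ip f v - z)) + (cmod t)\<^sup>2 * (nrm v)\<^sup>2 + 0"
        by (intro tendsto_intros inv0 limit_ip uH f vH lim)
      have "0 \<le> 2 * Re (cnj t * (ip f v - z)) + (cmod t)\<^sup>2 * (nrm v)\<^sup>2 + 0"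
      proof (rule LIMSEQ_le_const[OF lim'], intro exI allI impI)
        fix n
        show "0 \<le> 2 * Re (cnj t * (ip (u n) v - z)) + (cmod t)\<^sup>2 * (nrm v)\<^sup>2 + 1 / real (Suc n)"
          using J_perturb[OF v, of n t] Jp[of n]
          by (simp only: right_diff_distrib minus_complex.sel)
      qed
      thus "0 \<le> 2 * Re (cnj t * (ip f v - z)) + (cmod t)\<^sup>2 * (nrm v)\<^sup>2" by simp
    qed
    thus ?thesis by simp
  qed
  have "(nrm f)\<^sup>2 \<le> C * nrm f"
  proof (rule LIMSEQ_le)
    have "(\<lambda>n. Re (ip (u n) f)) \<longlonglongrightarrow> Re (ip f f)" by (intro tendsto_intros limit_ip uH f lim)
    thus "(\<lambda>n. Re (ip (u n) f)) \<longlonglongrightarrow> (nrm f)\<^sup>2" by (simp add: nrm_sq f)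
    show "(\<lambda>n. C * nrm (u n)) \<longlonglongrightarrow> C * nrm f" by (intro tendsto_intros limit_nrm uH f lim)
    have "Re (ip (u n) f) \<le> C * nrm (u n)" for n
    proof -
      have "ip (u n) f = cnj (l n)" using rep[OF up] ip_cnj[OF f uH] by simp
      hence "cmod (ip (u n) f) \<le> C * nrm (u n)" using P_bound[OF up] by simp
      thus ?thesis by (rule order_trans[OF complex_Re_le_cmod])
    qed
    thus "\<exists>N. \<forall>n\<ge>N. Re (ip (u n) f) \<le> C * nrm (u n)" by blast
  qed
  hence "nrm f \<le> C \<or> nrm f = 0" using nrm_nonneg[OF f]
    by (cases "nrm f = 0") (simp_all add: power2_eq_square)
  with f rep show ?thesis by auto
qed

definition kernel_comb :: "'x set \<Rightarrow> ('x \<Rightarrow> complex) \<Rightarrow> 'x \<Rightarrow> complex" where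
  "kernel_comb E c = (\<lambda>x. \<Sum>w\<in>E. c w * k x w)"

lemma kernel_comb_mem: "kernel_comb E c \<in> H"
  unfolding kernel_comb_def by (intro mem)

lemma ip_kernel_comb: "f \<in> H \<Longrightarrow> ip f (kernel_comb E c) = (\<Sum>w\<in>E. cnj (c w) * f w)"
  unfolding kernel_comb_def by (simp add: ip_sum_right mem ip_scale_right ip_kernel)

lemma kernel_comb_add: "(\<lambda>x. kernel_comb E c x + kernel_comb E d x) = kernel_comb E (\<lambda>w. c w + d w)"
  by (simp add: kernel_comb_def fun_eq_iff sum.distrib distrib_right)

lemma kernel_comb_scale: "(\<lambda>x. a * kernel_comb E c x) = kernel_comb E (\<lambda>w. a * c w)"
  by (simp add: kernel_comb_def fun_eq_iff sum_distrib_left mult.assoc)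

lemma kernel_comb_extend:
  assumes "finite F" "E \<subseteq> F"
  shows "kernel_comb E c = kernel_comb F (\<lambda>w. if w \<in> E then c w else 0)"
proof
  fix x
  have "(\<Sum>w\<in>E. c w * k x w) = (\<Sum>w\<in>F. (if w \<in> E then c w * k x w else 0))"
    using assms by (subst sum.inter_restrict[symmetric]) (auto intro!: sum.cong)
  thus "kernel_comb E c x = kernel_comb F (\<lambda>w. if w \<in> E then c w else 0) x"
    unfolding kernel_comb_def by (simp add: if_distrib[of "\<lambda>a. a * _"] cong: if_cong)
qed

text \<open>
  The functional \<open>kernel_comb E c \<mapsto> \<Sum> c w * cnj (y w)\<close>, which would be the inner product against \<open>y\<close>, is
  bounded, so it is represented by an element of the space; evaluating at single kernels shows that
  this element is \<open>y\<close>.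
\<close>

lemma membership_criterion:
  assumes C: "C \<ge> 0"
    and bound: "\<And>E c. finite E \<Longrightarrow> cmod (\<Sum>w\<in>E. cnj (c w) * y w) \<le> C * nrm (kernel_comb E c)"
  shows "y \<in> H" "nrm y \<le> C"
proof -
  define P where "P = {(kernel_comb E c, \<Sum>w\<in>E. cnj (c w) * y w) |E c. finite E}"
  have PI: "(kernel_comb E c, \<Sum>w\<in>E. cnj (c w) * y w) \<in> P" if "finite E" for E c
    unfolding P_def using that by blast
  have addP: "((\<lambda>x. u x + v x), l + m) \<in> P" if ul: "(u, l) \<in> P" and vm: "(v, m) \<in> P" for u l v m
  proof -
    obtain E c where E: "finite E" "u = kernel_comb E c" "l = (\<Sum>w\<in>E. cnj (c w) * y w)"
      using ul by (auto simp: P_def)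
    obtain F d where F: "finite F" "v = kernel_comb F d" "m = (\<Sum>w\<in>F. cnj (d w) * y w)"
      using vm by (auto simp: P_def)
    let ?c = "\<lambda>w. if w \<in> E then c w else 0" and ?d = "\<lambda>w. if w \<in> F then d w else 0"
    have l: "l = (\<Sum>w\<in>E \<union> F. if w \<in> E then cnj (c w) * y w else 0)"
      unfolding E(3) using E(1) F(1) by (subst sum.inter_restrict[symmetric]) (auto intro!: sum.cong)
    have m: "m = (\<Sum>w\<in>E \<union> F. if w \<in> F then cnj (d w) * y w else 0)"
      unfolding F(3) using E(1) F(1) by (subst sum.inter_restrict[symmetric]) (auto intro!: sum.cong)
    have "l + m = (\<Sum>w\<in>E \<union> F. cnj (?c w + ?d w) * y w)"
      unfolding l m sum.distrib[symmetric] by (intro sum.cong) (auto simp: algebra_simps)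
    moreover have "(\<lambda>x. u x + v x) = kernel_comb (E \<union> F) (\<lambda>w. ?c w + ?d w)"
      unfolding kernel_comb_add[symmetric] E(2) F(2)
      using kernel_comb_extend[of "E \<union> F" E c] kernel_comb_extend[of "E \<union> F" F d] E(1) F(1)
      by simp
    ultimately show ?thesis using PI[of "E \<union> F" "\<lambda>w. ?c w + ?d w"] E(1) F(1) by (simp only: finite_Un simp_thms)
  qed
  have scaleP: "((\<lambda>x. a * u x), cnj a * l) \<in> P" if ul: "(u, l) \<in> P" for a u l
  proof -
    obtain E c where E: "finite E" "u = kernel_comb E c" "l = (\<Sum>w\<in>E. cnj (c w) * y w)"
      using ul by (auto simp: P_def)
    have "cnj a * l = (\<Sum>w\<in>E. cnj (a * c w) * y w)" by (simp add: E sum_distrib_left mult.assoc)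
    moreover have "(\<lambda>x. a * u x) = kernel_comb E (\<lambda>w. a * c w)" by (simp add: E kernel_comb_scale)
    ultimately show ?thesis using PI[of E "\<lambda>w. a * c w"] E(1) by (simp only:)
  qed
  have "\<exists>f\<in>H. (nrm f \<le> C \<or> nrm f = 0) \<and> (\<forall>u l. (u, l) \<in> P \<longrightarrow> ip f u = l)"
  proof (rule riesz_linear_relation[of P C])
    show "u \<in> H" if "(u, l) \<in> P" for u l
      using that by (auto simp: P_def kernel_comb_mem)
    show "cmod l \<le> C * nrm u" if "(u, l) \<in> P" for u l
      using that by (auto simp: P_def bound)
    show "P \<noteq> {}" using PI[OF finite.emptyI] by blast
    show "((\<lambda>x. u x + v x), l + m) \<in> P" if "(u, l) \<in> P" "(v, m) \<in> P" for u l v m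
      by (rule addP[OF that])
    show "((\<lambda>x. a * u x), cnj a * l) \<in> P" if "(u, l) \<in> P" for a u l
      by (rule scaleP[OF that])
  qed
  then obtain f where f: "f \<in> H" "nrm f \<le> C \<or> nrm f = 0" "\<And>u l. (u, l) \<in> P \<Longrightarrow> ip f u = l"
    by blast
  have "f x = y x" for x
  proof -
    have "(kernel_comb {x} (\<lambda>_. 1), y x) \<in> P" using PI[of "{x}" "\<lambda>_. 1"] by simp
    hence "ip f (kernel_comb {x} (\<lambda>_. 1)) = y x" by (rule f(3))
    thus ?thesis using f(1) by (simp add: ip_kernel_comb)
  qed
  hence "f = y" by auto
  with f C show "y \<in> H" "nrm y \<le> C" by auto
qed

text \<open>
  Membership in a reproducing kernel Hilbert space is decided on finite sets as long as the norms
  stay bounded. This replaces all weak limits along the net of finite subsets.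
\<close>

lemma membership_finite_agreement:
  assumes C: "C \<ge> 0" and "\<And>E. finite E \<Longrightarrow> \<exists>g\<in>H. nrm g \<le> C \<and> (\<forall>w\<in>E. g w = y w)"
  shows "y \<in> H" "nrm y \<le> C"
proof -
  have *: "cmod (\<Sum>w\<in>E. cnj (c w) * y w) \<le> C * nrm (kernel_comb E c)" if E: "finite E" for E c
  proof -
    obtain g where g: "g \<in> H" "nrm g \<le> C" "\<forall>w\<in>E. g w = y w" using assms(2)[OF E] by blast
    have "(\<Sum>w\<in>E. cnj (c w) * y w) = ip g (kernel_comb E c)" using g by (simp add: ip_kernel_comb)
    also have "cmod \<dots> \<le> nrm g * nrm (kernel_comb E c)" by (intro cauchy_schwarz g kernel_comb_mem)
    also have "\<dots> \<le> C * nrm (kernel_comb E c)" by (intro mult_right_mono g nrm_nonneg kernel_comb_mem)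
    finally show ?thesis .
  qed
  show "y \<in> H" "nrm y \<le> C" using membership_criterion[OF C *] by blast+
qed

lemma membership_pointwise_limit:
  assumes C: "C \<ge> 0" and F: "\<And>n. F n \<in> H" "\<And>n. nrm (F n) \<le> C"
    and lim: "\<And>x. (\<lambda>n. F n x) \<longlonglongrightarrow> y x"
  shows "y \<in> H" "nrm y \<le> C"
proof -
  have *: "cmod (\<Sum>w\<in>E. cnj (c w) * y w) \<le> C * nrm (kernel_comb E c)" for E c
  proof (rule LIMSEQ_le_const2)
    show "(\<lambda>n. cmod (\<Sum>w\<in>E. cnj (c w) * F n w)) \<longlonglongrightarrow> cmod (\<Sum>w\<in>E. cnj (c w) * y w)"
      by (intro tendsto_intros lim)
    have "cmod (\<Sum>w\<in>E. cnj (c w) * F n w) \<le> C * nrm (kernel_comb E c)" for n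
      using cauchy_schwarz[OF F(1) kernel_comb_mem, of n E c]
        mult_right_mono[OF F(2) nrm_nonneg[OF kernel_comb_mem], of n E c]
      by (simp add: ip_kernel_comb F)
    thus "\<exists>N. \<forall>n\<ge>N. cmod (\<Sum>w\<in>E. cnj (c w) * F n w) \<le> C * nrm (kernel_comb E c)" by blast
  qed
  show "y \<in> H" "nrm y \<le> C" using membership_criterion[OF C *] by blast+
qed

end

section \<open>Multipliers and finite kernel spans\<close>

context rkhs
begin

text \<open>
  The uniform boundedness principle, by a gliding hump. For unbounded \<open>U\<close>, choose \<open>u n\<close> in \<open>U\<close> with
  rapidly growing norms and move from \<open>F n\<close> to \<open>F (n + 1)\<close> by a vector of length \<open>3\<^sup>-\<^sup>n\<close> parallel to
  \<open>u n\<close>, with the sign that makes the inner product with \<open>u n\<close> large. The remaining steps are together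
  too short to undo this, so the limit of the \<open>F n\<close> has unbounded inner products with \<open>U\<close>.
\<close>

lemma weakly_bounded_imp_bounded:
  assumes U: "U \<subseteq> H" and wb: "\<And>f. f \<in> H \<Longrightarrow> \<exists>B. \<forall>u\<in>U. cmod (ip f u) \<le> B"
  shows "\<exists>C. \<forall>u\<in>U. nrm u \<le> C"
proof (rule ccontr)
  assume "\<not> ?thesis"
  hence "\<forall>n::nat. \<exists>u. u \<in> U \<and> nrm u > 2 * real n * 3 ^ n" by (simp add: not_le Bex_def)
  hence "\<exists>u. \<forall>n. u n \<in> U \<and> nrm (u n) > 2 * real n * 3 ^ n" by (rule choice)
  then obtain u where u: "\<And>n. u n \<in> U" "\<And>n. nrm (u n) > 2 * real n * 3 ^ n" by blast
  have uH: "u n \<in> H" for n using u U by blast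
  have u_pos: "nrm (u n) > 0" for n
    using u(2)[of n] by (rule le_less_trans[rotated]) simp
  define a where "a = (\<lambda>n. 1 / (3 ^ n * nrm (u n)))"
  define step where "step = (\<lambda>n f. let g = (\<lambda>x. f x + of_real (a n) * u n x) in
     if cmod (ip g (u n)) \<ge> nrm (u n) / 3 ^ n then g else (\<lambda>x. f x - of_real (a n) * u n x))"
  define F where "F = rec_nat (\<lambda>x. 0) step"
  have F_Suc: "F (Suc n) = step n (F n)" for n by (simp add: F_def)
  have step_mem: "step n f \<in> H" if "f \<in> H" for n f
    using that uH by (simp add: step_def Let_def mem)
  have FH: "F n \<in> H" for n
    by (induction n) (simp_all add: F_Suc step_mem, simp add: F_def mem)
  have a_u: "nrm (\<lambda>x. of_real (a n) * u n x) = 1 / 3 ^ n" for n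
    using u_pos[of n] by (subst nrm_scale[OF uH]) (simp add: a_def norm_divide norm_mult norm_power)
  have step_dist: "nrm (\<lambda>x. F (Suc n) x - F n x) = 1 / 3 ^ n" for n
    using a_u[of n] nrm_uminus[of "\<lambda>x. of_real (a n) * u n x"] uH
    by (simp add: F_Suc step_def Let_def mem)
  have hit: "cmod (ip (F (Suc n)) (u n)) \<ge> nrm (u n) / 3 ^ n" for n
  proof -
    let ?p = "ip (F n) (u n)" and ?q = "of_real (nrm (u n) / 3 ^ n) :: complex"
    have q: "of_real (a n) * ip (u n) (u n) = ?q"
      using u_pos[of n] uH by (simp add: ip_self a_def power2_eq_square)
    have "ip (\<lambda>x. F n x + of_real (a n) * u n x) (u n) = ?p + ?q"
      "ip (\<lambda>x. F n x - of_real (a n) * u n x) (u n) = ?p - ?q"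
      using FH uH by (simp_all add: ip_add ip_diff mem ip_scale q)
    moreover have "cmod ?q = nrm (u n) / 3 ^ n"
      using u_pos[of n] by (simp add: norm_divide norm_power)
    moreover have "2 * cmod ?q \<le> cmod (?p + ?q) + cmod (?p - ?q)"
    proof -
      have "(?p + ?q) - (?p - ?q) = 2 * ?q" by simp
      hence "2 * cmod ?q = cmod ((?p + ?q) - (?p - ?q))" by (simp only: norm_mult norm_numeral)
      also have "\<dots> \<le> cmod (?p + ?q) + cmod (?p - ?q)" by (rule norm_triangle_ineq4)
      finally show ?thesis .
    qed
    ultimately show ?thesis by (simp add: F_Suc step_def Let_def)
  qed
  have tail: "nrm (\<lambda>x. F (n + j) x - F n x) \<le> 3 / 2 * (1 / 3 ^ n - 1 / 3 ^ (n + j))" for n j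
  proof (induction j)
    case 0
    show ?case by (simp add: nrm_zero)
  next
    case (Suc j)
    have "nrm (\<lambda>x. F (n + Suc j) x - F n x) \<le> nrm (\<lambda>x. F (Suc (n + j)) x - F (n + j) x) + nrm (\<lambda>x. F (n + j) x - F n x)"
      using nrm_triangle_diff[OF FH FH FH, of "n + Suc j" n "n + j"] by simp
    also have "\<dots> \<le> 1 / 3 ^ (n + j) + 3 / 2 * (1 / 3 ^ n - 1 / 3 ^ (n + j))"
      using Suc step_dist[of "n + j"] by simp
    also have "\<dots> = 3 / 2 * (1 / 3 ^ n - 1 / 3 ^ (n + j) / 3)"
      by (simp only: right_diff_distrib) simp
    finally show ?case by simp
  qed
  have tail': "nrm (\<lambda>x. F m x - F n x) \<le> 3 / 2 * (1 / 3 ^ n)" if mn: "m \<ge> n" for m n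
  proof -
    obtain j where m: "m = n + j" using le_Suc_ex[OF mn] by blast
    have "3 / 2 * (1 / 3 ^ n - 1 / 3 ^ (n + j)) \<le> 3 / 2 * (1 / (3::real) ^ n)"
      by (intro mult_left_mono) auto
    with tail[of n j] have "nrm (\<lambda>x. F (n + j) x - F n x) \<le> 3 / 2 * (1 / 3 ^ n)" by (rule order_trans)
    thus ?thesis by (simp only: m)
  qed
  have lim3: "(\<lambda>n. 3 / 2 * (1 / (3::real) ^ n)) \<longlonglongrightarrow> 0"
  proof -
    have "(\<lambda>n. 3 / 2 * (1 / 3 :: real) ^ n) \<longlonglongrightarrow> 3 / 2 * 0"
      by (intro tendsto_intros LIMSEQ_power_zero) simp
    thus ?thesis by (simp only: power_one_over mult_zero_right)
  qed
  have "\<exists>f\<in>H. (\<lambda>n. nrm (\<lambda>x. F n x - f x)) \<longlonglongrightarrow> 0"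
  proof (rule complete[OF FH])
    fix e :: real assume e: "e > 0"
    have "\<forall>\<^sub>F n in sequentially. 3 / 2 * (1 / (3::real) ^ n) < e / 2"
      using order_tendstoD(2)[OF lim3, of "e / 2"] e by simp
    then obtain N where N: "3 / 2 * (1 / (3::real) ^ N) < e / 2"
      by (auto simp: eventually_sequentially)
    have "nrm (\<lambda>x. F i x - F j x) < e" if "i \<ge> N" "j \<ge> N" for i j
      using nrm_triangle_diff[OF FH FH FH, of i j N] tail'[OF that(1)] tail'[OF that(2)]
        nrm_minus_commute[OF FH FH, of N j] N by linarith
    thus "\<exists>N. \<forall>i\<ge>N. \<forall>j\<ge>N. nrm (\<lambda>x. F i x - F j x) < e" by blast
  qed
  then obtain f where f: "f \<in> H" and lim: "(\<lambda>n. nrm (\<lambda>x. F n x - f x)) \<longlonglongrightarrow> 0" by blast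
  have f_dist: "nrm (\<lambda>x. F n x - f x) \<le> 3 / 2 * (1 / 3 ^ n)" for n
  proof (rule LIMSEQ_le_const)
    have "(\<lambda>m. nrm (\<lambda>x. F m x - f x) + 3 / 2 * (1 / 3 ^ n)) \<longlonglongrightarrow> 0 + 3 / 2 * (1 / 3 ^ n)"
      by (intro tendsto_intros lim)
    thus "(\<lambda>m. nrm (\<lambda>x. F m x - f x) + 3 / 2 * (1 / 3 ^ n)) \<longlonglongrightarrow> 3 / 2 * (1 / 3 ^ n)" by simp
    have "nrm (\<lambda>x. F n x - f x) \<le> nrm (\<lambda>x. F m x - f x) + 3 / 2 * (1 / 3 ^ n)" if "m \<ge> n" for m
      using nrm_triangle_diff[OF FH FH f, of n m] tail'[OF that] nrm_minus_commute[OF FH FH, of n m] by linarith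
    thus "\<exists>N. \<forall>m\<ge>N. nrm (\<lambda>x. F n x - f x) \<le> nrm (\<lambda>x. F m x - f x) + 3 / 2 * (1 / 3 ^ n)" by blast
  qed
  obtain B where B: "\<forall>u\<in>U. cmod (ip f u) \<le> B" using wb[OF f] ..
  obtain n :: nat where n: "real n > B" using reals_Archimedean2[of B] ..
  have "cmod (ip (\<lambda>x. F (Suc n) x - f x) (u n)) \<le> nrm (\<lambda>x. F (Suc n) x - f x) * nrm (u n)"
    by (intro cauchy_schwarz mem FH f uH)
  also have "\<dots> \<le> 3 / 2 * (1 / 3 ^ Suc n) * nrm (u n)"
    by (intro mult_right_mono f_dist nrm_nonneg uH)
  also have "\<dots> = nrm (u n) / 3 ^ n / 2" by simp
  finally have "cmod (ip (F (Suc n)) (u n)) - cmod (ip f (u n)) \<le> nrm (u n) / 3 ^ n / 2"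
    using norm_triangle_ineq2[of "ip (F (Suc n)) (u n)" "ip f (u n)"] by (simp add: ip_diff FH f uH)
  hence "nrm (u n) / 3 ^ n / 2 \<le> cmod (ip f (u n))" using hit[of n] by simp
  also have "\<dots> \<le> B" using bspec[OF B u(1)] .
  finally have "nrm (u n) / 3 ^ n / 2 \<le> B" .
  moreover have "real n < nrm (u n) / 3 ^ n / 2" using u(2)[of n] by (simp add: field_simps)
  ultimately show False using n by simp
qed

lemma Mult_memD: "\<phi> \<in> Mult H \<Longrightarrow> h \<in> H \<Longrightarrow> (\<lambda>x. \<phi> x * h x) \<in> H"
  by (simp add: Mult_def)

text \<open>
  The adjoint of multiplication by \<open>g\<close> maps the kernel at \<open>w\<close> to \<open>cnj (g w)\<close> times itself. So the
  principle of uniform boundedness can be applied to the images of unit kernel combinations, which are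
  explicit vectors. A single multiplier gives the closed graph theorem for its multiplication operator;
  the unit ball of the space, in case it consists of multipliers, gives joint continuity of the product.
\<close>

lemma multipliers_uniformly_bounded:
  assumes G: "G \<subseteq> Mult H"
    and pb: "\<And>f. f \<in> H \<Longrightarrow> \<exists>B. \<forall>g\<in>G. nrm (\<lambda>x. g x * f x) \<le> B"
  shows "\<exists>C\<ge>0. \<forall>g\<in>G. \<forall>f\<in>H. nrm (\<lambda>x. g x * f x) \<le> C * nrm f"
proof -
  define U where "U = {kernel_comb E (\<lambda>w. c w * cnj (g w)) |E c g.
    finite E \<and> g \<in> G \<and> nrm (kernel_comb E c) \<le> 1}"
  have adj: "ip f (kernel_comb E (\<lambda>w. c w * cnj (g w))) = ip (\<lambda>x. g x * f x) (kernel_comb E c)"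
    if "f \<in> H" "g \<in> G" for f g E c
    using that G Mult_memD[of g f] by (auto simp: ip_kernel_comb mult.assoc intro!: sum.cong)
  have "\<exists>C. \<forall>u\<in>U. nrm u \<le> C"
  proof (rule weakly_bounded_imp_bounded)
    show "U \<subseteq> H" by (auto simp: U_def kernel_comb_mem)
    fix f assume f: "f \<in> H"
    obtain B where B: "\<forall>g\<in>G. nrm (\<lambda>x. g x * f x) \<le> B" using pb[OF f] ..
    have "cmod (ip f u) \<le> B" if uU: "u \<in> U" for u
    proof -
      obtain E c g where u: "u = kernel_comb E (\<lambda>w. c w * cnj (g w))" "g \<in> G" "nrm (kernel_comb E c) \<le> 1"
        using uU by (auto simp: U_def)
      have gf: "(\<lambda>x. g x * f x) \<in> H" using Mult_memD f u G by auto
      have "cmod (ip f u) \<le> nrm (\<lambda>x. g x * f x) * nrm (kernel_comb E c)"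
        unfolding u(1) adj[OF f u(2)] by (intro cauchy_schwarz gf kernel_comb_mem)
      also have "\<dots> \<le> nrm (\<lambda>x. g x * f x) * 1" by (intro mult_left_mono u nrm_nonneg gf)
      also have "\<dots> \<le> B" using B u by simp
      finally show ?thesis .
    qed
    thus "\<exists>B. \<forall>u\<in>U. cmod (ip f u) \<le> B" by (intro exI ballI)
  qed
  then obtain C where C: "\<forall>u\<in>U. nrm u \<le> C" ..
  \<comment> \<open>The bound for \<open>U\<close> may be negative if \<open>U\<close> is empty.\<close>
  define D where "D = max C 0"
  have D: "D \<ge> 0" "\<forall>u\<in>U. nrm u \<le> D" using C by (auto simp: D_def max_def intro: order_trans)
  have "nrm (\<lambda>x. g x * f x) \<le> D * nrm f" if g: "g \<in> G" and f: "f \<in> H" for g f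
  proof -
    have gf: "(\<lambda>x. g x * f x) \<in> H" using Mult_memD f g G by auto
    have "cmod (\<Sum>w\<in>E. cnj (c w) * (g w * f w)) \<le> D * nrm f * nrm (kernel_comb E c)" if E: "finite E" for E c
    proof -
      define s where "s = nrm (kernel_comb E c)"
      have eq: "(\<Sum>w\<in>E. cnj (c w) * (g w * f w)) = ip (\<lambda>x. g x * f x) (kernel_comb E c)"
        by (simp add: ip_kernel_comb gf)
      show ?thesis
      proof (cases "s = 0")
        case True
        thus ?thesis using cauchy_schwarz[OF gf kernel_comb_mem, of E c] by (simp add: eq s_def)
      next
        case False
        hence s: "s > 0" using nrm_nonneg[OF kernel_comb_mem, of E c] by (simp add: s_def)
        define d where "d = (\<lambda>w. of_real (1 / s) * c w)"
        have d: "kernel_comb E d = (\<lambda>x. of_real (1 / s) * kernel_comb E c x)"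
          by (simp only: kernel_comb_scale d_def)
        have d1: "nrm (kernel_comb E d) = 1"
          using s unfolding d nrm_scale[OF kernel_comb_mem] by (simp add: s_def norm_divide)
        have d2: "ip (\<lambda>x. g x * f x) (kernel_comb E d)
            = of_real (1 / s) * ip (\<lambda>x. g x * f x) (kernel_comb E c)"
          unfolding d ip_scale_right[OF kernel_comb_mem gf] by simp
        have "kernel_comb E (\<lambda>w. d w * cnj (g w)) \<in> U"
          unfolding U_def by (intro CollectI exI[of _ E] exI[of _ d] exI[of _ g]) (simp add: E g d1)
        hence "nrm (kernel_comb E (\<lambda>w. d w * cnj (g w))) \<le> D" using D(2) by (rule bspec[rotated])
        hence "nrm f * nrm (kernel_comb E (\<lambda>w. d w * cnj (g w))) \<le> nrm f * D"
          by (rule mult_left_mono) (rule nrm_nonneg[OF f])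
        with cauchy_schwarz[OF f kernel_comb_mem]
        have "cmod (ip f (kernel_comb E (\<lambda>w. d w * cnj (g w)))) \<le> nrm f * D" by (rule order_trans)
        hence "cmod (ip (\<lambda>x. g x * f x) (kernel_comb E c)) / s \<le> nrm f * D"
          using s unfolding adj[OF f g] d2 by (simp add: norm_mult norm_divide)
        thus ?thesis using s unfolding eq s_def[symmetric] by (simp add: field_simps)
      qed
    qed
    thus ?thesis using membership_criterion(2)[of "D * nrm f" "\<lambda>x. g x * f x"] D(1) nrm_nonneg[OF f] by simp
  qed
  thus ?thesis using D(1) by (intro exI[of _ D]) simp
qed

text \<open>
  A relation between multipliers and bounds takes the place of the multiplier norm, since the finiteness
  of that norm is itself a theorem (\<open>Mult_imp_mult_bounded\<close>).
\<close>

definition mult_bounded :: "('x \<Rightarrow> complex) \<Rightarrow> real \<Rightarrow> bool" where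
  "mult_bounded \<phi> C \<longleftrightarrow> \<phi> \<in> Mult H \<and> 0 \<le> C \<and> (\<forall>h\<in>H. nrm (\<lambda>x. \<phi> x * h x) \<le> C * nrm h)"

lemma mult_boundedD:
  assumes "mult_bounded \<phi> C"
  shows "\<phi> \<in> Mult H" "0 \<le> C" "h \<in> H \<Longrightarrow> (\<lambda>x. \<phi> x * h x) \<in> H"
    "h \<in> H \<Longrightarrow> nrm (\<lambda>x. \<phi> x * h x) \<le> C * nrm h"
  using assms by (auto simp: mult_bounded_def Mult_def)

lemma Mult_imp_mult_bounded:
  assumes "\<phi> \<in> Mult H"
  obtains C where "mult_bounded \<phi> C"
proof -
  have "\<exists>C\<ge>0. \<forall>g\<in>{\<phi>}. \<forall>f\<in>H. nrm (\<lambda>x. g x * f x) \<le> C * nrm f"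
    by (rule multipliers_uniformly_bounded) (use assms in auto)
  thus ?thesis using that assms by (auto simp: mult_bounded_def)
qed

lemma mult_bounded_const: "mult_bounded (\<lambda>x. c) (cmod c)"
  by (auto simp: mult_bounded_def Mult_def mem nrm_scale)

lemma mult_bounded_add:
  assumes a: "mult_bounded \<phi> C" and b: "mult_bounded \<psi> D"
  shows "mult_bounded (\<lambda>x. \<phi> x + \<psi> x) (C + D)"
proof -
  have "(\<lambda>x. (\<phi> x + \<psi> x) * h x) \<in> H \<and> nrm (\<lambda>x. (\<phi> x + \<psi> x) * h x) \<le> (C + D) * nrm h" if h: "h \<in> H" for h
    using nrm_triangle[OF mult_boundedD(3)[OF a h] mult_boundedD(3)[OF b h]]
      mult_boundedD(3,4)[OF a h] mult_boundedD(3,4)[OF b h]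
    by (simp add: distrib_right mem)
  thus ?thesis using mult_boundedD(2)[OF a] mult_boundedD(2)[OF b]
    by (auto simp: mult_bounded_def Mult_def)
qed

lemma mult_bounded_mult:
  assumes a: "mult_bounded \<phi> C" and b: "mult_bounded \<psi> D"
  shows "mult_bounded (\<lambda>x. \<phi> x * \<psi> x) (C * D)"
proof -
  have "(\<lambda>x. \<phi> x * \<psi> x * h x) \<in> H \<and> nrm (\<lambda>x. \<phi> x * \<psi> x * h x) \<le> C * D * nrm h" if h: "h \<in> H" for h
    using mult_boundedD(3,4)[OF a mult_boundedD(3)[OF b h]]
      mult_left_mono[OF mult_boundedD(4)[OF b h] mult_boundedD(2)[OF a]]
    by (simp add: mult.assoc)
  thus ?thesis using mult_boundedD(2)[OF a] mult_boundedD(2)[OF b]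
    by (auto simp: mult_bounded_def Mult_def)
qed

lemma Mult_add: "\<phi> \<in> Mult H \<Longrightarrow> \<psi> \<in> Mult H \<Longrightarrow> (\<lambda>x. \<phi> x + \<psi> x) \<in> Mult H"
  by (simp add: Mult_def distrib_right mem)

lemma Mult_mult: "\<phi> \<in> Mult H \<Longrightarrow> \<psi> \<in> Mult H \<Longrightarrow> (\<lambda>x. \<phi> x * \<psi> x) \<in> Mult H"
  by (simp add: Mult_def mult.assoc)

lemma Mult_const: "(\<lambda>x. c) \<in> Mult H"
  by (simp add: Mult_def mem)

text \<open>
  Kernels are eigenvectors of the adjoint of a multiplication operator.
\<close>

lemma mult_bounded_pointwise:
  assumes b: "mult_bounded \<phi> c" and k: "k x x \<noteq> 0"
  shows "cmod (\<phi> x) \<le> c"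
proof -
  let ?k = "\<lambda>y. k y x"
  have "k x x = of_real ((nrm ?k)\<^sup>2)"
    using ip_self[OF kernel_mem, of x] ip_kernel[OF kernel_mem, of x x] by simp
  hence kk: "cmod (k x x) = nrm ?k * nrm ?k" by (simp add: power2_eq_square norm_mult)
  hence n: "nrm ?k * nrm ?k > 0" using k by (metis zero_less_norm_iff)
  have "cmod (\<phi> x) * (nrm ?k * nrm ?k) = cmod (ip (\<lambda>y. \<phi> y * ?k y) ?k)"
    using mult_boundedD(3)[OF b kernel_mem] by (simp add: ip_kernel norm_mult kk)
  also have "\<dots> \<le> nrm (\<lambda>y. \<phi> y * ?k y) * nrm ?k"
    by (intro cauchy_schwarz mult_boundedD(3)[OF b] kernel_mem)
  also have "\<dots> \<le> c * nrm ?k * nrm ?k"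
    by (intro mult_right_mono mult_boundedD(4)[OF b] nrm_nonneg kernel_mem)
  finally have "cmod (\<phi> x) * (nrm ?k * nrm ?k) \<le> c * (nrm ?k * nrm ?k)" by (simp only: mult.assoc)
  thus ?thesis using n by (rule mult_right_le_imp_le)
qed

lemma neumann_inverse:
  assumes b: "mult_bounded \<phi> c" and c: "c < 1" and k: "\<And>x. k x x \<noteq> 0"
  shows "mult_bounded (\<lambda>x. 1 / (1 - \<phi> x)) (1 / (1 - c))"
proof -
  have c0: "c \<ge> 0" by (rule mult_boundedD(2)[OF b])
  have \<phi>: "cmod (\<phi> x) < 1" for x using mult_bounded_pointwise[OF b k, of x] c by simp
  have *: "(\<lambda>x. 1 / (1 - \<phi> x) * h x) \<in> H" "nrm (\<lambda>x. 1 / (1 - \<phi> x) * h x) \<le> nrm h / (1 - c)"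
    if h: "h \<in> H" for h
  proof -
    have pw: "(\<lambda>x. \<phi> x ^ j * h x) \<in> H \<and> nrm (\<lambda>x. \<phi> x ^ j * h x) \<le> c ^ j * nrm h" for j
    proof (induction j)
      case (Suc j)
      thus ?case using mult_boundedD(3,4)[OF b, of "\<lambda>x. \<phi> x ^ j * h x"] c0
          mult_left_mono[of "nrm (\<lambda>x. \<phi> x ^ j * h x)" "c ^ j * nrm h" c]
        by (simp add: mult.assoc)
    qed (use h in simp)
    let ?F = "\<lambda>n x. \<Sum>j<n. \<phi> x ^ j * h x"
    have F: "?F n \<in> H" for n using pw by (intro mem) auto
    have Fn: "nrm (?F n) \<le> nrm h / (1 - c)" for n
    proof -
      have "nrm (?F n) \<le> (\<Sum>j<n. nrm (\<lambda>x. \<phi> x ^ j * h x))" by (rule nrm_sum_le) (use pw in auto)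
      also have "\<dots> \<le> (\<Sum>j<n. c ^ j * nrm h)" by (rule sum_mono) (use pw in auto)
      also have "\<dots> = (\<Sum>j<n. c ^ j) * nrm h" by (simp add: sum_distrib_right)
      also have "(\<Sum>j<n. c ^ j) = (1 - c ^ n) / (1 - c)"
        using c by (simp add: sum_gp_strict)
      also have "\<dots> * nrm h \<le> 1 / (1 - c) * nrm h"
        using c c0 nrm_nonneg[OF h] by (intro mult_right_mono divide_right_mono) auto
      finally show ?thesis by simp
    qed
    have lim: "(\<lambda>n. ?F n x) \<longlonglongrightarrow> 1 / (1 - \<phi> x) * h x" for x
      unfolding sum_distrib_right[symmetric]
      using geometric_sums[OF \<phi>[of x], unfolded sums_def] by (intro tendsto_intros)
    have C: "0 \<le> nrm h / (1 - c)" using c nrm_nonneg[OF h] by simp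
    show "(\<lambda>x. 1 / (1 - \<phi> x) * h x) \<in> H" "nrm (\<lambda>x. 1 / (1 - \<phi> x) * h x) \<le> nrm h / (1 - c)"
      by (rule membership_pointwise_limit[OF C F Fn lim])+
  qed
  thus ?thesis using c by (auto simp: mult_bounded_def Mult_def)
qed

lemma kernel_comb_sum:
  "(\<lambda>x. \<Sum>a\<in>I. b a * kernel_comb E (c a) x) = kernel_comb E (\<lambda>w. \<Sum>a\<in>I. b a * c a w)"
proof
  fix x
  have "(\<Sum>a\<in>I. b a * kernel_comb E (c a) x) = (\<Sum>a\<in>I. \<Sum>w\<in>E. b a * c a w * k x w)"
    by (simp add: kernel_comb_def sum_distrib_left mult.assoc)
  also have "\<dots> = kernel_comb E (\<lambda>w. \<Sum>a\<in>I. b a * c a w) x"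
    by (subst sum.swap) (simp add: kernel_comb_def sum_distrib_right)
  finally show "(\<Sum>a\<in>I. b a * kernel_comb E (c a) x) = kernel_comb E (\<lambda>w. \<Sum>a\<in>I. b a * c a w) x" .
qed

text \<open>
  Gram--Schmidt for the kernels at the points of \<open>E\<close>. The last clause is the finite expansion
  \<open>k x w = \<Sum> e x * cnj (e w)\<close>, which yields both the Schur product theorem and interpolation below.
\<close>

lemma kernel_span_orthonormal_basis:
  assumes "finite E"
  shows "\<exists>m (e :: nat \<Rightarrow> 'x \<Rightarrow> complex). (\<forall>a<m. \<exists>c. e a = kernel_comb E c) \<and>
     (\<forall>a<m. \<forall>b<m. ip (e a) (e b) = (if a = b then 1 else 0)) \<and>
     (\<forall>w\<in>E. \<forall>x. k x w = (\<Sum>a<m. cnj (e a w) * e a x))"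
  using assms
proof (induction E rule: finite_induct)
  case empty
  show ?case by (intro exI[of _ 0]) simp
next
  case (insert w E)
  from insert.IH obtain m and e :: "nat \<Rightarrow> 'x \<Rightarrow> complex" where
    me: "\<forall>a<m. \<exists>c. e a = kernel_comb E c"
      "\<forall>a<m. \<forall>b<m. ip (e a) (e b) = (if a = b then 1 else 0)"
      "\<forall>w\<in>E. \<forall>x. k x w = (\<Sum>a<m. cnj (e a w) * e a x)"
    by (elim exE conjE)
  have span: "\<exists>c. e a = kernel_comb E c" if "a < m" for a using me(1) that by simp
  have orth: "ip (e a) (e b) = (if a = b then 1 else 0)" if "a < m" "b < m" for a b using me(2) that by simp
  have rep: "k x v = (\<Sum>a<m. cnj (e a v) * e a x)" if "v \<in> E" for v x using me(3) that by simp
  have eH: "e a \<in> H" if "a < m" for a using span[OF that] kernel_comb_mem by auto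
  have span': "\<exists>c. e a = kernel_comb (insert w E) c" if a: "a < m" for a
  proof -
    obtain c where c: "e a = kernel_comb E c" using span[OF a] ..
    show ?thesis unfolding c
      by (rule exI, rule kernel_comb_extend) (use insert.hyps(1) in auto)
  qed
  define P where "P = (\<lambda>x. \<Sum>a<m. cnj (e a w) * e a x)"
  define g where "g = (\<lambda>x. k x w - P x)"
  have PH: "P \<in> H" unfolding P_def by (intro mem eH) auto
  have gH: "g \<in> H" unfolding g_def by (intro mem PH)
  have P_span: "\<exists>c. P = kernel_comb (insert w E) c"
  proof -
    have "\<forall>a\<in>{..<m}. \<exists>c. e a = kernel_comb (insert w E) c" using span' by simp
    then obtain c where c: "\<forall>a\<in>{..<m}. e a = kernel_comb (insert w E) (c a)" by (rule bchoice[THEN exE])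
    have "P = (\<lambda>x. \<Sum>a<m. cnj (e a w) * kernel_comb (insert w E) (c a) x)"
      unfolding P_def by (intro ext sum.cong) (auto simp: c)
    thus ?thesis by (auto simp: kernel_comb_sum)
  qed
  have k_span: "(\<lambda>x. k x w) = kernel_comb (insert w E) (\<lambda>v. if v = w then 1 else 0)"
    using insert.hyps by (auto simp: kernel_comb_def if_distrib[of "\<lambda>a. a * _"] cong: if_cong)
  have g_span: "\<exists>c. g = kernel_comb (insert w E) c"
  proof -
    obtain c where c: "P = kernel_comb (insert w E) c" using P_span ..
    have "g = (\<lambda>x. kernel_comb (insert w E) (\<lambda>v. if v = w then 1 else 0) x
        + kernel_comb (insert w E) (\<lambda>v. -1 * c v) x)"
      unfolding g_def kernel_comb_scale[symmetric] c[symmetric] k_span[symmetric] by simp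
    thus ?thesis by (auto simp: kernel_comb_add)
  qed
  have g_orth: "ip (e b) g = 0" if b: "b < m" for b
  proof -
    have "ip (e b) P = (\<Sum>a<m. e a w * ip (e b) (e a))"
      unfolding P_def using b by (subst ip_sum_right) (auto simp: mem eH ip_scale_right)
    also have "\<dots> = (\<Sum>a<m. if a = b then e a w else 0)" by (intro sum.cong) (auto simp: orth b)
    also have "\<dots> = e b w" using b by simp
    finally show ?thesis unfolding g_def using b by (simp add: ip_diff_right mem PH eH ip_kernel)
  qed
  show ?case
  proof (cases "g = (\<lambda>x. 0)")
    case True
    hence "k x w = P x" for x using fun_cong[OF g_def, of x] by simp
    thus ?thesis using span' orth rep by (intro exI[of _ m] exI[of _ e]) (auto simp: P_def)
  next
    case False
    define s where "s = nrm g"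
    have s: "s > 0" using nrm_eq_0[OF gH] False nrm_nonneg[OF gH] by (force simp: s_def)
    define f where "f = (\<lambda>x. of_real (1 / s) * g x)"
    have fH: "f \<in> H" unfolding f_def by (intro mem gH)
    have f_span: "\<exists>c. f = kernel_comb (insert w E) c" 
    using g_span unfolding f_def by (elim exE) (simp only: kernel_comb_scale, rule exI, rule refl)
    have g_f: "g = (\<lambda>x. of_real s * f x)" using s by (simp add: f_def)
    have fl: "ip f h = of_real (1 / s) * ip g h" if "h \<in> H" for h
      unfolding f_def by (rule ip_scale[OF gH that])
    have fr: "ip h f = of_real (1 / s) * ip h g" if "h \<in> H" for h
      unfolding f_def ip_scale_right[OF gH that] by simp
    have ff: "ip f f = 1"
      using s by (simp add: fl[OF fH] fr[OF gH] ip_self gH s_def[symmetric] power2_eq_square)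
    have ef: "ip (e b) f = 0" if "b < m" for b
      using g_orth[OF that] fr[OF eH[OF that]] by simp
    have fe: "ip f (e b) = 0" if "b < m" for b
      using ip_cnj[OF eH[OF that] fH] ef[OF that] by simp
    have fE: "f v = 0" if v: "v \<in> E" for v
    proof -
      have "f v = ip f (\<lambda>x. \<Sum>a<m. cnj (e a v) * e a x)" using ip_kernel[OF fH, of v] rep[OF v] by simp
      also have "\<dots> = (\<Sum>a<m. e a v * ip f (e a))"
        by (subst ip_sum_right) (auto simp: mem eH ip_scale_right fH)
      finally show ?thesis by (simp add: fe)
    qed
    have fP: "ip f P = 0"
      unfolding P_def by (subst ip_sum_right) (auto simp: mem eH ip_scale_right fH fe)
    have fw: "f w = of_real s"
    proof -
      have "k x w = of_real s * f x + P x" for x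
        using fun_cong[OF g_f, of x] fun_cong[OF g_def, of x] by (simp only: diff_eq_eq)
      hence "(\<lambda>x. k x w) = (\<lambda>x. of_real s * f x + P x)" by (simp only:)
      hence "f w = ip f (\<lambda>x. of_real s * f x + P x)" using ip_kernel[OF fH, of w] by simp
      thus ?thesis by (simp add: ip_add_right mem fH PH ip_scale_right ff fP)
    qed
    let ?e = "e(m := f)"
    have sum_e: "(\<Sum>a<Suc m. cnj (?e a v) * ?e a x) = (\<Sum>a<m. cnj (e a v) * e a x) + cnj (f v) * f x" for v x
      by simp
    have "k x w = (\<Sum>a<Suc m. cnj (?e a w) * ?e a x)" for x
      unfolding sum_e fw using fun_cong[OF g_f, of x] by (simp add: g_def P_def algebra_simps)
    moreover have "k x v = (\<Sum>a<Suc m. cnj (?e a v) * ?e a x)" if "v \<in> E" for v x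
      unfolding sum_e fE[OF that] using rep[OF that] by simp
    moreover have "\<exists>c. ?e a = kernel_comb (insert w E) c" if "a < Suc m" for a
      using that span' f_span by (auto simp: less_Suc_eq)
    moreover have "ip (?e a) (?e b) = (if a = b then 1 else 0)" if "a < Suc m" "b < Suc m" for a b
      using that orth ff ef fe by (auto simp: less_Suc_eq)
    ultimately show ?thesis by (intro exI[of _ "Suc m"] exI[of _ ?e]) blast
  qed
qed

text \<open>
  The expansion of \<open>k\<close> into rank one terms writes the form for \<open>k * M\<close> as a sum of forms for \<open>M\<close> with
  rescaled coefficients.
\<close>

lemma schur_product_kernel:
  assumes E: "finite E"
    and M: "\<And>d. 0 \<le> Re (\<Sum>z\<in>E. \<Sum>w\<in>E. d w * cnj (d z) * M z w)"
  shows "0 \<le> Re (\<Sum>z\<in>E. \<Sum>w\<in>E. c w * cnj (c z) * (k z w * M z w))"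
proof -
  obtain m and e :: "nat \<Rightarrow> 'x \<Rightarrow> complex" where
    rep: "\<And>w x. w \<in> E \<Longrightarrow> k x w = (\<Sum>a<m. cnj (e a w) * e a x)"
    using kernel_span_orthonormal_basis[OF E] by blast
  have "(\<Sum>z\<in>E. \<Sum>w\<in>E. c w * cnj (c z) * (k z w * M z w))
      = (\<Sum>z\<in>E. \<Sum>w\<in>E. \<Sum>a<m. (c w * cnj (e a w)) * cnj (c z * cnj (e a z)) * M z w)"
    by (intro sum.cong refl) (simp add: rep sum_distrib_left sum_distrib_right mult_ac)
  also have "\<dots> = (\<Sum>a<m. \<Sum>z\<in>E. \<Sum>w\<in>E. (c w * cnj (e a w)) * cnj (c z * cnj (e a z)) * M z w)"
    by (subst sum.swap[of _ "{..<m}" E], subst sum.swap[of _ "{..<m}" E]) (rule refl)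
  finally show ?thesis using M by (simp only: Re_sum[of _ "{..<m}"]) (intro sum_nonneg M)
qed

text \<open>
  The interpolating combination is the orthogonal projection of \<open>u\<close> onto the span of the kernels.
\<close>

lemma kernel_interpolation:
  assumes E: "finite E" and u: "u \<in> H"
  shows "\<exists>c. (\<forall>w\<in>E. kernel_comb E c w = u w) \<and> nrm (kernel_comb E c) \<le> nrm u"
proof -
  obtain m and e :: "nat \<Rightarrow> 'x \<Rightarrow> complex" where
    span: "\<And>a. a < m \<Longrightarrow> \<exists>c. e a = kernel_comb E c" and
    rep: "\<And>w x. w \<in> E \<Longrightarrow> k x w = (\<Sum>a<m. cnj (e a w) * e a x)"
    using kernel_span_orthonormal_basis[OF E] by blast
  have eH: "e a \<in> H" if "a < m" for a using span[OF that] kernel_comb_mem by auto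
  have "\<forall>a\<in>{..<m}. \<exists>c. e a = kernel_comb E c" using span by simp
  then obtain c' where c': "\<forall>a\<in>{..<m}. e a = kernel_comb E (c' a)" by (rule bchoice[THEN exE])
  define c where "c = (\<lambda>w. \<Sum>a<m. ip u (e a) * c' a w)"
  have s: "kernel_comb E c = (\<lambda>x. \<Sum>a<m. ip u (e a) * e a x)"
    unfolding c_def kernel_comb_sum[symmetric] by (intro ext sum.cong) (auto simp: c')
  have val: "kernel_comb E c w = u w" if w: "w \<in> E" for w
  proof -
    have "u w = ip u (\<lambda>x. \<Sum>a<m. cnj (e a w) * e a x)" using ip_kernel[OF u, of w] rep[OF w] by simp
    also have "\<dots> = (\<Sum>a<m. e a w * ip u (e a))"
      using u by (subst ip_sum_right) (auto simp: mem eH ip_scale_right)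
    finally show ?thesis by (simp add: s mult.commute)
  qed
  let ?s = "kernel_comb E c"
  have "ip u ?s = ip ?s ?s" using u val by (simp add: ip_kernel_comb kernel_comb_mem)
  hence "(nrm ?s)\<^sup>2 = Re (ip u ?s)" by (simp add: nrm_sq kernel_comb_mem)
  also have "\<dots> \<le> nrm u * nrm ?s"
    by (rule order_trans[OF complex_Re_le_cmod cauchy_schwarz[OF u kernel_comb_mem]])
  finally have "nrm ?s \<le> nrm u"
    using nrm_nonneg[OF kernel_comb_mem, of E c] nrm_nonneg[OF u]
    by (cases "nrm ?s = 0") (simp_all add: power2_eq_square)
  with val show ?thesis by (intro exI[of _ c] conjI ballI)
qed

end

section \<open>Contractive rows of multipliers\<close>

lemma mat_adjoint_carrier: "A \<in> carrier_mat n m \<Longrightarrow> mat_adjoint A \<in> carrier_mat m n"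
  unfolding mat_adjoint_def mat_of_rows_def by simp

lemma mat_adjoint_index:
  fixes A :: "complex mat"
  assumes "A \<in> carrier_mat n m" "i < m" "j < n"
  shows "mat_adjoint A $$ (i, j) = cnj (A $$ (j, i))"
  using assms unfolding mat_adjoint_def mat_of_rows_def by simp

locale normalized_pick_space = rkhs H ip k
  for H :: "('x \<Rightarrow> complex) set"
    and ip :: "('x \<Rightarrow> complex) \<Rightarrow> ('x \<Rightarrow> complex) \<Rightarrow> complex"
    and k :: "'x \<Rightarrow> 'x \<Rightarrow> complex" +
  fixes x0 :: 'x
  assumes diag: "k x x \<noteq> 0"
    and base: "k x x0 = 1"
    and pick: "complete_pick H ip k"
begin

lemma one_mem: "(\<lambda>x. 1) \<in> H"
  using kernel_mem[of x0] by (simp add: base)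

lemma ip_one_one: "ip (\<lambda>x. 1) (\<lambda>x. 1) = 1"
  using ip_kernel[OF one_mem, of x0] by (simp add: base)

text \<open>
  The matrix \<open>W i\<close> has the row \<open>B (z i)\<close> as its first row and is zero elsewhere. The Pick matrix then
  splits, along the residue of the index modulo \<open>m\<close>, into one block with all entries \<open>1\<close> and \<open>m - 1\<close>
  copies of the kernel matrix. All these blocks are Gram matrices in the space, the first one because
  \<open>1 = k x0 x0\<close>.
\<close>

lemma pos_semidef_row_pick_matrix:
  assumes m: "m > 0"
    and gram: "\<And>i j. i < n \<Longrightarrow> j < n \<Longrightarrow> k (z i) (z j) * (1 - (\<Sum>l<m. B l (z i) * cnj (B l (z j)))) = 1"
  defines "W \<equiv> \<lambda>i. Matrix.mat m m (\<lambda>(a, c). if a = 0 then B c (z i) else 0)"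
  shows "pos_semidef (pick_matrix k m n z W)"
proof -
  let ?A = "pick_matrix k m n z W"
  \<comment> \<open>The entry at \<open>(p, q)\<close> is the inner product of \<open>\<kappa> q\<close> and \<open>\<kappa> p\<close> if the residues agree, else \<open>0\<close>.\<close>
  define \<kappa> where "\<kappa> = (\<lambda>p x. if p mod m = 0 then k x x0 else k x (z (p div m)))"
  have \<kappa>H: "\<kappa> p \<in> H" for p by (cases "p mod m = 0") (simp_all add: \<kappa>_def kernel_mem)
  have Wc: "W i \<in> carrier_mat m m" for i by (simp add: W_def)
  have entry: "?A $$ (p, q) = (if p mod m = q mod m then ip (\<kappa> q) (\<kappa> p) else 0)"
    if p: "p < n * m" and q: "q < n * m" for p q
  proof -
    define i j a c where "i = p div m" and "j = q div m" and "a = p mod m" and "c = q mod m"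
    have ij: "i < n" "j < n" using p q by (simp_all add: i_def j_def less_mult_imp_div_less)
    have ac: "a < m" "c < m" using m by (simp_all add: a_def c_def)
    have adj: "mat_adjoint (W j) \<in> carrier_mat m m"
      by (rule mat_adjoint_carrier[OF Wc])
    have "?A $$ (p, q) = k (z i) (z j) * ((if a = c then 1 else 0) - (W i * mat_adjoint (W j)) $$ (a, c))"
      using p q ac Wc[of i] adj by (simp add: pick_matrix_def Let_def i_def[symmetric] j_def[symmetric]
          a_def[symmetric] c_def[symmetric])
    also have "(W i * mat_adjoint (W j)) $$ (a, c) = (\<Sum>l<m. W i $$ (a, l) * cnj (W j $$ (c, l)))"
      using ac Wc[of i] Wc[of j] adj
      by (simp add: scalar_prod_def lessThan_atLeast0 mat_adjoint_index[OF Wc[of j]])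
    also have "\<dots> = (if a = 0 \<and> c = 0 then \<Sum>l<m. B l (z i) * cnj (B l (z j)) else 0)"
      using ac m by (auto simp: W_def)
    also have "k (z i) (z j) * ((if a = c then 1 else 0) - \<dots>)
        = (if a = c then if a = 0 then 1 else k (z i) (z j) else 0)"
      using gram[OF ij] by auto
    also have "\<dots> = (if a = c then ip (\<kappa> q) (\<kappa> p) else 0)"
      by (auto simp: \<kappa>_def i_def j_def a_def c_def ip_kernel kernel_mem base ip_one_one)
    finally show ?thesis by (simp add: a_def c_def)
  qed
  have dim: "?A \<in> carrier_mat (n * m) (n * m)" by (simp add: pick_matrix_def)
  have "0 \<le> (?A *\<^sub>v v) \<bullet>c v" if v: "v \<in> carrier_vec (n * m)" for v
  proof -
    let ?P = "{..<n * m}"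
    define u where "u = (\<lambda>a x. \<Sum>p\<in>?P. (if p mod m = a then vec_index v p else 0) * \<kappa> p x)"
    have uH: "u a \<in> H" for a unfolding u_def by (intro mem \<kappa>H)
    have uu: "ip (u a) (u a) = (\<Sum>p\<in>?P. \<Sum>q\<in>?P.
        if p mod m = a \<and> q mod m = a then vec_index v q * cnj (vec_index v p) * ip (\<kappa> q) (\<kappa> p) else 0)" for a
      unfolding u_def ip_linear_combinations[of \<kappa>, OF \<kappa>H] by (intro sum.cong refl) auto
    have "(?A *\<^sub>v v) \<bullet>c v = (\<Sum>p\<in>?P. (\<Sum>q\<in>?P. ?A $$ (p, q) * vec_index v q) * cnj (vec_index v p))"
      using carrier_vecD[OF v] carrier_matD[OF dim] by (simp add: scalar_prod_def lessThan_atLeast0)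
    also have "\<dots> = (\<Sum>p\<in>?P. \<Sum>q\<in>?P. \<Sum>a<m.
        if p mod m = a \<and> q mod m = a then vec_index v q * cnj (vec_index v p) * ip (\<kappa> q) (\<kappa> p) else 0)"
      unfolding sum_distrib_right
    proof (intro sum.cong refl)
      fix p q assume pq: "p \<in> ?P" "q \<in> ?P"
      have "(\<Sum>a<m. if p mod m = a \<and> q mod m = a then vec_index v q * cnj (vec_index v p) * ip (\<kappa> q) (\<kappa> p) else 0)
          = (\<Sum>a<m. if p mod m = a then if p mod m = q mod m then vec_index v q * cnj (vec_index v p) * ip (\<kappa> q) (\<kappa> p) else 0 else 0)"
        by (intro sum.cong) auto
      also have "\<dots> = (if p mod m = q mod m then vec_index v q * cnj (vec_index v p) * ip (\<kappa> q) (\<kappa> p) else 0)"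
        using m by simp
      finally show "?A $$ (p, q) * vec_index v q * cnj (vec_index v p) = (\<Sum>a<m. if p mod m = a \<and> q mod m = a
          then vec_index v q * cnj (vec_index v p) * ip (\<kappa> q) (\<kappa> p) else 0)"
        using pq by (simp add: entry)
    qed
    also have "\<dots> = (\<Sum>a<m. ip (u a) (u a))"
      unfolding uu by (subst sum.swap[of _ "{..<m}" ?P], subst sum.swap[of _ "{..<m}" ?P]) (rule refl)
    also have "\<dots> = of_real (\<Sum>a<m. (nrm (u a))\<^sup>2)" by (simp add: ip_self uH)
    finally show ?thesis by (simp add: less_eq_complex_def sum_nonneg)
  qed
  thus ?thesis using dim by (auto simp: pos_semidef_def)
qed

text \<open>
  The row operator from the \<open>m\<close>-fold direct sum of the space to the space is a contraction.
\<close>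

definition row_contractive :: "nat \<Rightarrow> (nat \<Rightarrow> 'x \<Rightarrow> complex) \<Rightarrow> bool" where
  "row_contractive m b \<longleftrightarrow> (\<forall>l<m. b l \<in> Mult H) \<and>
     (\<forall>h. (\<forall>l<m. h l \<in> H) \<longrightarrow> (nrm (\<lambda>x. \<Sum>l<m. b l x * h l x))\<^sup>2 \<le> (\<Sum>l<m. (nrm (h l))\<^sup>2))"

lemma row_contractiveD:
  assumes "row_contractive m b"
  shows "l < m \<Longrightarrow> b l \<in> Mult H"
    "(\<And>l. l < m \<Longrightarrow> h l \<in> H) \<Longrightarrow> (nrm (\<lambda>x. \<Sum>l<m. b l x * h l x))\<^sup>2 \<le> (\<Sum>l<m. (nrm (h l))\<^sup>2)"
  using assms by (auto simp: row_contractive_def)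

text \<open>
  The complete Pick property for data that sit in a single row: the first row of the interpolating
  matrix multiplier is the required row.
\<close>

lemma pick_row_interpolation:
  assumes m: "m > 0" and E: "finite E"
    and gram: "\<And>x y. x \<in> E \<Longrightarrow> y \<in> E \<Longrightarrow> k x y * (1 - (\<Sum>l<m. B l x * cnj (B l y))) = 1"
  shows "\<exists>b. row_contractive m b \<and> (\<forall>l<m. \<forall>x\<in>E. b l x = B l x)"
proof -
  obtain z :: "nat \<Rightarrow> 'x" and n where z: "E = z ` {i. i < n}"
    using finite_imp_nat_seg_image_inj_on[OF E] by auto
  define W where "W = (\<lambda>i. Matrix.mat m m (\<lambda>(a, c). if a = 0 then B c (z i) else 0))"
  have "pos_semidef (pick_matrix k m n z W)"
    unfolding W_def by (rule pos_semidef_row_pick_matrix[OF m gram]) (auto simp: z)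
  moreover have "\<forall>i<n. W i \<in> carrier_mat m m" by (simp add: W_def)
  ultimately obtain \<Phi> where \<Phi>: "\<Phi> \<in> mat_Mult m H" "mult_norm_le_1 m H ip \<Phi>" "\<forall>i<n. \<Phi> (z i) = W i"
    using pick unfolding complete_pick_def by blast
  define b where "b = (\<lambda>l x. \<Phi> x $$ (0, l))"
  have \<Phi>c: "\<Phi> x \<in> carrier_mat m m" for x using \<Phi>(1) by (simp add: mat_Mult_def)
  have bM: "b l \<in> Mult H" if "l < m" for l using \<Phi>(1) m that by (simp add: mat_Mult_def b_def)
  have "(nrm (\<lambda>x. \<Sum>l<m. b l x * h l x))\<^sup>2 \<le> (\<Sum>l<m. (nrm (h l))\<^sup>2)"
    if h: "\<forall>l<m. h l \<in> H" for h
  proof -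
    define F where "F = (\<lambda>x. Matrix.vec m (\<lambda>l. h l x))"
    have Fa: "(\<lambda>x. vec_index (F x) a) = h a" if "a < m" for a using that by (simp add: F_def)
    have F: "F \<in> tensor_space m H" using h Fa by (simp add: tensor_space_def) (simp add: F_def)
    have "tensor_norm m ip (\<lambda>x. \<Phi> x *\<^sub>v F x) \<le> tensor_norm m ip F"
      using \<Phi>(2) F by (simp add: mult_norm_le_1_def)
    hence le: "(\<Sum>a<m. (nrm (\<lambda>x. vec_index (\<Phi> x *\<^sub>v F x) a))\<^sup>2) \<le> (\<Sum>a<m. (nrm (\<lambda>x. vec_index (F x) a))\<^sup>2)"
      by (simp add: tensor_norm_def)
    have "(\<lambda>x. vec_index (\<Phi> x *\<^sub>v F x) 0) = (\<lambda>x. \<Sum>l<m. b l x * h l x)"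
    proof
      fix x
      show "vec_index (\<Phi> x *\<^sub>v F x) 0 = (\<Sum>l<m. b l x * h l x)"
        using \<Phi>c[of x] m by (simp add: scalar_prod_def lessThan_atLeast0 F_def b_def)
    qed
    hence "(nrm (\<lambda>x. \<Sum>l<m. b l x * h l x))\<^sup>2 = (nrm (\<lambda>x. vec_index (\<Phi> x *\<^sub>v F x) 0))\<^sup>2" by simp
    also have "\<dots> \<le> (\<Sum>a<m. (nrm (\<lambda>x. vec_index (\<Phi> x *\<^sub>v F x) a))\<^sup>2)"
      using m by (intro member_le_sum) auto
    also note le
    also have "(\<Sum>a<m. (nrm (\<lambda>x. vec_index (F x) a))\<^sup>2) = (\<Sum>a<m. (nrm (h a))\<^sup>2)"
      by (intro sum.cong refl) (simp add: Fa)
    finally show ?thesis .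
  qed
  hence "row_contractive m b" using bM by (simp add: row_contractive_def)
  moreover have "\<forall>l<m. \<forall>x\<in>E. b l x = B l x" using \<Phi>(3) m by (auto simp: z b_def W_def)
  ultimately show ?thesis by (intro exI[of _ b] conjI)
qed

text \<open>
  The hypothesis \<open>adj\<close> says that the adjoint of the row operator maps \<open>u\<close> to \<open>g\<close>, and adjoints of
  contractions are contractions. In this form no adjoint operator has to be constructed.
\<close>

lemma row_adjoint_contractive:
  assumes b: "row_contractive m b" and u: "u \<in> H" and g: "\<And>l. l < m \<Longrightarrow> g l \<in> H"
    and adj: "\<And>l h. l < m \<Longrightarrow> h \<in> H \<Longrightarrow> ip h (g l) = ip (\<lambda>x. b l x * h x) u"
  shows "(\<Sum>l<m. (nrm (g l))\<^sup>2) \<le> (nrm u)\<^sup>2"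
proof -
  define S where "S = (\<Sum>l<m. (nrm (g l))\<^sup>2)"
  let ?G = "\<lambda>x. \<Sum>l<m. b l x * g l x"
  have bg: "(\<lambda>x. b l x * g l x) \<in> H" if "l < m" for l
    using that g row_contractiveD(1)[OF b] Mult_memD by auto
  have GH: "?G \<in> H" by (intro mem bg) auto
  have "S = Re (\<Sum>l<m. ip (g l) (g l))"
    unfolding S_def Re_sum by (intro sum.cong refl) (simp add: nrm_sq g)
  also have "(\<Sum>l<m. ip (g l) (g l)) = ip ?G u"
    by (subst ip_sum) (auto simp: bg u adj g)
  also have "Re (ip ?G u) \<le> nrm ?G * nrm u"
    by (rule order_trans[OF complex_Re_le_cmod cauchy_schwarz[OF GH u]])
  finally have S1: "S \<le> nrm ?G * nrm u" .
  have S2: "(nrm ?G)\<^sup>2 \<le> S" unfolding S_def by (rule row_contractiveD(2)[OF b g])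
  have S0: "S \<ge> 0" unfolding S_def by (intro sum_nonneg) simp
  have "S\<^sup>2 \<le> (nrm ?G * nrm u)\<^sup>2" using S0 S1 by (intro power_mono)
  also have "\<dots> \<le> S * (nrm u)\<^sup>2" unfolding power_mult_distrib using S2 by (intro mult_right_mono) auto
  finally have "S * S \<le> S * (nrm u)\<^sup>2" by (simp only: power2_eq_square)
  hence "S \<le> (nrm u)\<^sup>2" using S0 by (cases "S = 0") auto
  thus ?thesis by (simp only: S_def)
qed

end

section \<open>The reciprocal of a complete Pick kernel\<close>

context normalized_pick_space
begin

lemma kernel_base_left: "k x0 x = 1"
  using kernel_cnj[of x0 x] by (simp add: base)

lemma kernel_diag_real: "k x x = of_real ((nrm (\<lambda>s. k s x))\<^sup>2)"
  using ip_self[OF kernel_mem, of x] ip_kernel[OF kernel_mem, of x x] by simp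

text \<open>
  Adjoint contractivity for \<open>u = t k\<^sub>x + k\<^sub>y - k\<^sub>x\<^sub>0\<close>. The kernel at the base point is annihilated by the
  adjoint since the row vanishes there.
\<close>

lemma row_kernel_inequality:
  assumes b: "row_contractive m b" and b0: "\<And>l. l < m \<Longrightarrow> b l x0 = 0"
  shows "(\<Sum>l<m. (nrm (\<lambda>s. t * cnj (b l x) * k s x + cnj (b l y) * k s y))\<^sup>2)
    \<le> (nrm (\<lambda>s. t * k s x + (k s y - k s x0)))\<^sup>2"
proof (rule row_adjoint_contractive[OF b])
  show "ip h (\<lambda>s. t * cnj (b l x) * k s x + cnj (b l y) * k s y)
      = ip (\<lambda>s. b l s * h s) (\<lambda>s. t * k s x + (k s y - k s x0))" if "l < m" "h \<in> H" for l h
    using that Mult_memD[OF row_contractiveD(1)[OF b]] b0[of l]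
    by (simp add: ip_add_right ip_diff_right ip_scale_right mem ip_kernel mult.assoc)
qed (intro mem)+

lemma gram_diagonal:
  assumes "k x x * (1 - (\<Sum>l<m. b l x * cnj (b l x))) = 1"
  shows "(\<Sum>l<m. (cmod (b l x))\<^sup>2) = 1 - 1 / (nrm (\<lambda>s. k s x))\<^sup>2"
proof -
  let ?K = "(nrm (\<lambda>s. k s x))\<^sup>2"
  have K: "?K \<noteq> 0" using diag[of x] kernel_diag_real[of x] by auto
  have "(\<Sum>l<m. b l x * cnj (b l x)) = of_real (\<Sum>l<m. (cmod (b l x))\<^sup>2)"
    by (simp only: of_real_sum complex_norm_square)
  hence "of_real (?K * (1 - (\<Sum>l<m. (cmod (b l x))\<^sup>2))) = (1 :: complex)"
    using assms unfolding kernel_diag_real[of x] by (simp only: of_real_mult of_real_diff of_real_1)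
  hence "?K * (1 - (\<Sum>l<m. (cmod (b l x))\<^sup>2)) = 1" by (simp only: of_real_eq_1_iff)
  hence "1 - (\<Sum>l<m. (cmod (b l x))\<^sup>2) = 1 / ?K" using K by (simp add: eq_divide_eq mult.commute)
  thus ?thesis by simp
qed

text \<open>
  A contractive row that represents \<open>1 - 1 / k\<close> at \<open>(y, y)\<close> represents it at \<open>(y, x)\<close> for every further
  point \<open>x\<close>. Indeed the vector \<open>k\<^sub>y - k\<^sub>x\<^sub>0\<close> and its image under the adjoint have the same norm by
  the hypothesis, so equality holds in the contractivity estimate at \<open>t = 0\<close>, and the term that is linear
  in \<open>t\<close> must vanish.
\<close>

lemma gram_extension:
  assumes b: "row_contractive m b" and b0: "\<And>l. l < m \<Longrightarrow> b l x0 = 0"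
    and y: "k y y * (1 - (\<Sum>l<m. b l y * cnj (b l y))) = 1"
  shows "k y x * (1 - (\<Sum>l<m. b l y * cnj (b l x))) = 1"
proof -
  let ?K = "\<lambda>x. (nrm (\<lambda>s. k s x))\<^sup>2"
  define B where "B = ?K x - (\<Sum>l<m. (cmod (b l x))\<^sup>2 * ?K x)"
  define \<zeta> where "\<zeta> = k y x - 1 - (\<Sum>l<m. cnj (b l x) * b l y * k y x)"
  have gl: "(nrm (\<lambda>s. t * cnj (b l x) * k s x + cnj (b l y) * k s y))\<^sup>2
      = (cmod t)\<^sup>2 * ((cmod (b l x))\<^sup>2 * ?K x) + (cmod (b l y))\<^sup>2 * ?K y
        + 2 * Re (t * (cnj (b l x) * b l y * k y x))" for l t
  proof -
    have "ip (\<lambda>s. t * cnj (b l x) * k s x) (\<lambda>s. cnj (b l y) * k s y) = t * (cnj (b l x) * b l y * k y x)"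
      by (subst ip_scale) (simp_all add: mem ip_scale_right ip_kernel)
    moreover have "(nrm (\<lambda>s. t * cnj (b l x) * k s x))\<^sup>2 = (cmod t)\<^sup>2 * ((cmod (b l x))\<^sup>2 * ?K x)"
      unfolding nrm_scale[OF kernel_mem] by (simp add: norm_mult power_mult_distrib)
    moreover have "(nrm (\<lambda>s. cnj (b l y) * k s y))\<^sup>2 = (cmod (b l y))\<^sup>2 * ?K y"
      unfolding nrm_scale[OF kernel_mem] by (simp add: power_mult_distrib)
    ultimately show ?thesis by (subst nrm_add_sq) (simp_all only: mem)
  qed
  have ky: "(nrm (\<lambda>s. k s y - k s x0))\<^sup>2 = ?K y - 1"
  proof -
    have "(nrm (\<lambda>s. k s y - k s x0))\<^sup>2 = ?K y + ?K x0 - 2 * Re (ip (\<lambda>s. k s y) (\<lambda>s. k s x0))"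
      by (intro nrm_diff_sq mem)
    also have "ip (\<lambda>s. k s y) (\<lambda>s. k s x0) = 1" using ip_kernel[OF kernel_mem, of y x0] kernel_base_left by simp
    also have "?K x0 = 1" using kernel_diag_real[of x0] by (simp only: base) (metis of_real_eq_1_iff)
    finally show ?thesis by simp
  qed
  have u: "(nrm (\<lambda>s. t * k s x + (k s y - k s x0)))\<^sup>2
      = (cmod t)\<^sup>2 * ?K x + (?K y - 1) + 2 * Re (t * (k y x - 1))" for t
  proof -
    have "(nrm (\<lambda>s. t * k s x + (k s y - k s x0)))\<^sup>2
        = (nrm (\<lambda>s. t * k s x))\<^sup>2 + (nrm (\<lambda>s. k s y - k s x0))\<^sup>2
          + 2 * Re (ip (\<lambda>s. t * k s x) (\<lambda>s. k s y - k s x0))"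
      by (intro nrm_add_sq mem)
    also have "ip (\<lambda>s. t * k s x) (\<lambda>s. k s y - k s x0) = t * (k y x - k x0 x)"
      by (subst ip_scale) (simp_all only: mem ip_diff_right ip_kernel)
    also have "nrm (\<lambda>s. t * k s x) = cmod t * nrm (\<lambda>s. k s x)" by (intro nrm_scale mem)
    finally show ?thesis by (simp only: ky kernel_base_left power_mult_distrib)
  qed
  have sum_y: "(\<Sum>l<m. (cmod (b l y))\<^sup>2 * ?K y) = ?K y - 1"
  proof -
    have "?K y \<noteq> 0" using diag[of y] kernel_diag_real[of y] by auto
    thus ?thesis unfolding sum_distrib_right[symmetric] gram_diagonal[where b = b, OF y] by (simp add: left_diff_distrib)
  qed
  have "\<zeta> = 0"
  proof (rule nonneg_quadratic_imp_zero)
    fix t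
    have "(\<Sum>l<m. (cmod t)\<^sup>2 * ((cmod (b l x))\<^sup>2 * ?K x) + (cmod (b l y))\<^sup>2 * ?K y
        + 2 * Re (cnj t * (cnj (b l x) * b l y * k y x)))
      \<le> (cmod t)\<^sup>2 * ?K x + (?K y - 1) + 2 * Re (cnj t * (k y x - 1))"
      using row_kernel_inequality[OF b b0, of "cnj t" x y] unfolding gl u by simp
    also have "(\<Sum>l<m. (cmod t)\<^sup>2 * ((cmod (b l x))\<^sup>2 * ?K x) + (cmod (b l y))\<^sup>2 * ?K y
        + 2 * Re (cnj t * (cnj (b l x) * b l y * k y x)))
      = (cmod t)\<^sup>2 * (\<Sum>l<m. (cmod (b l x))\<^sup>2 * ?K x) + (?K y - 1)
        + 2 * Re (cnj t * (\<Sum>l<m. cnj (b l x) * b l y * k y x))"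
      by (simp only: sum.distrib sum_distrib_left[symmetric] sum_y Re_sum[symmetric])
    finally show "0 \<le> 2 * Re (cnj t * \<zeta>) + (cmod t)\<^sup>2 * B"
      by (simp only: \<zeta>_def B_def right_diff_distrib minus_complex.sel)
  qed
  hence \<zeta>: "(\<Sum>l<m. cnj (b l x) * b l y * k y x) = k y x - 1" by (simp add: \<zeta>_def)
  have "k y x * (1 - (\<Sum>l<m. b l y * cnj (b l x))) = k y x - (\<Sum>l<m. cnj (b l x) * b l y * k y x)"
    by (simp add: right_diff_distrib sum_distrib_left mult_ac)
  also have "\<dots> = 1" unfolding \<zeta> by simp
  finally show ?thesis .
qed

text \<open>
  The defect of the row at a new point is nonnegative, which leaves room for one more coordinate.
\<close>

lemma row_defect:
  assumes b: "row_contractive m b" and b0: "\<And>l. l < m \<Longrightarrow> b l x0 = 0"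
  shows "(\<Sum>l<m. (cmod (b l x))\<^sup>2) \<le> 1 - 1 / (nrm (\<lambda>s. k s x))\<^sup>2"
proof -
  let ?K = "(nrm (\<lambda>s. k s x))\<^sup>2"
  have K: "?K > 0" using diag[of x] kernel_diag_real[of x] by auto
  have 1: "(nrm (\<lambda>s. 0 * cnj (b l x0) * k s x0 + cnj (b l x) * k s x))\<^sup>2 = (cmod (b l x))\<^sup>2 * ?K" for l
    using nrm_scale[OF kernel_mem, of "cnj (b l x)" x] by (simp add: power_mult_distrib)
  have "(nrm (\<lambda>s. 0 * k s x0 + (k s x - k s x0)))\<^sup>2 = (nrm (\<lambda>s. k s x - k s x0))\<^sup>2" by simp
  also have "\<dots> = ?K + (nrm (\<lambda>s. k s x0))\<^sup>2 - 2 * Re (ip (\<lambda>s. k s x) (\<lambda>s. k s x0))"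
    by (intro nrm_diff_sq mem)
  also have "ip (\<lambda>s. k s x) (\<lambda>s. k s x0) = 1" using ip_kernel[OF kernel_mem, of x x0] kernel_base_left by simp
  also have "(nrm (\<lambda>s. k s x0))\<^sup>2 = 1"
    using kernel_diag_real[of x0] by (simp only: base) (metis of_real_eq_1_iff)
  finally have "(\<Sum>l<m. (cmod (b l x))\<^sup>2 * ?K) \<le> ?K - 1"
    using row_kernel_inequality[OF b b0, of 0 x0 x] unfolding 1 by simp
  hence "(\<Sum>l<m. (cmod (b l x))\<^sup>2) * ?K \<le> ?K - 1" by (simp only: sum_distrib_right)
  hence "(\<Sum>l<m. (cmod (b l x))\<^sup>2) \<le> (?K - 1) / ?K" using K by (simp only: pos_le_divide_eq)
  also have "\<dots> = 1 - 1 / ?K" using K by (simp add: diff_divide_distrib)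
  finally show ?thesis .
qed

text \<open>
  The theorem of McCullough and Quiggin that \<open>1 - 1 / k\<close> is positive semidefinite for a normalized complete
  Pick kernel, together with an extension of its Gram vectors to a contractive row of multipliers. Both
  come out of one induction. A row that works on a finite set extends by the Pick property to the whole domain. At the next point \<open>x\<close>
  its values already have the right inner products with the earlier ones, and one additional coordinate,
  supported at \<open>x\<close>, corrects the norm.
\<close>

theorem kernel_reciprocal_gram:
  assumes "finite E"
  shows "\<exists>m b. row_contractive m b \<and>
    (\<forall>x\<in>E. \<forall>y\<in>E. k x y * (1 - (\<Sum>l<m. b l x * cnj (b l y))) = 1)"
proof -
  have "\<exists>m b. row_contractive m b \<and>
    (\<forall>x\<in>insert x0 E. \<forall>y\<in>insert x0 E. k x y * (1 - (\<Sum>l<m. b l x * cnj (b l y))) = 1)"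
    using assms
  proof (induction E rule: finite_induct)
    case empty
    show ?case by (intro exI[of _ 0]) (auto simp: row_contractive_def base nrm_zero)
  next
    case (insert x E)
    show ?case
    proof (cases "x = x0")
      case True
      thus ?thesis using insert.IH by simp
    next
      case False
      let ?E = "insert x0 E"
      from insert.IH obtain m b where b: "row_contractive m b"
        and gram: "\<forall>x\<in>?E. \<forall>y\<in>?E. k x y * (1 - (\<Sum>l<m. b l x * cnj (b l y))) = 1"
        by (elim exE conjE)
      have sq: "(\<Sum>l<m. b l y * cnj (b l y)) = of_real (\<Sum>l<m. (cmod (b l y))\<^sup>2)" for y
        by (simp only: of_real_sum complex_norm_square)
      have "(\<Sum>l<m. b l x0 * cnj (b l x0)) = 0" using gram by (auto simp: base)
      hence "(\<Sum>l<m. (cmod (b l x0))\<^sup>2) = 0" unfolding sq by (simp only: of_real_eq_0_iff)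
      hence b0: "b l x0 = 0" if "l < m" for l using that by (subst (asm) sum_nonneg_eq_0_iff) auto
      define K where "K = (nrm (\<lambda>s. k s x))\<^sup>2"
      have K: "K > 0" using diag[of x] kernel_diag_real[of x] by (auto simp: K_def)
      define s where "s = 1 - 1 / K - (\<Sum>l<m. (cmod (b l x))\<^sup>2)"
      have s: "s \<ge> 0" using row_defect[OF b b0, of x] by (simp add: s_def K_def)
      \<comment> \<open>The coordinate of index \<open>m\<close> is supported at \<open>x\<close>, where it fills up the defect.\<close>
      define B where "B = (\<lambda>l y. if l < m then b l y else if y = x then of_real (sqrt s) else (0::complex))"
      have B_sum: "(\<Sum>l<Suc m. B l y * cnj (B l z)) = (\<Sum>l<m. b l y * cnj (b l z)) + B m y * cnj (B m z)" for y z
        by (simp add: B_def)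
      have xE: "x \<notin> ?E" using insert.hyps False by auto
      have Bm: "B m y = (if y = x then of_real (sqrt s) else 0)" for y by (simp add: B_def)
      have yx: "k y x * (1 - (\<Sum>l<Suc m. B l y * cnj (B l x))) = 1" if "y \<in> ?E" for y
      proof -
        have "y \<noteq> x" using that xE by auto
        moreover have "k y y * (1 - (\<Sum>l<m. b l y * cnj (b l y))) = 1" using gram that by blast
        ultimately show ?thesis using gram_extension[OF b b0, of y x] unfolding B_sum Bm by simp
      qed
      have xy: "k x y * (1 - (\<Sum>l<Suc m. B l x * cnj (B l y))) = 1" if "y \<in> ?E" for y
        using arg_cong[OF yx[OF that], of cnj] kernel_cnj[of y x]
        by (simp only: complex_cnj_mult complex_cnj_diff complex_cnj_one cnj_sum complex_cnj_cnj kernel_cnj[of x y, symmetric] mult.commute)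
      have xx: "k x x * (1 - (\<Sum>l<Suc m. B l x * cnj (B l x))) = 1"
      proof -
        have ss: "complex_of_real (sqrt s) * cnj (complex_of_real (sqrt s)) = of_real s"
          using s by (simp flip: of_real_mult)
        have "(\<Sum>l<Suc m. B l x * cnj (B l x)) = of_real (\<Sum>l<m. (cmod (b l x))\<^sup>2) + of_real s"
          unfolding B_sum Bm sq if_P[OF refl] ss ..
        also have "\<dots> = of_real (1 - 1 / K)" by (simp add: s_def)
        finally have "k x x * (1 - (\<Sum>l<Suc m. B l x * cnj (B l x))) = of_real (K * (1 - (1 - 1 / K)))"
          unfolding kernel_diag_real[of x] K_def[symmetric] by (simp only: of_real_mult of_real_diff of_real_1)
        thus ?thesis using K by simp
      qed
      have yy: "k y z * (1 - (\<Sum>l<Suc m. B l y * cnj (B l z))) = 1" if "y \<in> ?E" "z \<in> ?E" for y z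
      proof -
        have "y \<noteq> x" using that xE by auto
        moreover have "k y z * (1 - (\<Sum>l<m. b l y * cnj (b l z))) = 1" using gram that by blast
        ultimately show ?thesis unfolding B_sum Bm by simp
      qed
      let ?F = "insert x ?E"
      have gramB: "k y z * (1 - (\<Sum>l<Suc m. B l y * cnj (B l z))) = 1" if "y \<in> ?F" "z \<in> ?F" for y z
        using that xx xy yx yy by blast
      obtain b' where b': "row_contractive (Suc m) b'" "\<forall>l<Suc m. \<forall>x\<in>?F. b' l x = B l x"
        using pick_row_interpolation[of "Suc m" ?F B, OF _ _ gramB] insert.hyps(1) by auto
      have "\<forall>y\<in>?F. \<forall>z\<in>?F. k y z * (1 - (\<Sum>l<Suc m. b' l y * cnj (b' l z))) = 1"
      proof (intro ballI)
        fix y z assume yz: "y \<in> ?F" "z \<in> ?F"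
        have "(\<Sum>l<Suc m. b' l y * cnj (b' l z)) = (\<Sum>l<Suc m. B l y * cnj (B l z))"
          using b'(2) yz by (intro sum.cong) auto
        thus "k y z * (1 - (\<Sum>l<Suc m. b' l y * cnj (b' l z))) = 1" using gramB[OF yz] by (simp only:)
      qed
      hence "\<forall>y\<in>insert x0 (insert x E). \<forall>z\<in>insert x0 (insert x E).
          k y z * (1 - (\<Sum>l<Suc m. b' l y * cnj (b' l z))) = 1"
        by (simp only: insert_commute)
      with b'(1) show ?thesis by (intro exI conjI)
    qed
  qed
  thus ?thesis by blast
qed

lemma kernel_nonzero: "k x y \<noteq> 0"
  using kernel_reciprocal_gram[of "{x, y}"] by fastforce

text \<open>
  On a finite set, \<open>k x w\<close> equals \<open>1 / (1 - \<psi> x)\<close> where \<open>\<psi>\<close> is the contractive row paired with its value at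
  \<open>w\<close>. The multiplier norm of \<open>\<psi>\<close> is at most \<open>c = sqrt (1 - 1 / k w w) < 1\<close>, whatever the finite set is, so
  the Neumann series gives a bound that is uniform in the finite set.
\<close>

lemma kernel_in_Mult: "(\<lambda>x. k x w) \<in> Mult H"
proof -
  define K where "K = (nrm (\<lambda>s. k s w))\<^sup>2"
  have K: "K > 0" using diag[of w] kernel_diag_real[of w] by (auto simp: K_def)
  define c where "c = sqrt (1 - 1 / K)"
  have K1: "1 - 1 / K \<ge> 0"
  proof -
    obtain m and b :: "nat \<Rightarrow> 'x \<Rightarrow> complex" where "k w w * (1 - (\<Sum>l<m. b l w * cnj (b l w))) = 1"
      using kernel_reciprocal_gram[of "{w}"] by auto
    from gram_diagonal[where b = b, OF this, symmetric] show ?thesis by (simp add: K_def sum_nonneg)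
  qed
  have c: "0 \<le> c" "c < 1" using K K1 by (auto simp: c_def)
  have "(\<lambda>x. k x w * h x) \<in> H" if h: "h \<in> H" for h
  proof (rule membership_finite_agreement(1)[where C = "1 / (1 - c) * nrm h"])
    show "0 \<le> 1 / (1 - c) * nrm h" using c nrm_nonneg[OF h] by simp
    fix E :: "'x set" assume E: "finite E"
    obtain m b where b: "row_contractive m b"
      and g: "\<forall>x\<in>insert w E. \<forall>y\<in>insert w E. k x y * (1 - (\<Sum>l<m. b l x * cnj (b l y))) = 1"
      using kernel_reciprocal_gram[of "insert w E"] E by auto
    define \<psi> where "\<psi> = (\<lambda>x. \<Sum>l<m. b l x * cnj (b l w))"
    have \<psi>: "(\<lambda>x. \<psi> x * f x) \<in> H" "nrm (\<lambda>x. \<psi> x * f x) \<le> c * nrm f" if f: "f \<in> H" for f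
    proof -
      have eq: "(\<lambda>x. \<psi> x * f x) = (\<lambda>x. \<Sum>l<m. b l x * (cnj (b l w) * f x))"
        by (simp add: \<psi>_def sum_distrib_right mult.assoc)
      show "(\<lambda>x. \<psi> x * f x) \<in> H"
        unfolding eq by (intro sum_mem Mult_memD[OF row_contractiveD(1)[OF b]] mem f) auto
      have s: "(\<Sum>l<m. (cmod (b l w))\<^sup>2) = c\<^sup>2"
      proof -
        have "k w w * (1 - (\<Sum>l<m. b l w * cnj (b l w))) = 1" by (rule g[rule_format]) simp_all
        from gram_diagonal[where b = b, OF this] show ?thesis using K1 by (simp add: c_def K_def)
      qed
      have "(nrm (\<lambda>x. \<psi> x * f x))\<^sup>2 \<le> (\<Sum>l<m. (nrm (\<lambda>x. cnj (b l w) * f x))\<^sup>2)"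
        unfolding eq by (rule row_contractiveD(2)[OF b]) (intro mem f)
      also have "\<dots> = (\<Sum>l<m. (cmod (b l w))\<^sup>2) * (nrm f)\<^sup>2"
        by (simp add: nrm_scale[OF f] power_mult_distrib sum_distrib_right)
      also have "\<dots> = (c * nrm f)\<^sup>2" by (simp add: s power_mult_distrib)
      finally show "nrm (\<lambda>x. \<psi> x * f x) \<le> c * nrm f"
        by (rule power2_le_imp_le) (use c nrm_nonneg[OF f] in simp)
    qed
    have "mult_bounded \<psi> c" using \<psi> c by (auto simp: mult_bounded_def Mult_def)
    from neumann_inverse[OF this c(2) diag]
    have N: "mult_bounded (\<lambda>x. 1 / (1 - \<psi> x)) (1 / (1 - c))" .
    have "1 / (1 - \<psi> x) * h x = k x w * h x" if "x \<in> E" for x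
    proof -
      have "k x w * (1 - \<psi> x) = 1" unfolding \<psi>_def by (rule g[rule_format]) (simp_all add: that)
      moreover from this have "1 - \<psi> x \<noteq> 0" by force
      ultimately have "1 / (1 - \<psi> x) = k x w" by (simp add: divide_eq_eq)
      thus ?thesis by simp
    qed
    thus "\<exists>g\<in>H. nrm g \<le> 1 / (1 - c) * nrm h \<and> (\<forall>x\<in>E. g x = k x w * h x)"
      using mult_boundedD(3,4)[OF N h] by (intro bexI[of _ "\<lambda>x. 1 / (1 - \<psi> x) * h x"]) auto
  qed
  thus ?thesis by (simp add: Mult_def)
qed

end

section \<open>Functions in the space as quotients of multipliers\<close>

context normalized_pick_space
begin

lemma kernel_times_mem: "f \<in> H \<Longrightarrow> (\<lambda>x. k x w * f x) \<in> H"
  by (rule Mult_memD[OF kernel_in_Mult])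

text \<open>
  With an infinite row \<open>b\<close> such that \<open>1 - 1 / k z w = \<Sum> b z * cnj (b w)\<close>, the function on the left
  would be the image under the row operator of the tuple with entries \<open>\<Sum> d w * cnj (b w) * k\<^sub>w * f\<close>,
  and the right-hand side would be the squared norm of that tuple. With the finite rows at hand both
  statements hold on every finite set, which suffices.
\<close>

lemma kernel_minus_one_bound:
  assumes f: "f \<in> H" and E: "finite E"
  shows "(nrm (\<lambda>x. \<Sum>w\<in>E. d w * (k x w * f x - f x)))\<^sup>2
    \<le> Re (\<Sum>z\<in>E. \<Sum>w\<in>E. d w * cnj (d z) * ((1 - 1 / k z w) * ip (\<lambda>x. k x w * f x) (\<lambda>x. k x z * f x)))"
    (is "(nrm ?h)\<^sup>2 \<le> Re ?Q")
proof -
  have ex: "\<exists>g\<in>H. (nrm g)\<^sup>2 \<le> Re ?Q \<and> (\<forall>x\<in>E'. g x = ?h x)" if E': "finite E'" for E'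
  proof -
    obtain m b where b: "row_contractive m b"
      and g: "\<forall>x\<in>E \<union> E'. \<forall>y\<in>E \<union> E'. k x y * (1 - (\<Sum>l<m. b l x * cnj (b l y))) = 1"
      using kernel_reciprocal_gram[of "E \<union> E'"] E E' by auto
    have rec: "(\<Sum>l<m. b l x * cnj (b l y)) = 1 - 1 / k x y" if "x \<in> E \<union> E'" "y \<in> E \<union> E'" for x y
    proof -
      have "k x y * (1 - (\<Sum>l<m. b l x * cnj (b l y))) = 1" using g that by blast
      hence "1 - (\<Sum>l<m. b l x * cnj (b l y)) = 1 / k x y" using kernel_nonzero[of x y]
        by (simp add: eq_divide_eq mult.commute)
      thus ?thesis by (simp add: algebra_simps)
    qed
    define g where "g = (\<lambda>l x. \<Sum>w\<in>E. (d w * cnj (b l w)) * (k x w * f x))"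
    have gH: "g l \<in> H" for l unfolding g_def by (intro mem kernel_times_mem f)
    let ?G = "\<lambda>x. \<Sum>l<m. b l x * g l x"
    have "?G \<in> H" by (intro sum_mem Mult_memD[OF row_contractiveD(1)[OF b]] gH) auto
    moreover have "(nrm ?G)\<^sup>2 \<le> Re ?Q"
    proof -
      have "(nrm ?G)\<^sup>2 \<le> (\<Sum>l<m. (nrm (g l))\<^sup>2)" by (rule row_contractiveD(2)[OF b gH])
      also have "\<dots> = Re (\<Sum>l<m. ip (g l) (g l))" by (simp add: nrm_sq gH)
      also have "(\<Sum>l<m. ip (g l) (g l)) = (\<Sum>l<m. \<Sum>z\<in>E. \<Sum>w\<in>E. d w * cnj (d z) *
          ((b l z * cnj (b l w)) * ip (\<lambda>x. k x w * f x) (\<lambda>x. k x z * f x)))"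
        unfolding g_def ip_linear_combinations[where g = "\<lambda>w x. k x w * f x", OF kernel_times_mem[OF f]] by (intro sum.cong refl) simp
      also have "\<dots> = (\<Sum>z\<in>E. \<Sum>w\<in>E. d w * cnj (d z) *
          ((\<Sum>l<m. b l z * cnj (b l w)) * ip (\<lambda>x. k x w * f x) (\<lambda>x. k x z * f x)))"
        unfolding sum_distrib_left sum_distrib_right
        by (subst sum.swap[of _ E "{..<m}"], subst sum.swap[of _ E "{..<m}"]) (rule refl)
      also have "\<dots> = ?Q" by (intro sum.cong refl) (simp add: rec)
      finally show ?thesis .
    qed
    moreover have "?G x = ?h x" if x: "x \<in> E'" for x
    proof -
      have "?G x = (\<Sum>w\<in>E. d w * (\<Sum>l<m. b l x * cnj (b l w)) * (k x w * f x))"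
        unfolding g_def sum_distrib_left sum_distrib_right
        by (subst sum.swap) (intro sum.cong refl, simp)
      also have "\<dots> = ?h x"
        by (intro sum.cong refl) (use x kernel_nonzero in \<open>simp add: rec algebra_simps\<close>)
      finally show ?thesis .
    qed
    ultimately show ?thesis by (intro bexI[of _ ?G]) blast+
  qed
  have Q: "Re ?Q \<ge> 0"
  proof -
    obtain g where "(nrm g)\<^sup>2 \<le> Re ?Q" using ex[OF finite.emptyI] by blast
    thus ?thesis using zero_le_power2[of "nrm g"] by linarith
  qed
  have "nrm ?h \<le> sqrt (Re ?Q)"
  proof (rule membership_finite_agreement(2))
    show "0 \<le> sqrt (Re ?Q)" using Q by simp
    fix E' :: "'x set" assume "finite E'"
    from ex[OF this] obtain g where g: "g \<in> H" "(nrm g)\<^sup>2 \<le> Re ?Q" "\<forall>x\<in>E'. g x = ?h x" by blast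
    have "nrm g \<le> sqrt (Re ?Q)" using g(2) by (rule real_le_rsqrt)
    thus "\<exists>g\<in>H. nrm g \<le> sqrt (Re ?Q) \<and> (\<forall>w\<in>E'. g w = ?h w)" using g by (intro bexI[of _ g]) auto
  qed
  moreover have "?h \<in> H" by (intro mem kernel_times_mem f)
  ultimately have "(nrm ?h)\<^sup>2 \<le> (sqrt (Re ?Q))\<^sup>2" using nrm_nonneg by (intro power_mono) auto
  thus ?thesis using Q by simp
qed

text \<open>
  The value \<open>\<langle>f, k\<^sub>z f\<rangle>\<close>; up to an affine change of variable this is the Sarason function of \<open>f\<close>. In
  the Hardy space of the disc its real part is one half of the Poisson integral of \<open>|f|\<^sup>2\<close> plus a constant.
\<close>

definition sarason :: "('x \<Rightarrow> complex) \<Rightarrow> 'x \<Rightarrow> complex" where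
  "sarason f z = ip f (\<lambda>x. k x z * f x)"

text \<open>
  Formally this says \<open>\<parallel>f u\<parallel>\<^sup>2 + \<parallel>f\<parallel>\<^sup>2 \<parallel>u\<parallel>\<^sup>2 \<le> 2 Re \<langle>V u, u\<rangle>\<close> for the Sarason function \<open>V\<close> and kernel combinations \<open>u\<close>;
  the sum on the right gives a meaning to \<open>\<langle>V u, u\<rangle>\<close> when \<open>V u\<close> is not in the space. The preceding bound
  states that the kernel \<open>M\<close> is positive semidefinite; multiplied by \<open>k\<close> it becomes
  \<open>k z w * (V z + cnj (V w) - \<parallel>f\<parallel>\<^sup>2) - \<langle>k\<^sub>w f, k\<^sub>z f\<rangle>\<close>, and the Schur product theorem applies.
\<close>

lemma sarason_inequality:
  assumes f: "f \<in> H" and E: "finite E"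
  shows "(nrm (\<lambda>x. f x * kernel_comb E c x))\<^sup>2 + (nrm f)\<^sup>2 * (nrm (kernel_comb E c))\<^sup>2
    \<le> 2 * Re (\<Sum>z\<in>E. cnj (c z) * (sarason f z * kernel_comb E c z))"
proof -
  let ?h = "\<lambda>w x. k x w * f x" and ?v = "sarason f"
  have hH: "?h w \<in> H" for w by (rule kernel_times_mem[OF f])
  let ?P = "\<lambda>z w. ip (?h w) (?h z)"
  let ?D = "\<lambda>z w. ip (\<lambda>x. ?h w x - f x) (\<lambda>x. ?h z x - f x)"
  have D: "?D z w = ?P z w - cnj (?v w) - ?v z + of_real ((nrm f)\<^sup>2)" for z w
  proof -
    have "ip (?h w) f = cnj (?v w)" unfolding sarason_def by (rule ip_cnj[OF f hH])
    thus ?thesis using ip_self[OF f] by (simp add: ip_diff ip_diff_right mem hH f sarason_def)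
  qed
  define M where "M = (\<lambda>z w. (1 - 1 / k z w) * ?P z w - ?D z w)"
  have M: "0 \<le> Re (\<Sum>z\<in>E. \<Sum>w\<in>E. d w * cnj (d z) * M z w)" for d
  proof -
    let ?g = "\<lambda>x. \<Sum>w\<in>E. d w * (k x w * f x - f x)"
    have gH: "?g \<in> H" by (intro mem hH f)
    have "ip ?g ?g = (\<Sum>z\<in>E. \<Sum>w\<in>E. d w * cnj (d z) * ?D z w)"
      by (rule ip_linear_combinations) (intro mem hH f)
    hence "(nrm ?g)\<^sup>2 = Re (\<Sum>z\<in>E. \<Sum>w\<in>E. d w * cnj (d z) * ?D z w)"
      by (simp only: nrm_sq[OF gH])
    with kernel_minus_one_bound[OF f E, of d] show ?thesis
      by (simp only: M_def right_diff_distrib sum_subtractf minus_complex.sel)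
  qed
  let ?u = "kernel_comb E c"
  have fu: "(\<lambda>x. f x * ?u x) = (\<lambda>x. \<Sum>w\<in>E. c w * ?h w x)"
    by (simp add: kernel_comb_def sum_distrib_left mult_ac)
  have fuH: "(\<lambda>x. f x * ?u x) \<in> H" unfolding fu by (intro mem hH)
  define T where "T = (\<Sum>z\<in>E. cnj (c z) * (?v z * ?u z))"
  have kM: "k z w * M z w = k z w * ?v z + k z w * cnj (?v w) - k z w * of_real ((nrm f)\<^sup>2) - ?P z w" for z w
  proof -
    have "k z w * ((1 - 1 / k z w) * p) = k z w * p - p" for p
      using kernel_nonzero[of z w] by (simp add: field_simps)
    thus ?thesis unfolding M_def D right_diff_distrib[of "k z w"] by (simp only: ring_distribs) simp
  qed
  have s1: "(\<Sum>z\<in>E. \<Sum>w\<in>E. c w * cnj (c z) * (k z w * ?v z)) = T"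
    by (simp add: T_def kernel_comb_def sum_distrib_left mult_ac)
  have s2: "(\<Sum>z\<in>E. \<Sum>w\<in>E. c w * cnj (c z) * (k z w * cnj (?v w))) = cnj T"
  proof -
    have "cnj T = (\<Sum>z\<in>E. \<Sum>w\<in>E. cnj (c w) * c z * (cnj (k z w) * cnj (?v z)))"
      by (simp add: s1[symmetric] cnj_sum)
    also have "\<dots> = (\<Sum>w\<in>E. \<Sum>z\<in>E. cnj (c w) * c z * (cnj (k z w) * cnj (?v z)))"
      by (rule sum.swap)
    also have "\<dots> = (\<Sum>z\<in>E. \<Sum>w\<in>E. c w * cnj (c z) * (k z w * cnj (?v w)))"
      by (intro sum.cong refl) (simp add: kernel_cnj[symmetric] mult_ac)
    finally show ?thesis ..
  qed
  have s3: "(\<Sum>z\<in>E. \<Sum>w\<in>E. c w * cnj (c z) * (k z w * of_real ((nrm f)\<^sup>2)))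
      = of_real ((nrm f)\<^sup>2 * (nrm ?u)\<^sup>2)"
  proof -
    have "of_real ((nrm ?u)\<^sup>2) = (\<Sum>z\<in>E. cnj (c z) * ?u z)"
      by (simp only: ip_self[OF kernel_comb_mem, symmetric] ip_kernel_comb[OF kernel_comb_mem])
    also have "\<dots> = (\<Sum>z\<in>E. \<Sum>w\<in>E. c w * cnj (c z) * k z w)"
      by (simp add: kernel_comb_def sum_distrib_left mult_ac)
    finally show ?thesis by (simp only: of_real_mult) (simp add: sum_distrib_left mult_ac)
  qed
  have s4: "(\<Sum>z\<in>E. \<Sum>w\<in>E. c w * cnj (c z) * ?P z w) = of_real ((nrm (\<lambda>x. f x * ?u x))\<^sup>2)"
    unfolding ip_self[OF fuH, symmetric] unfolding fu ip_linear_combinations[of ?h, OF hH] ..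
  have "0 \<le> Re (\<Sum>z\<in>E. \<Sum>w\<in>E. c w * cnj (c z) * (k z w * M z w))"
    by (rule schur_product_kernel[OF E M])
  also have "(\<Sum>z\<in>E. \<Sum>w\<in>E. c w * cnj (c z) * (k z w * M z w))
     = T + cnj T - of_real ((nrm f)\<^sup>2 * (nrm ?u)\<^sup>2) - of_real ((nrm (\<lambda>x. f x * ?u x))\<^sup>2)"
    unfolding kM right_diff_distrib distrib_left sum_subtractf sum.distrib s1 s2 s3 s4 ..
  finally show ?thesis unfolding T_def[symmetric] by simp
qed

lemma sarason_positive:
  assumes E: "finite E" and f: "f \<in> H"
  shows "0 \<le> Re (\<Sum>z\<in>E. cnj (c z) * (sarason f z * kernel_comb E c z))"
proof -
  have "0 \<le> (nrm (\<lambda>x. f x * kernel_comb E c x))\<^sup>2 + (nrm f)\<^sup>2 * (nrm (kernel_comb E c))\<^sup>2" by simp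
  also note sarason_inequality[OF f E, of c]
  finally show ?thesis by simp
qed

lemma sarason_Re_nonneg: "f \<in> H \<Longrightarrow> 0 \<le> Re (sarason f z)"
proof -
  assume f: "f \<in> H"
  have K: "(nrm (\<lambda>s. k s z))\<^sup>2 > 0" using diag[of z] kernel_diag_real[of z] by auto
  have "0 \<le> Re (sarason f z * k z z)"
    using sarason_positive[OF _ f, of "{z}" "\<lambda>_. 1"] by (simp add: kernel_comb_def)
  also have "\<dots> = Re (sarason f z) * (nrm (\<lambda>s. k s z))\<^sup>2"
    unfolding kernel_diag_real[of z] by (simp del: of_real_power)
  finally show ?thesis using K by (simp add: zero_le_mult_iff)
qed

lemma sarason_plus_one_nonzero: "f \<in> H \<Longrightarrow> sarason f z + 1 \<noteq> 0"
proof
  assume f: "f \<in> H" and "sarason f z + 1 = 0"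
  hence "Re (sarason f z + 1) = 0" by (simp only: zero_complex.sel)
  thus False using sarason_Re_nonneg[OF f, of z] by simp
qed

text \<open>
  Since multiplication by \<open>V\<close> has nonnegative real part, \<open>1 / (V + 1)\<close> is a contractive multiplier. The
  estimate is made for the adjoint, which acts diagonally on kernels.
\<close>

lemma sarason_denominator_bounded:
  assumes f: "f \<in> H"
  shows "mult_bounded (\<lambda>x. 1 / (sarason f x + 1)) 1"
proof -
  let ?W = "\<lambda>x. sarason f x + 1"
  have "(\<lambda>x. 1 / ?W x * h x) \<in> H \<and> nrm (\<lambda>x. 1 / ?W x * h x) \<le> nrm h" if h: "h \<in> H" for h
  proof -
    have *: "cmod (\<Sum>w\<in>E. cnj (d w) * (1 / ?W w * h w)) \<le> nrm h * nrm (kernel_comb E d)"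
      if E: "finite E" for E d
    proof -
      define c where "c = (\<lambda>w. d w * cnj (1 / ?W w))"
      let ?u = "kernel_comb E c" and ?r = "kernel_comb E (\<lambda>w. c w * cnj (sarason f w))"
      have "d = (\<lambda>w. c w + c w * cnj (sarason f w))"
      proof
        fix w
        have "c w + c w * cnj (sarason f w) = d w * cnj (1 / ?W w * ?W w)"
          unfolding c_def complex_cnj_mult[of "1 / ?W w"] complex_cnj_add complex_cnj_one
          by (simp only: distrib_left mult_1_right mult.assoc add.commute)
        also have "1 / ?W w * ?W w = 1" using sarason_plus_one_nonzero[OF f, of w] by simp
        finally show "d w = c w + c w * cnj (sarason f w)" by simp
      qed
      hence d: "kernel_comb E d = (\<lambda>x. ?u x + ?r x)" by (simp add: kernel_comb_add)
      have "ip ?u ?r = (\<Sum>z\<in>E. cnj (c z) * (sarason f z * ?u z))"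
        by (simp add: ip_kernel_comb kernel_comb_mem mult.assoc)
      hence "Re (ip ?u ?r) \<ge> 0" using sarason_positive[OF E f, of c] by simp
      hence "(nrm ?u)\<^sup>2 \<le> (nrm (kernel_comb E d))\<^sup>2"
        unfolding d by (simp add: nrm_add_sq kernel_comb_mem)
      hence le: "nrm ?u \<le> nrm (kernel_comb E d)"
        by (rule power2_le_imp_le) (rule nrm_nonneg[OF kernel_comb_mem])
      have "(\<Sum>w\<in>E. cnj (d w) * (1 / ?W w * h w)) = ip h ?u"
        by (simp add: ip_kernel_comb[OF h] c_def mult.assoc)
      also have "cmod \<dots> \<le> nrm h * nrm ?u" by (rule cauchy_schwarz[OF h kernel_comb_mem])
      also have "\<dots> \<le> nrm h * nrm (kernel_comb E d)" by (intro mult_left_mono le nrm_nonneg h)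
      finally show ?thesis .
    qed
    show ?thesis using membership_criterion[OF nrm_nonneg[OF h] *] by simp
  qed
  thus ?thesis by (auto simp: mult_bounded_def Mult_def)
qed

text \<open>
  For \<open>u = h / (V + 1)\<close> both \<open>u\<close> and \<open>V u = h - u\<close> are in the space, so the formal inequality
  \<open>\<parallel>f u\<parallel>\<^sup>2 \<le> 2 Re \<langle>V u, u\<rangle> \<le> 2 \<parallel>V u\<parallel> \<parallel>u\<parallel>\<close> bounds \<open>f u\<close>. It is applied to the interpolants of \<open>u\<close> from
  kernel spans, for which it has been proved.
\<close>

lemma sarason_numerator_Mult:
  assumes f: "f \<in> H"
  shows "(\<lambda>x. f x / (sarason f x + 1)) \<in> Mult H"
proof -
  let ?W = "\<lambda>x. sarason f x + 1"
  have "(\<lambda>x. f x / ?W x * h x) \<in> H" if h: "h \<in> H" for h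
  proof -
    define u where "u = (\<lambda>x. 1 / ?W x * h x)"
    have uH: "u \<in> H" unfolding u_def by (rule mult_boundedD(3)[OF sarason_denominator_bounded[OF f] h])
    define g where "g = (\<lambda>x. h x - u x)"
    have gH: "g \<in> H" unfolding g_def by (intro mem h uH)
    have vu: "sarason f x * u x = g x" for x
      using sarason_plus_one_nonzero[OF f, of x] by (simp add: g_def u_def field_simps)
    define C where "C = sqrt (2 * (nrm g * nrm u))"
    have C0: "0 \<le> 2 * (nrm g * nrm u)" by (intro mult_nonneg_nonneg nrm_nonneg gH uH) simp
    have "(\<lambda>x. f x * u x) \<in> H"
    proof (rule membership_finite_agreement(1)[of C])
      show "0 \<le> C" using C0 by (simp add: C_def)
      fix E :: "'x set" assume E: "finite E"
      obtain c where c: "\<forall>w\<in>E. kernel_comb E c w = u w" "nrm (kernel_comb E c) \<le> nrm u"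
        using kernel_interpolation[OF E uH] by (elim exE conjE)
      let ?s = "kernel_comb E c"
      have fs: "(\<lambda>x. f x * ?s x) \<in> H"
      proof -
        have "(\<lambda>x. f x * ?s x) = (\<lambda>x. \<Sum>w\<in>E. c w * (k x w * f x))"
          by (simp add: kernel_comb_def sum_distrib_left mult_ac)
        thus ?thesis by (simp add: mem kernel_times_mem f)
      qed
      have "(nrm (\<lambda>x. f x * ?s x))\<^sup>2 \<le> (nrm (\<lambda>x. f x * ?s x))\<^sup>2 + (nrm f)\<^sup>2 * (nrm ?s)\<^sup>2" by simp
      also note sarason_inequality[OF f E, of c]
      also have "(\<Sum>z\<in>E. cnj (c z) * (sarason f z * ?s z)) = ip g ?s"
        unfolding ip_kernel_comb[OF gH] by (intro sum.cong refl) (simp add: c(1) vu)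
      also have "Re (ip g ?s) \<le> nrm g * nrm ?s"
        by (rule order_trans[OF complex_Re_le_cmod cauchy_schwarz[OF gH kernel_comb_mem]])
      also have "nrm g * nrm ?s \<le> nrm g * nrm u" by (intro mult_left_mono c nrm_nonneg gH)
      finally have "nrm (\<lambda>x. f x * ?s x) \<le> C" unfolding C_def by (simp add: real_le_rsqrt)
      thus "\<exists>g\<in>H. nrm g \<le> C \<and> (\<forall>x\<in>E. g x = f x * u x)"
        using fs c(1) by (intro bexI[of _ "\<lambda>x. f x * ?s x"]) auto
    qed
    thus ?thesis by (simp add: u_def)
  qed
  thus ?thesis by (simp add: Mult_def)
qed

lemma Mult_subset: "Mult H \<subseteq> H"
  using Mult_memD[OF _ one_mem] by auto

text \<open>
  Every \<open>f\<close> in the space is the quotient of the multipliers \<open>f / (V + 1)\<close> and \<open>1 / (V + 1)\<close>, and the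
  denominator does not vanish on the domain.
\<close>

theorem one_function_corona_imp_Mult_eq:
  assumes oc: "one_function_corona_theorem (Mult H)"
  shows "Mult H = H"
proof
  show "H \<subseteq> Mult H"
  proof
    fix f assume f: "f \<in> H"
    let ?W = "\<lambda>x. sarason f x + 1"
    have inv: "(\<lambda>x. 1 / ?W x) \<in> Mult H" by (rule mult_boundedD(1)[OF sarason_denominator_bounded[OF f]])
    have "1 / ?W x \<noteq> 0" for x using sarason_plus_one_nonzero[OF f] by simp
    hence "(\<lambda>x. 1 / (1 / ?W x)) \<in> Mult H"
      by (intro oc[unfolded one_function_corona_theorem_def, rule_format, OF inv])
    hence "(\<lambda>x. 1 / (1 / ?W x) * (f x / ?W x)) \<in> Mult H"
      by (rule Mult_mult[OF _ sarason_numerator_Mult[OF f]])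
    moreover have "(\<lambda>x. 1 / (1 / ?W x) * (f x / ?W x)) = f"
      using sarason_plus_one_nonzero[OF f] by simp
    ultimately show "f \<in> Mult H" by simp
  qed
qed (rule Mult_subset)

end

section \<open>Maximal ideals and characters of the multiplier algebra\<close>

text \<open>
  Zorn's lemma for ideals inside a subring \<open>A\<close> of the ambient ring; maximality is recorded as
  invertibility of the remaining elements modulo \<open>J\<close>.
\<close>

lemma exists_maximal_ideal_containing:
  fixes A :: "'a::comm_ring_1 set"
  assumes add: "\<And>a b. a \<in> A \<Longrightarrow> b \<in> A \<Longrightarrow> a + b \<in> A"
    and mult: "\<And>a b. a \<in> A \<Longrightarrow> b \<in> A \<Longrightarrow> a * b \<in> A"
    and one: "1 \<in> A" and minus_one: "- 1 \<in> A"
    and x: "x \<in> A" and not_inv: "\<And>a. a \<in> A \<Longrightarrow> a * x \<noteq> 1"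
  shows "\<exists>J. J \<subseteq> A \<and> x \<in> J \<and> 1 \<notin> J \<and> (\<forall>a\<in>J. \<forall>b\<in>J. a + b \<in> J) \<and> (\<forall>a\<in>A. \<forall>b\<in>J. a * b \<in> J) \<and>
    (\<forall>y\<in>A. y \<notin> J \<longrightarrow> (\<exists>a\<in>A. a * y - 1 \<in> J))"
proof -
  define ideal where "ideal = (\<lambda>J. J \<subseteq> A \<and> (\<forall>a\<in>J. \<forall>b\<in>J. a + b \<in> J) \<and> (\<forall>a\<in>A. \<forall>b\<in>J. a * b \<in> J))"
  define \<J> where "\<J> = {J. ideal J \<and> x \<in> J \<and> 1 \<notin> J}"
  have "\<exists>M\<in>\<J>. \<forall>X\<in>\<J>. M \<subseteq> X \<longrightarrow> X = M"
  proof (rule subset_Zorn_nonempty)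
    have "ideal ((\<lambda>a. a * x) ` A)"
      unfolding ideal_def
    proof (intro conjI ballI)
      show "(\<lambda>a. a * x) ` A \<subseteq> A" using mult x by auto
      show "a + b \<in> (\<lambda>a. a * x) ` A" if "a \<in> (\<lambda>a. a * x) ` A" "b \<in> (\<lambda>a. a * x) ` A" for a b
        using that add by (auto simp flip: distrib_right)
      show "a * b \<in> (\<lambda>a. a * x) ` A" if "a \<in> A" "b \<in> (\<lambda>a. a * x) ` A" for a b
        using that mult by (auto simp flip: mult.assoc)
    qed
    moreover have "x \<in> (\<lambda>a. a * x) ` A" using one by (intro image_eqI[of _ _ 1]) auto
    moreover have "1 \<notin> (\<lambda>a. a * x) ` A"
    proof
      assume "1 \<in> (\<lambda>a. a * x) ` A"
      then obtain a where "a \<in> A" "1 = a * x" by (rule imageE)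
      thus False using not_inv[of a] by simp
    qed
    ultimately show "\<J> \<noteq> {}" by (auto simp: \<J>_def)
    fix \<C> assume ne: "\<C> \<noteq> {}" and chain: "subset.chain \<J> \<C>"
    have C: "ideal J" "x \<in> J" "1 \<notin> J" if "J \<in> \<C>" for J
      using that chain by (auto simp: subset.chain_def \<J>_def)
    have lin: "J \<subseteq> K \<or> K \<subseteq> J" if "J \<in> \<C>" "K \<in> \<C>" for J K
      using that chain by (auto simp: subset_chain_def)
    have "ideal (\<Union>\<C>)"
      unfolding ideal_def
    proof (intro conjI ballI)
      have CA: "\<forall>J\<in>\<C>. J \<subseteq> A" and Cm: "\<forall>J\<in>\<C>. \<forall>a\<in>A. \<forall>b\<in>J. a * b \<in> J"
        using C(1) by (simp_all add: ideal_def)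
      show "\<Union>\<C> \<subseteq> A" using CA by blast
      show "a * b \<in> \<Union>\<C>" if "a \<in> A" "b \<in> \<Union>\<C>" for a b using that Cm by blast
      show "a + b \<in> \<Union>\<C>" if ab: "a \<in> \<Union>\<C>" "b \<in> \<Union>\<C>" for a b
      proof -
        obtain J K where JK: "J \<in> \<C>" "a \<in> J" "K \<in> \<C>" "b \<in> K" using ab by auto
        have sum: "a + b \<in> L" if "L \<in> \<C>" "a \<in> L" "b \<in> L" for L
          using C(1)[OF that(1)] that(2,3) by (simp add: ideal_def)
        from lin[OF JK(1,3)] show ?thesis
        proof
          assume "J \<subseteq> K"
          thus ?thesis using sum[OF JK(3) _ JK(4)] JK(2,3) by blast
        next
          assume "K \<subseteq> J"
          thus ?thesis using sum[OF JK(1) JK(2)] JK(1,4) by blast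
        qed
      qed
    qed
    moreover have "x \<in> \<Union>\<C>" using ne C(2) by auto
    moreover have "1 \<notin> \<Union>\<C>" using C(3) by auto
    ultimately show "\<Union>\<C> \<in> \<J>" by (simp add: \<J>_def)
  qed
  then obtain M where M: "M \<in> \<J>" and max: "\<forall>X\<in>\<J>. M \<subseteq> X \<longrightarrow> X = M" by (elim bexE)
  have M_ideal: "M \<subseteq> A" "\<forall>a\<in>M. \<forall>b\<in>M. a + b \<in> M" "\<forall>a\<in>A. \<forall>b\<in>M. a * b \<in> M" "x \<in> M" "1 \<notin> M"
    using M by (auto simp: \<J>_def ideal_def)
  have zM: "0 \<in> M" and zA: "0 \<in> A"
  proof -
    have "- 1 * x \<in> M" by (rule M_ideal(3)[rule_format, OF minus_one M_ideal(4)])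
    from M_ideal(2)[rule_format, OF M_ideal(4) this] show "0 \<in> M" by simp
    thus "0 \<in> A" using M_ideal(1) by (rule subsetD[rotated])
  qed
  have "\<exists>a\<in>A. a * y - 1 \<in> M" if y: "y \<in> A" "y \<notin> M" for y
  proof -
    define N where "N = {m + a * y |m a. m \<in> M \<and> a \<in> A}"
    have NI: "m + a * y \<in> N" if "m \<in> M" "a \<in> A" for m a using that unfolding N_def by blast
    have "ideal N"
      unfolding ideal_def
    proof (intro conjI ballI)
      show "N \<subseteq> A" using M_ideal(1) y(1) by (auto simp: N_def intro!: add mult)
      show "b + c \<in> N" if bc: "b \<in> N" "c \<in> N" for b c
      proof -
        obtain m a m' a' where "b = m + a * y" "c = m' + a' * y" "m \<in> M" "m' \<in> M" "a \<in> A" "a' \<in> A"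
          using bc by (auto simp: N_def)
        thus ?thesis using NI[of "m + m'" "a + a'"] M_ideal(2) add by (simp add: algebra_simps)
      qed
      show "c * b \<in> N" if cb: "c \<in> A" "b \<in> N" for c b
      proof -
        obtain m a where "b = m + a * y" "m \<in> M" "a \<in> A" using cb by (auto simp: N_def)
        thus ?thesis using NI[of "c * m" "c * a"] M_ideal(3) cb(1) mult by (simp add: algebra_simps)
      qed
    qed
    moreover have MN: "M \<subseteq> N" using NI[OF _ zA] by auto
    moreover have "y \<in> N" using NI[OF zM one] by simp
    hence "N \<noteq> M" using y(2) by auto
    ultimately have "N \<notin> \<J>" using max by auto
    hence "1 \<in> N" using \<open>ideal N\<close> MN M_ideal(4) by (auto simp: \<J>_def)
    then obtain m a where ma: "1 = m + a * y" "m \<in> M" "a \<in> A" by (auto simp: N_def)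
    have "a * y - 1 = - 1 * m" using ma(1) by (simp add: algebra_simps)
    moreover have "- 1 * m \<in> M" by (rule M_ideal(3)[rule_format, OF minus_one ma(2)])
    ultimately show ?thesis using ma(3) by (intro bexI[of _ a]) simp_all
  qed
  with M_ideal show ?thesis by (intro exI[of _ M]) simp
qed

lemma le_mult_Inf:
  fixes X :: "real set"
  assumes ne: "X \<noteq> {}" and c: "c \<ge> 0" and le: "\<And>D. D \<in> X \<Longrightarrow> y \<le> c * D"
  shows "y \<le> c * Inf X"
proof (cases "c = 0")
  case True
  thus ?thesis using ne le by auto
next
  case False
  hence "y / c \<le> Inf X" using c le ne
    by (intro cInf_greatest) (auto simp: divide_le_eq mult.commute)
  thus ?thesis using c False by (simp add: divide_le_eq mult.commute)
qed

context normalized_pick_space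
begin

lemma corona_if_characters_are_evaluations:
  assumes "\<And>\<rho>. \<rho> \<in> maximal_ideal_space (Mult H) \<Longrightarrow> \<exists>y. \<forall>\<phi>\<in>Mult H. \<rho> \<phi> = \<phi> y"
  shows "corona_theorem (Mult H)"
proof -
  have "point_evaluation (Mult H) y \<in> maximal_ideal_space (Mult H)" for y
    using Mult_const[of 1]
    by (auto simp: maximal_ideal_space_def point_evaluation_def linear_functional_on_def
        Mult_add Mult_mult Mult_mult[OF Mult_const] intro!: bexI[of _ "\<lambda>x. 1"])
  moreover have "\<rho> \<in> range (point_evaluation (Mult H))" if \<rho>: "\<rho> \<in> maximal_ideal_space (Mult H)" for \<rho>
  proof -
    obtain y where y: "\<forall>\<phi>\<in>Mult H. \<rho> \<phi> = \<phi> y" using assms[OF \<rho>] ..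
    have "\<rho> = point_evaluation (Mult H) y"
      using \<rho> y by (intro extensionalityI[of _ "Mult H"])
        (auto simp: maximal_ideal_space_def point_evaluation_def)
    thus ?thesis by simp
  qed
  ultimately show ?thesis unfolding corona_theorem_def by blast
qed

text \<open>
  If all elements of the space are multipliers, then the product is jointly continuous in the norm of the
  space, so characters are bounded in this norm, by the usual argument with the Neumann series. They are
  thus partially multiplicative, and the maximality of the domain applies.
\<close>

theorem Mult_eq_imp_corona:
  assumes eq: "Mult H = H" and md: "maximal_domain H ip"
  shows "corona_theorem (Mult H)"
proof (rule corona_if_characters_are_evaluations)
  fix \<rho> assume \<rho>: "\<rho> \<in> maximal_ideal_space (Mult H)"
  have \<rho>_add: "\<rho> (\<lambda>x. f x + g x) = \<rho> f + \<rho> g" if "f \<in> H" "g \<in> H" for f g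
    using \<rho> that by (simp add: maximal_ideal_space_def linear_functional_on_def eq)
  have \<rho>_scale: "\<rho> (\<lambda>x. c * f x) = c * \<rho> f" if "f \<in> H" for c f
    using \<rho> that by (simp add: maximal_ideal_space_def linear_functional_on_def eq)
  have \<rho>_mult: "\<rho> (\<lambda>x. f x * g x) = \<rho> f * \<rho> g" if "f \<in> H" "g \<in> H" for f g
    using \<rho> that by (simp add: maximal_ideal_space_def eq)
  obtain f0 where f0: "f0 \<in> H" "\<rho> f0 \<noteq> 0"
    using \<rho> by (auto simp: maximal_ideal_space_def eq)
  have \<rho>_one: "\<rho> (\<lambda>x. 1) = 1" using \<rho>_mult[OF f0(1) one_mem] f0(2) by simp
  have "\<exists>C\<ge>0. \<forall>g\<in>{g \<in> H. nrm g \<le> 1}. \<forall>f\<in>H. nrm (\<lambda>x. g x * f x) \<le> C * nrm f"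
  proof (rule multipliers_uniformly_bounded)
    show "{g \<in> H. nrm g \<le> 1} \<subseteq> Mult H" by (auto simp: eq)
    fix f assume "f \<in> H"
    hence "f \<in> Mult H" by (simp add: eq)
    then obtain B where B: "mult_bounded f B" by (rule Mult_imp_mult_bounded)
    have "nrm (\<lambda>x. g x * f x) \<le> B" if "g \<in> H" "nrm g \<le> 1" for g
    proof -
      have "nrm (\<lambda>x. g x * f x) \<le> B * nrm g" using mult_boundedD(4)[OF B that(1)] by (simp add: mult.commute)
      also have "\<dots> \<le> B * 1" using that(2) mult_boundedD(2)[OF B] by (intro mult_left_mono)
      finally show ?thesis by simp
    qed
    thus "\<exists>B. \<forall>g\<in>{g \<in> H. nrm g \<le> 1}. nrm (\<lambda>x. g x * f x) \<le> B" by (intro exI[of _ B]) simp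
  qed
  then obtain C where C: "C \<ge> 0" "\<forall>g\<in>{g \<in> H. nrm g \<le> 1}. \<forall>f\<in>H. nrm (\<lambda>x. g x * f x) \<le> C * nrm f"
    by (elim exE conjE)
  have unit: "mult_bounded g C" if "g \<in> H" "nrm g \<le> 1" for g
    using C that by (simp add: mult_bounded_def eq)
  have Cg: "mult_bounded g (C * nrm g)" if g: "g \<in> H" for g
  proof (cases "nrm g = 0")
    case True
    hence "g = (\<lambda>x. 0)" by (rule nrm_eq_0[OF g])
    thus ?thesis using mult_bounded_const[of 0] True by simp
  next
    case False
    hence s: "nrm g > 0" using nrm_nonneg[OF g] by simp
    let ?g = "\<lambda>x. of_real (1 / nrm g) * g x"
    have gH: "?g \<in> H" by (intro mem g)
    have "nrm ?g \<le> 1" using s unfolding nrm_scale[OF g] by (simp add: norm_divide)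
    hence "mult_bounded ?g C" by (rule unit[OF gH])
    hence "mult_bounded (\<lambda>x. of_real (nrm g) * ?g x) (cmod (of_real (nrm g)) * C)"
      by (rule mult_bounded_mult[OF mult_bounded_const])
    moreover have "(\<lambda>x. of_real (nrm g) * ?g x) = g" using s by (simp add: fun_eq_iff)
    ultimately show ?thesis using s by (simp add: mult.commute)
  qed
  have \<rho>_bound: "cmod (\<rho> f) \<le> C * nrm f" if f: "f \<in> H" for f
  proof (rule ccontr)
    assume "\<not> ?thesis"
    hence lt: "C * nrm f < cmod (\<rho> f)" by simp
    have nz: "cmod (\<rho> f) > 0" using lt C(1) nrm_nonneg[OF f] by (meson le_less_trans mult_nonneg_nonneg)
    let ?\<phi> = "\<lambda>x. 1 / \<rho> f * f x"
    have "mult_bounded ?\<phi> (cmod (1 / \<rho> f) * (C * nrm f))"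
      by (rule mult_bounded_mult[OF mult_bounded_const Cg[OF f]])
    moreover have "cmod (1 / \<rho> f) * (C * nrm f) < 1"
      using lt nz by (simp add: norm_divide divide_less_eq)
    ultimately have b: "mult_bounded (\<lambda>x. 1 / (1 - ?\<phi> x)) (1 / (1 - cmod (1 / \<rho> f) * (C * nrm f)))"
      and pw: "1 - ?\<phi> x \<noteq> 0" for x
      using neumann_inverse[OF _ _ diag] mult_bounded_pointwise[OF _ diag, of ?\<phi> _ x] by force+
    let ?\<psi> = "\<lambda>x. 1 / (1 - ?\<phi> x)"
    have \<psi>: "?\<psi> \<in> H" using mult_boundedD(1)[OF b] by (simp add: eq)
    have d: "(\<lambda>x. 1 + (- (1 / \<rho> f)) * f x) \<in> H" by (intro mem one_mem f)
    have "\<rho> (\<lambda>x. 1 + (- (1 / \<rho> f)) * f x) = 0"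
      using nz by (subst \<rho>_add) (simp_all only: mem one_mem f \<rho>_scale \<rho>_one, simp)
    hence "\<rho> (\<lambda>x. (1 + (- (1 / \<rho> f)) * f x) * ?\<psi> x) = 0" using \<rho>_mult[OF d \<psi>] by simp
    moreover have "(\<lambda>x. (1 + (- (1 / \<rho> f)) * f x) * ?\<psi> x) = (\<lambda>x. 1)" using pw by (simp add: fun_eq_iff)
    ultimately show False using \<rho>_one by simp
  qed
  have "partially_multiplicative H ip \<rho>"
    unfolding partially_multiplicative_def linear_functional_on_def
    using \<rho>_add \<rho>_scale \<rho>_mult f0 by (intro conjI exI[of _ C] bexI[of _ f0] ballI allI impI \<rho>_bound) auto
  thus "\<exists>y. \<forall>\<phi>\<in>Mult H. \<rho> \<phi> = \<phi> y" using md unfolding maximal_domain_def eq by simp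
qed

text \<open>
  A non-invertible multiplier lies in a maximal ideal \<open>J\<close>. The distance to \<open>J\<close> in the multiplier norm is a
  submultiplicative seminorm \<open>q\<close>; it does not vanish at \<open>1\<close> because multipliers near \<open>1\<close> are
  invertible. By the Gelfand--Mazur theorem every multiplier is congruent to a scalar modulo \<open>J\<close>, and this
  scalar defines a character that vanishes on \<open>J\<close>. Being a point evaluation, it exhibits a zero of the
  given multiplier.
\<close>

theorem corona_imp_one_function_corona:
  assumes corona: "corona_theorem (Mult H)"
  shows "one_function_corona_theorem (Mult H)"
  unfolding one_function_corona_theorem_def
proof (intro ballI impI, rule ccontr)
  let ?A = "Mult H"
  fix \<phi> assume \<phi>: "\<phi> \<in> ?A" and nv: "\<forall>x. \<phi> x \<noteq> 0" and ni: "(\<lambda>x. 1 / \<phi> x) \<notin> ?A"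
  define e where "e = (\<lambda>c (x::'x). c :: complex)"
  have eA: "e c \<in> ?A" for c unfolding e_def by (rule Mult_const)
  have addA: "a + b \<in> ?A" if "a \<in> ?A" "b \<in> ?A" for a b
    using Mult_add[OF that] by (simp add: plus_fun_def)
  have multA: "a * b \<in> ?A" if "a \<in> ?A" "b \<in> ?A" for a b
    using Mult_mult[OF that] by (simp add: times_fun_def)
  have e1: "e 1 = 1" by (simp add: e_def one_fun_def)
  have em1: "e (- 1) = - 1" by (simp add: e_def one_fun_def fun_Compl_def)
  have "\<exists>J. J \<subseteq> ?A \<and> \<phi> \<in> J \<and> 1 \<notin> J \<and> (\<forall>a\<in>J. \<forall>b\<in>J. a + b \<in> J) \<and> (\<forall>a\<in>?A. \<forall>b\<in>J. a * b \<in> J) \<and>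
    (\<forall>y\<in>?A. y \<notin> J \<longrightarrow> (\<exists>a\<in>?A. a * y - 1 \<in> J))"
  proof (rule exists_maximal_ideal_containing)
    show "1 \<in> ?A" using eA[of 1] e1 by simp
    show "- 1 \<in> ?A" using eA[of "- 1"] em1 by simp
    show "a * \<phi> \<noteq> 1" if a: "a \<in> ?A" for a
    proof
      assume "a * \<phi> = 1"
      hence "a x * \<phi> x = 1" for x by (metis times_fun_def one_fun_def)
      hence "a = (\<lambda>x. 1 / \<phi> x)" using nv by (auto simp: fun_eq_iff eq_divide_eq)
      thus False using a ni by simp
    qed
  qed (use \<phi> addA multA in auto)
  then obtain J where JA: "J \<subseteq> ?A" and \<phi>J: "\<phi> \<in> J" and J1: "1 \<notin> J"
    and J_add: "\<forall>a\<in>J. \<forall>b\<in>J. a + b \<in> J" and J_mult: "\<forall>a\<in>?A. \<forall>b\<in>J. a * b \<in> J"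
    and J_max: "\<forall>y\<in>?A. y \<notin> J \<longrightarrow> (\<exists>a\<in>?A. a * y - 1 \<in> J)"
    by (elim exE conjE)
  note J_addI = J_add[rule_format] and J_multI = J_mult[rule_format]
  have J0: "0 \<in> J"
    using J_multI[OF eA[of 0] \<phi>J] by (simp add: e_def times_fun_def zero_fun_def)
  \<comment> \<open>\<open>S a\<close> collects the bounds of all multipliers congruent to \<open>a\<close>, so \<open>q\<close> is the quotient seminorm.\<close>
  define S where "S = (\<lambda>a. {C. \<exists>b. a - b \<in> J \<and> mult_bounded b C})"
  define q where "q a = Inf (S a)" for a
  have S_nonneg: "0 \<le> C" if "C \<in> S a" for a C using that mult_boundedD(2) by (auto simp: S_def)
  have bdd: "bdd_below (S a)" for a using S_nonneg by (rule bdd_belowI)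
  have S_ne: "S a \<noteq> {}" if a: "a \<in> ?A" for a
  proof -
    obtain C where "mult_bounded a C" using Mult_imp_mult_bounded[OF a] .
    hence "C \<in> S a" using J0 by (auto simp: S_def intro!: exI[of _ a])
    thus ?thesis by auto
  qed
  have q_le: "q a \<le> C" if "C \<in> S a" for a C unfolding q_def by (rule cInf_lower[OF that bdd])
  have S_add: "C + D \<in> S (a + b)" if CD: "C \<in> S a" "D \<in> S b" for a b C D
  proof -
    obtain a' b' where a': "a - a' \<in> J" "mult_bounded a' C" and b': "b - b' \<in> J" "mult_bounded b' D"
      using CD by (auto simp: S_def)
    have "(a - a') + (b - b') \<in> J" by (rule J_addI[OF a'(1) b'(1)])
    hence "(a + b) - (a' + b') \<in> J" by (simp add: algebra_simps)
    moreover have "mult_bounded (a' + b') (C + D)"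
      using mult_bounded_add[OF a'(2) b'(2)] by (simp add: plus_fun_def)
    ultimately show ?thesis unfolding S_def by (intro CollectI exI conjI)
  qed
  have S_mult: "C * D \<in> S (a * b)" if CD: "C \<in> S a" "D \<in> S b" and b: "b \<in> ?A" for a b C D
  proof -
    obtain a' b' where a': "a - a' \<in> J" "mult_bounded a' C" and b': "b - b' \<in> J" "mult_bounded b' D"
      using CD by (auto simp: S_def)
    have "b * (a - a') + a' * (b - b') \<in> J"
      by (rule J_addI[OF J_multI[OF b a'(1)] J_multI[OF mult_boundedD(1)[OF a'(2)] b'(1)]])
    hence "a * b - a' * b' \<in> J" by (simp add: algebra_simps)
    moreover have "mult_bounded (a' * b') (C * D)"
      using mult_bounded_mult[OF a'(2) b'(2)] by (simp add: times_fun_def)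
    ultimately show ?thesis unfolding S_def by (intro CollectI exI conjI)
  qed
  have S_one: "1 \<le> C" if C: "C \<in> S 1" for C
  proof (rule ccontr)
    assume C1: "\<not> 1 \<le> C"
    obtain b where b: "1 - b \<in> J" "mult_bounded b C" using C by (auto simp: S_def)
    have inv: "(\<lambda>x. 1 / (1 - b x)) \<in> ?A"
      using mult_boundedD(1)[OF neumann_inverse[OF b(2) _ diag]] C1 by simp
    have "1 - b x \<noteq> 0" for x using mult_bounded_pointwise[OF b(2) diag, of x] C1 by auto
    hence "(\<lambda>x. 1 / (1 - b x)) * (1 - b) = 1"
      by (simp add: fun_eq_iff times_fun_def one_fun_def)
    thus False using J_multI[OF inv b(1)] J1 by simp
  qed
  interpret seminormed_algebra ?A e q
  proof
    fix a b :: "'x \<Rightarrow> complex" and c d :: complex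
    show "e c \<in> ?A" by (rule eA)
    show "a \<in> ?A \<Longrightarrow> b \<in> ?A \<Longrightarrow> a + b \<in> ?A" by (rule addA)
    show "a \<in> ?A \<Longrightarrow> b \<in> ?A \<Longrightarrow> a * b \<in> ?A" by (rule multA)
    show "e (c + d) = e c + e d" by (simp add: e_def plus_fun_def)
    show "e (c * d) = e c * e d" by (simp add: e_def times_fun_def)
    show "e 1 = 1" by (rule e1)
    show "0 \<le> q a" if "a \<in> ?A"
      unfolding q_def by (rule cInf_greatest[OF S_ne[OF that] S_nonneg])
    show "q (a + b) \<le> q a + q b" if ab: "a \<in> ?A" "b \<in> ?A"
    proof -
      have *: "q (a + b) - C \<le> q b" if C: "C \<in> S a" for C
        unfolding q_def[of b]
      proof (rule cInf_greatest[OF S_ne[OF ab(2)]])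
        fix D assume "D \<in> S b"
        from q_le[OF S_add[OF C this]] show "q (a + b) - C \<le> D" by (simp only: diff_le_eq add.commute)
      qed
      have "q (a + b) - q b \<le> q a"
        unfolding q_def[of a]
      proof (rule cInf_greatest[OF S_ne[OF ab(1)]])
        fix C assume "C \<in> S a"
        from *[OF this] show "q (a + b) - q b \<le> C" by linarith
      qed
      thus ?thesis by simp
    qed
    show mult: "q (a * b) \<le> q a * q b" if ab: "a \<in> ?A" "b \<in> ?A" for a b
    proof -
      have 1: "q (a * b) \<le> C * q b" if C: "C \<in> S a" for C
        unfolding q_def[of b]
        by (rule le_mult_Inf[OF S_ne[OF ab(2)] S_nonneg[OF C]]) (rule q_le[OF S_mult[OF C _ ab(2)]])
      have "0 \<le> q b" unfolding q_def by (rule cInf_greatest[OF S_ne[OF ab(2)] S_nonneg])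
      hence "q (a * b) \<le> q b * q a"
        unfolding q_def[of a] using 1 by (intro le_mult_Inf S_ne ab) (simp_all add: mult.commute)
      thus ?thesis by (simp only: mult.commute)
    qed
    show "q (e c * a) \<le> cmod c * q a" if a: "a \<in> ?A"
    proof -
      have "cmod c \<in> S (e c)"
        using mult_bounded_const[of c] J0 unfolding S_def by (auto simp: e_def intro!: exI[of _ "e c"])
      thus ?thesis unfolding q_def[of a]
        using a by (intro le_mult_Inf S_ne a q_le S_mult) auto
    qed
    have "1 \<le> q 1" unfolding q_def using S_one S_ne[of 1] eA[of 1] e1 by (intro cInf_greatest) auto
    thus "q 1 > 0" by simp
  qed
  have J_null: "J \<subseteq> null"
  proof
    fix j assume j: "j \<in> J"
    have "mult_bounded 0 0" using mult_bounded_const[of 0] by (simp add: zero_fun_def)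
    hence "0 \<in> S j" using j unfolding S_def by (auto intro!: exI[of _ 0])
    thus "j \<in> null" using j JA q_le by (intro null_memI) auto
  qed
  have ex: "\<exists>l. a - e l \<in> J" if a: "a \<in> ?A" for a
  proof -
    obtain l where l: "\<forall>r\<in>?A. r * (a - e l) - 1 \<notin> null" using gelfand_mazur[OF a] ..
    have "a - e l \<in> J"
    proof (rule ccontr)
      assume "a - e l \<notin> J"
      with J_max minus_mem[OF a eA] obtain r where r: "r \<in> ?A" "r * (a - e l) - 1 \<in> J" by blast
      show False using bspec[OF l r(1)] subsetD[OF J_null r(2)] ..
    qed
    thus ?thesis ..
  qed
  have J_uminus: "- a \<in> J" if "a \<in> J" for a
    using J_multI[OF eA[of "- 1"] that] by (simp add: em1)
  have uniq: "l = m" if lm: "a - e l \<in> J" "a - e m \<in> J" for a l m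
  proof (rule ccontr)
    assume ne: "l \<noteq> m"
    have "(a - e l) + - (a - e m) \<in> J" by (rule J_addI[OF lm(1) J_uminus[OF lm(2)]])
    hence "e (m - l) \<in> J" by (simp add: e_diff)
    hence "e (1 / (m - l)) * e (m - l) \<in> J" by (rule J_multI[OF eA])
    thus False using ne J1 by (simp add: e_1 flip: e_mult)
  qed
  define \<rho> where "\<rho> = (\<lambda>a\<in>?A. THE l. a - e l \<in> J)"
  have \<rho>I: "\<rho> a = l" if "a \<in> ?A" "a - e l \<in> J" for a l
    using that uniq by (auto simp: \<rho>_def intro!: the_equality)
  have \<rho>_mem: "a - e (\<rho> a) \<in> J" if a: "a \<in> ?A" for a
  proof -
    obtain l where "a - e l \<in> J" using ex[OF a] ..
    thus ?thesis using \<rho>I[OF a] by simp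
  qed
  have "\<rho> \<in> maximal_ideal_space ?A"
    unfolding maximal_ideal_space_def linear_functional_on_def
  proof (intro CollectI conjI ballI allI)
    show "\<rho> \<in> extensional ?A" by (simp add: \<rho>_def)
    show add: "\<rho> (\<lambda>x. a x + b x) = \<rho> a + \<rho> b" if ab: "a \<in> ?A" "b \<in> ?A" for a b
    proof -
      have "(a - e (\<rho> a)) + (b - e (\<rho> b)) \<in> J" by (intro J_addI \<rho>_mem ab)
      hence "\<rho> (a + b) = \<rho> a + \<rho> b" by (intro \<rho>I addA ab) (simp add: e_add algebra_simps)
      thus ?thesis by (simp add: plus_fun_def)
    qed
    show mult: "\<rho> (\<lambda>x. a x * b x) = \<rho> a * \<rho> b" if ab: "a \<in> ?A" "b \<in> ?A" for a b
    proof -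
      have "b * (a - e (\<rho> a)) + e (\<rho> a) * (b - e (\<rho> b)) \<in> J"
        by (intro J_addI J_multI \<rho>_mem ab eA)
      hence "\<rho> (a * b) = \<rho> a * \<rho> b" by (intro \<rho>I multA ab) (simp add: e_mult algebra_simps)
      thus ?thesis by (simp add: times_fun_def)
    qed
    have const: "\<rho> (e c) = c" for c using J0 by (intro \<rho>I eA) simp
    show "\<rho> (\<lambda>x. c * a x) = c * \<rho> a" if "a \<in> ?A" for c a
      using mult[OF eA[of c] that] const[of c] by (simp add: e_def)
    show "\<exists>\<phi>\<in>?A. \<rho> \<phi> \<noteq> 0" using const[of 1] eA[of 1] by (intro bexI[of _ "e 1"]) auto
  qed
  then obtain y where y: "\<rho> = point_evaluation ?A y" using corona unfolding corona_theorem_def by auto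
  have "\<rho> \<phi> = 0" using \<phi>J by (intro \<rho>I \<phi>) (simp add: e_0)
  hence "\<phi> y = 0" using \<phi> by (simp add: y point_evaluation_def)
  thus False using nv by simp
qed

end

section \<open>The equivalence\<close>

theorem proposition1p5:
  fixes H :: "('x :: topological_space \<Rightarrow> complex) set"
    and ip :: "('x \<Rightarrow> complex) \<Rightarrow> ('x \<Rightarrow> complex) \<Rightarrow> complex"
    and k :: "'x \<Rightarrow> 'x \<Rightarrow> complex"
  assumes "rkhs H ip k"
    and "\<forall>x. k x x \<noteq> 0"
    and "normalized_kernel k"
    and "complete_pick H ip k"
    and "compact (UNIV :: 'x set)"
    and "\<forall>f\<in>H. continuous_on UNIV f"
    and "maximal_domain H ip"
    and "separates_points (Mult H)"
  shows "(Mult H = H \<longleftrightarrow> corona_theorem (Mult H)) \<and>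
         (corona_theorem (Mult H) \<longleftrightarrow> one_function_corona_theorem (Mult H))"
proof -
  obtain x0 where x0: "\<forall>x. k x x0 = 1" using assms(3) unfolding normalized_kernel_def ..
  interpret normalized_pick_space H ip k x0
    by (intro normalized_pick_space.intro normalized_pick_space_axioms.intro) (use assms x0 in auto)
  show ?thesis
    using Mult_eq_imp_corona[OF _ assms(7)] corona_imp_one_function_corona
      one_function_corona_imp_Mult_eq by argo
qed

end
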